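(* The logic $\mathrm{BL}_{\mathrm{Chang}}$ is finitely strongly complete with respect to $\omega\mathcal{V}$. As a consequence, the variety of $\mathrm{BL}_{\mathrm{Chang}}$-algebras is generated by the class of all ordinal sums of perfect MV-chains, and hence it is the smallest variety containing this class of algebras.
   Context: **BL-algebras.** A BL-algebra is $\mathcal A=\langle A,*,\Rightarrow,\sqcap,\sqcup,0,1\rangle$ such that $\langle A,\sqcap,\sqcup,0,1\rangle$ is a bounded lattice, $\langle A,*,1\rangle$ is a commutative monoid, $z*x\le y$ iff $z\le x\Rightarrow y$, and $(x\Rightarrow y)\sqcup(y\Rightarrow x)=1$, $x\sqcap y=x*(x\Rightarrow y)$. A BL-chain is a totally ordered BL-algebra. Write $\sim x=x\Rightarrow 0$. An MV-algebra is a BL-algebra satisfying $x=\sim\sim x$; an MV-chain is a totally ordered one. An MV-algebra is perfect if for every element $x$: $ord(x)<\infty$ iff $ord(\sim x)=\infty$, where $ord(x)$ is the least positive $n$ with $x^n=x*\dots*x=0$, and $ord(x)=\infty$ if no such $n$ exists. **Logic.** Formulas are built from a denumerable set $VAR$ of variables with $\&,\to,\bot$. Derived connectives: $\neg\varphi=\varphi\to\bot$, $\varphi\land\psi=\varphi\&(\varphi\to\psi)$, $\varphi\vee\psi=((\varphi\to\psi)\to\psi)\land((\psi\to\varphi)\to\varphi)$, $\varphi\leftrightarrow\psi=(\varphi\to\psi)\&(\psi\to\varphi)$, $\varphi^2=\varphi\&\varphi$, and $\varphi\veebar\psi=((\varphi\to(\varphi\&\psi))\to\psi)\land((\psi\to(\varphi\&\psi))\to\varphi)$,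 $\overline 2\varphi=\varphi\veebar\varphi$. BL has modus ponens as only rule and axioms: $(\varphi\to\psi)\to((\psi\to\chi)\to(\varphi\to\chi))$; $(\varphi\&\psi)\to\varphi$; $(\varphi\&\psi)\to(\psi\&\varphi)$; $(\varphi\&(\varphi\to\psi))\to(\psi\&(\psi\to\varphi))$; $(\varphi\to(\psi\to\chi))\to((\varphi\&\psi)\to\chi)$; $((\varphi\&\psi)\to\chi)\to(\varphi\to(\psi\to\chi))$; $((\varphi\to\psi)\to\chi)\to(((\psi\to\varphi)\to\chi)\to\chi)$; $\bot\to\varphi$. $\mathrm{BL}_{\mathrm{Chang}}$ is BL plus the axiom schema $(\overline2\varphi)^2\leftrightarrow\overline2(\varphi^2)$. $T\vdash_L\varphi$ denotes derivability of $\varphi$ from a set of formulas $T$ in $L$. **Semantics.** An $\mathcal A$-evaluation $v$ maps $VAR$ to $A$ and is extended to formulas by interpreting $\&,\to,\bot$ as $*,\Rightarrow,0$. An $L$-algebra (for $L$ an axiomatic extension of BL) is a BL-algebra in which every axiom of $L$ has value $1$ under every evaluation. For an $L$-algebra $\mathcal A$, $T\models_{\mathcal A}\varphi$ means: every $\mathcal A$-evaluation $v$ with $v(\psi)=1$ for all $\psi\in T$ satisfies $v(\varphi)=1$. $L$ is finitely strongly complete with respect to $\mathcal A$ if for every finite $T$ and every $\varphi$: $T\vdash_L\varphi$ iff $T\models_{\mathcal A}\varphi$. **Hoops.** A hoop is $\langle A,*,\Rightarrow,1\rangle$ with $\langle A,*,1\rangle$ a commutative monoid and $x\Rightarrow x=1$,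 $x\Rightarrow(y\Rightarrow z)=(x*y)\Rightarrow z$, $x*(x\Rightarrow y)=y*(y\Rightarrow x)$; its order is $x\le y$ iff $x\Rightarrow y=1$. It is cancellative if $x=y\Rightarrow(x*y)$ holds. The standard cancellative hoop $(0,1]_C$ is $(0,1]$ with ordinary product and $x\Rightarrow y=\min(1,y/x)$. **Disconnected rotation.** For a cancellative hoop $\mathcal A$, let $A'=\{a':a\in A\}$ be a disjoint copy of $A$ with the inverse order, and $A^*=A\cup A'$ with $a'<b$ for all $a,b\in A$. Put $1=1_{\mathcal A}$, $0=1'$, $\sim a=a'$ and $\sim a'=a$ for $a\in A$; lattice operations come from the order. The product $a*b$ is: $a*_{\mathcal A}b$ if $a,b\in A$; $\sim(a\Rightarrow_{\mathcal A}\sim b)$ if $a\in A,b\in A'$; $\sim(b\Rightarrow_{\mathcal A}\sim a)$ if $a\in A',b\in A$; $0$ if $a,b\in A'$. The implication $a\Rightarrow b$ is: $a\Rightarrow_{\mathcal A}b$ if $a,b\in A$; $\sim(a*_{\mathcal A}\sim b)$ if $a\in A,b\in A'$; $1$ if $a\in A',b\in A$; $(\sim b)\Rightarrow_{\mathcal A}(\sim a)$ if $a,b\in A'$. The result $\mathcal A^*$ is the disconnected rotation of $\mathcal A$. Let $\mathcal V=((0,1]_C)^*$. **Ordinal sums.** Let $\langle I,\le\rangle$ be a totally ordered set with minimum $0$, and $(\mathcal A_i)_{i\in I}$ hoops with $A_i\cap A_j=\{1\}$ for $i\ne j$ (taking isomorphic copies if necessary) and $\mathcal A_0$ bounded (i.e.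 with a minimum). MV-algebras are used here through their $0$-free reducts. $\bigoplus_{i\in I}\mathcal A_i$ has universe $\bigcup_iA_i$, bottom $\min\mathcal A_0$, top $1$; operations inside a component are those of the component; if $x\in A_i\setminus\{1\}$, $y\in A_j$, $i<j$, then $x\Rightarrow y=1$ and $x*y=y*x=x$; if $x\in A_i$, $y\in A_j$, $i>j$, then $x\Rightarrow y=y$ (for $y\neq 1$). $\omega\mathcal V$ is the ordinal sum, indexed by the natural numbers, of copies of $\mathcal V$. *)

theory Defs
  imports Complex_Main "HOL-Library.FuncSet" "HOL-Library.Extended_Nat" "HOL-Algebra.Group"
begin

section \<open>Hoops\<close>

record 'a hoop = "'a monoid" +
  impl :: "'a \<Rightarrow> 'a \<Rightarrow> 'a" (infixr "\<rightarrow>\<index>" 65)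

definition hoop_le :: "('a, 'm) hoop_scheme \<Rightarrow> 'a \<Rightarrow> 'a \<Rightarrow> bool" where
  "hoop_le A x y \<longleftrightarrow> x \<rightarrow>\<^bsub>A\<^esub> y = \<one>\<^bsub>A\<^esub>"

locale hoop = comm_monoid A for A :: "('a, 'm) hoop_scheme" (structure) +
  assumes impl_closed: "\<lbrakk>x \<in> carrier A; y \<in> carrier A\<rbrakk> \<Longrightarrow> x \<rightarrow> y \<in> carrier A"
    and impl_refl: "x \<in> carrier A \<Longrightarrow> x \<rightarrow> x = \<one>"
    and impl_curry: "\<lbrakk>x \<in> carrier A; y \<in> carrier A; z \<in> carrier A\<rbrakk>
      \<Longrightarrow> x \<rightarrow> (y \<rightarrow> z) = (x \<otimes> y) \<rightarrow> z"
    and divisibility: "\<lbrakk>x \<in> carrier A; y \<in> carrier A\<rbrakk> \<Longrightarrow> x \<otimes> (x \<rightarrow> y) = y \<otimes> (y \<rightarrow> x)"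

locale cancellative_hoop = hoop +
  assumes cancel: "\<lbrakk>x \<in> carrier A; y \<in> carrier A\<rbrakk> \<Longrightarrow> x = y \<rightarrow> (x \<otimes> y)"

definition standard_cancellative_hoop :: "real hoop" where
  "standard_cancellative_hoop =
     \<lparr>carrier = {0<..1}, monoid.mult = (\<lambda>x y. x * y), one = 1, impl = (\<lambda>x y. min 1 (y / x))\<rparr>"


section \<open>BL-algebras, MV-algebras and perfect MV-chains\<close>

record 'a bl = "'a hoop" +
  zero :: 'a ("\<zero>\<index>")
  inf_op :: "'a \<Rightarrow> 'a \<Rightarrow> 'a" (infixl "\<curlywedge>\<index>" 70)
  sup_op :: "'a \<Rightarrow> 'a \<Rightarrow> 'a" (infixl "\<curlyvee>\<index>" 65)

definition bl_le :: "('a, 'm) bl_scheme \<Rightarrow> 'a \<Rightarrow> 'a \<Rightarrow> bool" where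
  "bl_le A x y \<longleftrightarrow> x \<curlywedge>\<^bsub>A\<^esub> y = x"

definition bl_neg :: "('a, 'm) bl_scheme \<Rightarrow> 'a \<Rightarrow> 'a" where
  "bl_neg A x = x \<rightarrow>\<^bsub>A\<^esub> \<zero>\<^bsub>A\<^esub>"

text \<open>Closure of the carrier under the monoid operations is part of \<^locale>\<open>comm_monoid\<close>.\<close>

locale BL_algebra = comm_monoid A for A :: "('a, 'm) bl_scheme" (structure) +
  assumes zero_closed: "\<zero> \<in> carrier A"
    and impl_closed: "\<lbrakk>x \<in> carrier A; y \<in> carrier A\<rbrakk> \<Longrightarrow> x \<rightarrow> y \<in> carrier A"
    and inf_closed: "\<lbrakk>x \<in> carrier A; y \<in> carrier A\<rbrakk> \<Longrightarrow> x \<curlywedge> y \<in> carrier A"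
    and sup_closed: "\<lbrakk>x \<in> carrier A; y \<in> carrier A\<rbrakk> \<Longrightarrow> x \<curlyvee> y \<in> carrier A"
    and inf_commute: "\<lbrakk>x \<in> carrier A; y \<in> carrier A\<rbrakk> \<Longrightarrow> x \<curlywedge> y = y \<curlywedge> x"
    and sup_commute: "\<lbrakk>x \<in> carrier A; y \<in> carrier A\<rbrakk> \<Longrightarrow> x \<curlyvee> y = y \<curlyvee> x"
    and inf_assoc: "\<lbrakk>x \<in> carrier A; y \<in> carrier A; z \<in> carrier A\<rbrakk>
      \<Longrightarrow> (x \<curlywedge> y) \<curlywedge> z = x \<curlywedge> (y \<curlywedge> z)"
    and sup_assoc: "\<lbrakk>x \<in> carrier A; y \<in> carrier A; z \<in> carrier A\<rbrakk>
      \<Longrightarrow> (x \<curlyvee> y) \<curlyvee> z = x \<curlyvee> (y \<curlyvee> z)"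
    and inf_sup_absorb: "\<lbrakk>x \<in> carrier A; y \<in> carrier A\<rbrakk> \<Longrightarrow> x \<curlywedge> (x \<curlyvee> y) = x"
    and sup_inf_absorb: "\<lbrakk>x \<in> carrier A; y \<in> carrier A\<rbrakk> \<Longrightarrow> x \<curlyvee> (x \<curlywedge> y) = x"
    and zero_least: "x \<in> carrier A \<Longrightarrow> bl_le A \<zero> x"
    and one_greatest: "x \<in> carrier A \<Longrightarrow> bl_le A x \<one>"
    and residuation: "\<lbrakk>x \<in> carrier A; y \<in> carrier A; z \<in> carrier A\<rbrakk>
      \<Longrightarrow> bl_le A (z \<otimes> x) y \<longleftrightarrow> bl_le A z (x \<rightarrow> y)"
    and prelinearity: "\<lbrakk>x \<in> carrier A; y \<in> carrier A\<rbrakk> \<Longrightarrow> (x \<rightarrow> y) \<curlyvee> (y \<rightarrow> x) = \<one>"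
    and divisibility: "\<lbrakk>x \<in> carrier A; y \<in> carrier A\<rbrakk> \<Longrightarrow> x \<curlywedge> y = x \<otimes> (x \<rightarrow> y)"

locale BL_chain = BL_algebra +
  assumes total: "\<lbrakk>x \<in> carrier A; y \<in> carrier A\<rbrakk> \<Longrightarrow> bl_le A x y \<or> bl_le A y x"

locale MV_algebra = BL_algebra +
  assumes involutive: "x \<in> carrier A \<Longrightarrow> x = bl_neg A (bl_neg A x)"

locale MV_chain = MV_algebra + BL_chain

definition bl_ord :: "('a, 'm) bl_scheme \<Rightarrow> 'a \<Rightarrow> enat" where
  "bl_ord A x =
     (if \<exists>n::nat>0. x [^]\<^bsub>A\<^esub> n = \<zero>\<^bsub>A\<^esub>
      then enat (LEAST n. n > 0 \<and> x [^]\<^bsub>A\<^esub> n = \<zero>\<^bsub>A\<^esub>) else \<infinity>)"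

locale perfect_MV_algebra = MV_algebra +
  assumes perfect: "x \<in> carrier A \<Longrightarrow> bl_ord A x < \<infinity> \<longleftrightarrow> bl_ord A (bl_neg A x) = \<infinity>"

locale perfect_MV_chain = perfect_MV_algebra + MV_chain


section \<open>Disconnected rotation and ordinal sums\<close>

definition glb_in :: "'a set \<Rightarrow> ('a \<Rightarrow> 'a \<Rightarrow> bool) \<Rightarrow> 'a \<Rightarrow> 'a \<Rightarrow> 'a" where
  "glb_in C R x y =
     (THE z. z \<in> C \<and> R z x \<and> R z y \<and> (\<forall>w\<in>C. R w x \<and> R w y \<longrightarrow> R w z))"

definition lub_in :: "'a set \<Rightarrow> ('a \<Rightarrow> 'a \<Rightarrow> bool) \<Rightarrow> 'a \<Rightarrow> 'a \<Rightarrow> 'a" where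
  "lub_in C R x y =
     (THE z. z \<in> C \<and> R x z \<and> R y z \<and> (\<forall>w\<in>C. R x w \<and> R y w \<longrightarrow> R z w))"

text \<open>\<open>Copy a\<close> is the element \<open>a'\<close> of the disjoint copy.\<close>

datatype 'a rotation = Orig 'a | Copy 'a

fun rot_neg :: "'a rotation \<Rightarrow> 'a rotation" where
  "rot_neg (Orig a) = Copy a"
| "rot_neg (Copy a) = Orig a"

fun rot_le :: "('a, 'm) hoop_scheme \<Rightarrow> 'a rotation \<Rightarrow> 'a rotation \<Rightarrow> bool" where
  "rot_le A (Orig a) (Orig b) \<longleftrightarrow> hoop_le A a b"
| "rot_le A (Orig a) (Copy b) \<longleftrightarrow> False"
| "rot_le A (Copy a) (Orig b) \<longleftrightarrow> True"
| "rot_le A (Copy a) (Copy b) \<longleftrightarrow> hoop_le A b a"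

text \<open>The equations below are the case distinctions of the definition with
  \<open>\<sim>(Copy b) = Orig b\<close> substituted in the arguments of the operations of \<open>A\<close>.\<close>

fun rot_mult :: "('a, 'm) hoop_scheme \<Rightarrow> 'a rotation \<Rightarrow> 'a rotation \<Rightarrow> 'a rotation" where
  "rot_mult A (Orig a) (Orig b) = Orig (a \<otimes>\<^bsub>A\<^esub> b)"
| "rot_mult A (Orig a) (Copy b) = rot_neg (Orig (a \<rightarrow>\<^bsub>A\<^esub> b))"
| "rot_mult A (Copy a) (Orig b) = rot_neg (Orig (b \<rightarrow>\<^bsub>A\<^esub> a))"
| "rot_mult A (Copy a) (Copy b) = Copy \<one>\<^bsub>A\<^esub>"

fun rot_impl :: "('a, 'm) hoop_scheme \<Rightarrow> 'a rotation \<Rightarrow> 'a rotation \<Rightarrow> 'a rotation" where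
  "rot_impl A (Orig a) (Orig b) = Orig (a \<rightarrow>\<^bsub>A\<^esub> b)"
| "rot_impl A (Orig a) (Copy b) = rot_neg (Orig (a \<otimes>\<^bsub>A\<^esub> b))"
| "rot_impl A (Copy a) (Orig b) = Orig \<one>\<^bsub>A\<^esub>"
| "rot_impl A (Copy a) (Copy b) = Orig (b \<rightarrow>\<^bsub>A\<^esub> a)"

definition disconnected_rotation :: "('a, 'm) hoop_scheme \<Rightarrow> 'a rotation bl" where
  "disconnected_rotation A =
    (let C = Orig ` carrier A \<union> Copy ` carrier A in
     \<lparr>carrier = C, monoid.mult = rot_mult A, one = Orig \<one>\<^bsub>A\<^esub>, impl = rot_impl A,
      zero = Copy \<one>\<^bsub>A\<^esub>, inf_op = glb_in C (rot_le A), sup_op = lub_in C (rot_le A)\<rparr>)"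

definition chang_V :: "real rotation bl" where
  "chang_V = disconnected_rotation standard_cancellative_hoop"

text \<open>
  Ordinal sum of a family of hoops over an index set \<open>I\<close> ordered by \<open>r\<close>. The required isomorphic
  copies are built in: \<open>None\<close> is the common top element, and \<open>x \<noteq> 1\<close> in the \<open>i\<close>-th component
  becomes \<open>Some (i, x)\<close>. The lattice operations are those of the hoop order.
\<close>

definition os_emb ::
    "('i \<Rightarrow> ('a, 'm) hoop_scheme) \<Rightarrow> 'i \<Rightarrow> 'a \<Rightarrow> ('i \<times> 'a) option" where
  "os_emb A i x = (if x = \<one>\<^bsub>A i\<^esub> then None else Some (i, x))"

fun os_mult :: "('i \<times> 'i) set \<Rightarrow> ('i \<Rightarrow> ('a, 'm) hoop_scheme) \<Rightarrow>
    ('i \<times> 'a) option \<Rightarrow> ('i \<times> 'a) option \<Rightarrow> ('i \<times> 'a) option" where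
  "os_mult r A None y = y"
| "os_mult r A (Some p) None = Some p"
| "os_mult r A (Some (i, x)) (Some (j, y)) =
     (if i = j then os_emb A i (x \<otimes>\<^bsub>A i\<^esub> y)
      else if (i, j) \<in> r then Some (i, x) else Some (j, y))"

fun os_impl :: "('i \<times> 'i) set \<Rightarrow> ('i \<Rightarrow> ('a, 'm) hoop_scheme) \<Rightarrow>
    ('i \<times> 'a) option \<Rightarrow> ('i \<times> 'a) option \<Rightarrow> ('i \<times> 'a) option" where
  "os_impl r A None y = y"
| "os_impl r A (Some p) None = None"
| "os_impl r A (Some (i, x)) (Some (j, y)) =
     (if i = j then os_emb A i (x \<rightarrow>\<^bsub>A i\<^esub> y)
      else if (i, j) \<in> r then None else Some (j, y))"

definition os_bottom ::
    "'i set \<Rightarrow> ('i \<times> 'i) set \<Rightarrow> ('i \<Rightarrow> ('a, 'm) hoop_scheme) \<Rightarrow> ('i \<times> 'a) option" where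
  "os_bottom I r A =
     (let i0 = (THE i. i \<in> I \<and> (\<forall>j\<in>I. (i, j) \<in> r)) in
      os_emb A i0 (THE m. m \<in> carrier (A i0) \<and> (\<forall>x\<in>carrier (A i0). hoop_le (A i0) m x)))"

definition ordinal_sum ::
    "'i set \<Rightarrow> ('i \<times> 'i) set \<Rightarrow> ('i \<Rightarrow> ('a, 'm) hoop_scheme) \<Rightarrow> ('i \<times> 'a) option bl" where
  "ordinal_sum I r A =
    (let C = (\<Union>i\<in>I. os_emb A i ` carrier (A i));
         ord_le = (\<lambda>x y. os_impl r A x y = None)
     in \<lparr>carrier = C, monoid.mult = os_mult r A, one = None, impl = os_impl r A,
         zero = os_bottom I r A, inf_op = glb_in C ord_le, sup_op = lub_in C ord_le\<rparr>)"

type_synonym omegaV_elem = "(nat \<times> real rotation) option"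

definition omegaV :: "omegaV_elem bl" where
  "omegaV = ordinal_sum UNIV {(m, n). m \<le> n} (\<lambda>_. chang_V)"

definition ordinal_sums_of_perfect_MV_chains :: "('i \<times> 'a) option bl set" where
  "ordinal_sums_of_perfect_MV_chains =
     {ordinal_sum I r A | I r (A :: 'i \<Rightarrow> 'a bl).
        linear_order_on I r \<and> (\<exists>i0\<in>I. \<forall>i\<in>I. (i0, i) \<in> r) \<and> (\<forall>i\<in>I. perfect_MV_chain (A i))}"


section \<open>Logic\<close>

datatype fm =
    Var nat
  | Falsum
  | Fuse fm fm (infixr "\<^bold>&" 65)
  | Impl fm fm (infixr "\<^bold>\<rightarrow>" 55)

definition fm_and :: "fm \<Rightarrow> fm \<Rightarrow> fm" (infixr "\<^bold>\<and>" 62) where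
  "\<phi> \<^bold>\<and> \<psi> = \<phi> \<^bold>& (\<phi> \<^bold>\<rightarrow> \<psi>)"

definition fm_iff :: "fm \<Rightarrow> fm \<Rightarrow> fm" (infix "\<^bold>\<leftrightarrow>" 54) where
  "\<phi> \<^bold>\<leftrightarrow> \<psi> = (\<phi> \<^bold>\<rightarrow> \<psi>) \<^bold>& (\<psi> \<^bold>\<rightarrow> \<phi>)"

definition fm_square :: "fm \<Rightarrow> fm" where
  "fm_square \<phi> = \<phi> \<^bold>& \<phi>"

definition fm_veebar :: "fm \<Rightarrow> fm \<Rightarrow> fm" where
  "fm_veebar \<phi> \<psi> = ((\<phi> \<^bold>\<rightarrow> (\<phi> \<^bold>& \<psi>)) \<^bold>\<rightarrow> \<psi>) \<^bold>\<and> ((\<psi> \<^bold>\<rightarrow> (\<phi> \<^bold>& \<psi>)) \<^bold>\<rightarrow> \<phi>)"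

definition fm_double :: "fm \<Rightarrow> fm" where
  "fm_double \<phi> = fm_veebar \<phi> \<phi>"

inductive_set BL_axioms :: "fm set" where
  A1: "(\<phi> \<^bold>\<rightarrow> \<psi>) \<^bold>\<rightarrow> ((\<psi> \<^bold>\<rightarrow> \<chi>) \<^bold>\<rightarrow> (\<phi> \<^bold>\<rightarrow> \<chi>)) \<in> BL_axioms"
| A2: "(\<phi> \<^bold>& \<psi>) \<^bold>\<rightarrow> \<phi> \<in> BL_axioms"
| A3: "(\<phi> \<^bold>& \<psi>) \<^bold>\<rightarrow> (\<psi> \<^bold>& \<phi>) \<in> BL_axioms"
| A4: "(\<phi> \<^bold>& (\<phi> \<^bold>\<rightarrow> \<psi>)) \<^bold>\<rightarrow> (\<psi> \<^bold>& (\<psi> \<^bold>\<rightarrow> \<phi>)) \<in> BL_axioms"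
| A5a: "(\<phi> \<^bold>\<rightarrow> (\<psi> \<^bold>\<rightarrow> \<chi>)) \<^bold>\<rightarrow> ((\<phi> \<^bold>& \<psi>) \<^bold>\<rightarrow> \<chi>) \<in> BL_axioms"
| A5b: "((\<phi> \<^bold>& \<psi>) \<^bold>\<rightarrow> \<chi>) \<^bold>\<rightarrow> (\<phi> \<^bold>\<rightarrow> (\<psi> \<^bold>\<rightarrow> \<chi>)) \<in> BL_axioms"
| A6: "((\<phi> \<^bold>\<rightarrow> \<psi>) \<^bold>\<rightarrow> \<chi>) \<^bold>\<rightarrow> (((\<psi> \<^bold>\<rightarrow> \<phi>) \<^bold>\<rightarrow> \<chi>) \<^bold>\<rightarrow> \<chi>) \<in> BL_axioms"
| A7: "Falsum \<^bold>\<rightarrow> \<phi> \<in> BL_axioms"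

text \<open>An axiomatic extension of BL is represented by the set of its axioms, those of BL included.\<close>

definition BL_Chang :: "fm set" where
  "BL_Chang = BL_axioms \<union>
     {fm_square (fm_double \<phi>) \<^bold>\<leftrightarrow> fm_double (fm_square \<phi>) | \<phi>. True}"

inductive derivable :: "fm set \<Rightarrow> fm set \<Rightarrow> fm \<Rightarrow> bool" for L T :: "fm set" where
  ax: "\<phi> \<in> L \<Longrightarrow> derivable L T \<phi>"
| hyp: "\<phi> \<in> T \<Longrightarrow> derivable L T \<phi>"
| mp: "\<lbrakk>derivable L T \<phi>; derivable L T (\<phi> \<^bold>\<rightarrow> \<psi>)\<rbrakk> \<Longrightarrow> derivable L T \<psi>"

primrec fm_eval :: "('a, 'm) bl_scheme \<Rightarrow> (nat \<Rightarrow> 'a) \<Rightarrow> fm \<Rightarrow> 'a" where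
  "fm_eval A v (Var n) = v n"
| "fm_eval A v Falsum = \<zero>\<^bsub>A\<^esub>"
| "fm_eval A v (\<phi> \<^bold>& \<psi>) = fm_eval A v \<phi> \<otimes>\<^bsub>A\<^esub> fm_eval A v \<psi>"
| "fm_eval A v (\<phi> \<^bold>\<rightarrow> \<psi>) = fm_eval A v \<phi> \<rightarrow>\<^bsub>A\<^esub> fm_eval A v \<psi>"

definition entails :: "('a, 'm) bl_scheme \<Rightarrow> fm set \<Rightarrow> fm \<Rightarrow> bool" where
  "entails A T \<phi> \<longleftrightarrow>
     (\<forall>v. range v \<subseteq> carrier A \<and> (\<forall>\<psi>\<in>T. fm_eval A v \<psi> = \<one>\<^bsub>A\<^esub>) \<longrightarrow> fm_eval A v \<phi> = \<one>\<^bsub>A\<^esub>)"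

definition L_algebra :: "fm set \<Rightarrow> ('a, 'm) bl_scheme \<Rightarrow> bool" where
  "L_algebra L A \<longleftrightarrow>
     BL_algebra A \<and> (\<forall>\<phi>\<in>L. \<forall>v. range v \<subseteq> carrier A \<longrightarrow> fm_eval A v \<phi> = \<one>\<^bsub>A\<^esub>)"

text \<open>The notion is only meaningful for \<open>L\<close>-algebras, so being one is made part of it.\<close>

definition finitely_strongly_complete :: "fm set \<Rightarrow> ('a, 'm) bl_scheme \<Rightarrow> bool" where
  "finitely_strongly_complete L A \<longleftrightarrow>
     L_algebra L A \<and> (\<forall>T \<phi>. finite T \<longrightarrow> (derivable L T \<phi> \<longleftrightarrow> entails A T \<phi>))"

definition BL_Chang_algebras :: "'a bl set" where
  "BL_Chang_algebras = {A. L_algebra BL_Chang A}"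


section \<open>Varieties\<close>

definition bl_hom :: "'a bl \<Rightarrow> 'b bl \<Rightarrow> ('a \<Rightarrow> 'b) set" where
  "bl_hom A B = {h \<in> carrier A \<rightarrow> carrier B.
     h \<one>\<^bsub>A\<^esub> = \<one>\<^bsub>B\<^esub> \<and> h \<zero>\<^bsub>A\<^esub> = \<zero>\<^bsub>B\<^esub> \<and>
     (\<forall>x\<in>carrier A. \<forall>y\<in>carrier A.
        h (x \<otimes>\<^bsub>A\<^esub> y) = h x \<otimes>\<^bsub>B\<^esub> h y \<and> h (x \<rightarrow>\<^bsub>A\<^esub> y) = h x \<rightarrow>\<^bsub>B\<^esub> h y \<and>
        h (x \<curlywedge>\<^bsub>A\<^esub> y) = h x \<curlywedge>\<^bsub>B\<^esub> h y \<and> h (x \<curlyvee>\<^bsub>A\<^esub> y) = h x \<curlyvee>\<^bsub>B\<^esub> h y)}"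

definition bl_closed :: "'a set \<Rightarrow> 'a bl \<Rightarrow> bool" where
  "bl_closed S A \<longleftrightarrow> \<one>\<^bsub>A\<^esub> \<in> S \<and> \<zero>\<^bsub>A\<^esub> \<in> S \<and>
     (\<forall>x\<in>S. \<forall>y\<in>S. x \<otimes>\<^bsub>A\<^esub> y \<in> S \<and> x \<rightarrow>\<^bsub>A\<^esub> y \<in> S \<and> x \<curlywedge>\<^bsub>A\<^esub> y \<in> S \<and> x \<curlyvee>\<^bsub>A\<^esub> y \<in> S)"

definition bl_product :: "'j set \<Rightarrow> ('j \<Rightarrow> 'a bl) \<Rightarrow> ('j \<Rightarrow> 'a) bl" where
  "bl_product J B =
     \<lparr>carrier = (\<Pi>\<^sub>E j\<in>J. carrier (B j)),
      monoid.mult = (\<lambda>f g. \<lambda>j\<in>J. f j \<otimes>\<^bsub>B j\<^esub> g j),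
      one = (\<lambda>j\<in>J. \<one>\<^bsub>B j\<^esub>),
      impl = (\<lambda>f g. \<lambda>j\<in>J. f j \<rightarrow>\<^bsub>B j\<^esub> g j),
      zero = (\<lambda>j\<in>J. \<zero>\<^bsub>B j\<^esub>),
      inf_op = (\<lambda>f g. \<lambda>j\<in>J. f j \<curlywedge>\<^bsub>B j\<^esub> g j),
      sup_op = (\<lambda>f g. \<lambda>j\<in>J. f j \<curlyvee>\<^bsub>B j\<^esub> g j)\<rparr>"

definition hom_images :: "'a bl set \<Rightarrow> 'b bl set" where
  "hom_images K = {B. \<exists>A\<in>K. \<exists>h\<in>bl_hom A B. h ` carrier A = carrier B}"

definition subalgebras :: "'a bl set \<Rightarrow> 'a bl set" where
  "subalgebras K = {A\<lparr>carrier := S\<rparr> | A S. A \<in> K \<and> S \<subseteq> carrier A \<and> bl_closed S A}"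

definition direct_products :: "'a bl set \<Rightarrow> ('j \<Rightarrow> 'a) bl set" where
  "direct_products K = {bl_product J B | J B. \<forall>j\<in>J. B j \<in> K}"

text \<open>
  The variety generated by \<open>K\<close> consists of the homomorphic images of subalgebras of direct products
  of members of \<open>K\<close>. In HOL the index sets of the products have to range over some type \<open>'j\<close>.
\<close>

definition HSP :: "'j itself \<Rightarrow> 'b bl set \<Rightarrow> 'a bl set" where
  "HSP _ K = hom_images (subalgebras (direct_products K :: ('j \<Rightarrow> 'b) bl set))"

datatype bl_term =
    TVar nat
  | TZero
  | TOne
  | TMult bl_term bl_term
  | TImpl bl_term bl_term
  | TInf bl_term bl_term
  | TSup bl_term bl_term

primrec term_eval :: "'a bl \<Rightarrow> (nat \<Rightarrow> 'a) \<Rightarrow> bl_term \<Rightarrow> 'a" where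
  "term_eval A v (TVar n) = v n"
| "term_eval A v TZero = \<zero>\<^bsub>A\<^esub>"
| "term_eval A v TOne = \<one>\<^bsub>A\<^esub>"
| "term_eval A v (TMult s t) = term_eval A v s \<otimes>\<^bsub>A\<^esub> term_eval A v t"
| "term_eval A v (TImpl s t) = term_eval A v s \<rightarrow>\<^bsub>A\<^esub> term_eval A v t"
| "term_eval A v (TInf s t) = term_eval A v s \<curlywedge>\<^bsub>A\<^esub> term_eval A v t"
| "term_eval A v (TSup s t) = term_eval A v s \<curlyvee>\<^bsub>A\<^esub> term_eval A v t"

text \<open>
  The variety axiomatised by a set of identities. Given by identities, one and the same variety has
  members over every type.
\<close>

definition variety :: "(bl_term \<times> bl_term) set \<Rightarrow> 'a bl set" where
  "variety E = {A. bl_closed (carrier A) A \<and>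
     (\<forall>(s, t)\<in>E. \<forall>v. range v \<subseteq> carrier A \<longrightarrow> term_eval A v s = term_eval A v t)}"

end

theory Submission
  imports Defs "HOL-Algebra.FiniteProduct"
begin

text \<open>
Soundness amounts to checking that an ordinal sum of perfect MV-chains is a BL-chain satisfying the
identity \<open>(2x)\<^sup>2 = 2(x\<^sup>2)\<close>, where \<open>2x\<close> interprets \<open>fm_double\<close>. Since \<open>x \<veebar> x\<close> is computed inside the component
of \<open>x\<close>, the identity may be checked in one perfect MV-chain (\<open>chang_identity\<close>).

For completeness let \<open>\<phi>\<close> be underivable from a finite \<open>T\<close>. Zorn's lemma extends \<open>T\<close> to a theory which
still does not derive \<open>\<phi>\<close> and for which any two formulas are comparable (\<open>linear_extension\<close>). Its
Lindenbaum algebra is a totally ordered hoop with a least element in which the Chang identity holds,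
and only finitely many of its elements are values of subformulas of \<open>T\<close> and \<open>\<phi>\<close>. Therefore it
suffices to embed a finite part of such a chain into \<open>\<omega>\<V>\<close>, respecting the operations wherever
argument and result belong to the finite part (\<open>finite_part_embeds_in_omegaV\<close>).

The embedding is built component by component. For \<open>x \<noteq> 1\<close> the set of all \<open>t\<close> with \<open>t \<rightarrow> x = x\<close>
determines the component of \<open>x\<close> in the decomposition of the chain into Wajsberg hoops, and between
different components the operations are those of an ordinal sum. The heart is \<open>wajsberg\<close>: for \<open>x < y\<close>
in one component, \<open>(y \<rightarrow> x) \<rightarrow> x = y\<close>. Hence multiplication is cancellative as long as products stay
above some element of the component (\<open>component_cancel\<close>). A component without a least element is
thus cancellative. In a component with least element \<open>b\<close> the Chang identity makes the elements
lying above their negation \<open>x \<rightarrow> b\<close> closed under products, every other element is the negation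
of one of these, and the component is the disconnected rotation of this cancellative part.

A finite part of a totally ordered cancellative monoid is represented in the multiplicative interval
\<open>(0, 1]\<close>: comparisons between monomials form an additive total preorder on integer
exponent vectors, and Fourier-Motzkin elimination provides real logarithms of the generators that
decide any finite set of these comparisons correctly (\<open>additive_total_real_weights\<close>).

The consequences for varieties come from the set of all identities valid in \<open>\<omega>\<V>\<close>. By completeness
they hold in every algebra of the logic. Conversely they include an equational axiomatisation of
BL-algebras and of the axioms of the logic. Birkhoff's argument, with the terms over \<open>A\<close> evaluated
simultaneously under all assignments \<open>A \<Rightarrow> \<omega>\<V>\<close>, then presents each algebra \<open>A\<close> of the logic as a
homomorphic image of a subalgebra of a power of \<open>\<omega>\<V>\<close>.
\<close>

unbundle no funcset_syntax

section \<open>Hoops\<close>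

context hoop
begin

declare impl_closed [simp]

abbreviation hle (infix "\<preceq>" 50) where "x \<preceq> y \<equiv> hoop_le A x y"

lemma impl_swap:
  assumes "x \<in> carrier A" "y \<in> carrier A" "z \<in> carrier A"
  shows "x \<rightarrow> (y \<rightarrow> z) = y \<rightarrow> (x \<rightarrow> z)"
  using assms by (metis impl_curry m_comm)

text \<open>The three hoop identities do not mention \<open>\<one>\<close> as a top element. Divisibility lets the premises
  \<open>a\<close> and \<open>a \<rightarrow> c\<close> be traded for \<open>c\<close> and \<open>c \<rightarrow> a\<close>, which shows first that \<open>\<one>\<close> is above every
  implication; \<open>one_impl\<close> then turns every element into an implication.\<close>

lemma impl_impl_one:
  assumes a: "a \<in> carrier A" and c: "c \<in> carrier A"
  shows "(a \<rightarrow> c) \<rightarrow> \<one> = \<one>"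
proof -
  have "(a \<rightarrow> c) \<rightarrow> \<one> = a \<rightarrow> ((a \<rightarrow> c) \<rightarrow> a)"
    using impl_swap[of "a \<rightarrow> c" a a] a c by (simp add: impl_refl)
  also have "\<dots> = c \<rightarrow> ((c \<rightarrow> a) \<rightarrow> a)"
    using a c by (simp add: impl_curry divisibility)
  also have "\<dots> = \<one>"
    using impl_swap[of c "c \<rightarrow> a" a] a c by (simp add: impl_refl)
  finally show ?thesis .
qed

lemma one_impl [simp]:
  assumes x: "x \<in> carrier A"
  shows "\<one> \<rightarrow> x = x"
proof -
  have div: "\<one> \<rightarrow> x = x \<otimes> (x \<rightarrow> \<one>)"
    using divisibility[of x \<one>] x by simp
  have "(\<one> \<rightarrow> x) \<rightarrow> x = (x \<rightarrow> \<one>) \<rightarrow> (x \<rightarrow> x)"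
    using x by (simp add: div impl_curry m_comm)
  hence le1: "(\<one> \<rightarrow> x) \<rightarrow> x = \<one>"
    using impl_impl_one[of x \<one>] x by (simp add: impl_refl)
  have le2: "x \<rightarrow> (\<one> \<rightarrow> x) = \<one>"
    using impl_curry[of x \<one> x] x by (simp add: impl_refl)
  show ?thesis
    using divisibility[of "\<one> \<rightarrow> x" x] le1 le2 x by simp
qed

lemma impl_one [simp]:
  "x \<in> carrier A \<Longrightarrow> x \<rightarrow> \<one> = \<one>"
  using impl_impl_one[of \<one> x] by simp

lemma hle_refl [simp]: "x \<in> carrier A \<Longrightarrow> x \<preceq> x"
  by (simp add: hoop_le_def impl_refl)

lemma hle_one [simp]: "x \<in> carrier A \<Longrightarrow> x \<preceq> \<one>"
  by (simp add: hoop_le_def)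

lemma one_hle: "x \<in> carrier A \<Longrightarrow> \<one> \<preceq> x \<longleftrightarrow> x = \<one>"
  by (simp add: hoop_le_def)

lemma hle_antisym: "\<lbrakk>x \<preceq> y; y \<preceq> x; x \<in> carrier A; y \<in> carrier A\<rbrakk> \<Longrightarrow> x = y"
  using divisibility[of x y] by (simp add: hoop_le_def)

lemma inf_eq: "\<lbrakk>y \<preceq> x; x \<in> carrier A; y \<in> carrier A\<rbrakk> \<Longrightarrow> x \<otimes> (x \<rightarrow> y) = y"
  using divisibility[of x y] by (simp add: hoop_le_def)

lemma residuated:
  "\<lbrakk>x \<in> carrier A; y \<in> carrier A; z \<in> carrier A\<rbrakk> \<Longrightarrow> x \<otimes> y \<preceq> z \<longleftrightarrow> x \<preceq> y \<rightarrow> z"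
  by (simp add: hoop_le_def impl_curry)

lemma hle_trans:
  assumes "x \<preceq> y" "y \<preceq> z" "x \<in> carrier A" "y \<in> carrier A" "z \<in> carrier A"
  shows "x \<preceq> z"
proof -
  have "x = y \<otimes> (y \<rightarrow> x)" using assms by (simp add: inf_eq)
  hence "x \<rightarrow> z = (y \<rightarrow> x) \<rightarrow> (y \<rightarrow> z)" using assms by (metis impl_closed impl_curry m_comm)
  thus ?thesis using assms by (simp add: hoop_le_def)
qed

lemma mult_le_right: "\<lbrakk>x \<in> carrier A; y \<in> carrier A\<rbrakk> \<Longrightarrow> x \<otimes> y \<preceq> y"
  by (simp add: residuated impl_refl)

lemma mult_le_left: "\<lbrakk>x \<in> carrier A; y \<in> carrier A\<rbrakk> \<Longrightarrow> x \<otimes> y \<preceq> x"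
  using mult_le_right[of y x] by (simp add: m_comm)

lemma le_impl: "\<lbrakk>x \<in> carrier A; y \<in> carrier A\<rbrakk> \<Longrightarrow> x \<preceq> y \<rightarrow> x"
  using mult_le_left[of x y] by (simp add: residuated)

lemma mult_mono_right:
  assumes "x \<preceq> y" "x \<in> carrier A" "y \<in> carrier A" "z \<in> carrier A"
  shows "z \<otimes> x \<preceq> z \<otimes> y"
proof -
  have "z \<otimes> x = z \<otimes> y \<otimes> (y \<rightarrow> x)" using assms by (simp add: inf_eq m_assoc)
  thus ?thesis using assms by (simp add: mult_le_left)
qed

lemma mult_mono:
  assumes "x \<preceq> y" "x' \<preceq> y'" "x \<in> carrier A" "y \<in> carrier A" "x' \<in> carrier A" "y' \<in> carrier A"
  shows "x \<otimes> x' \<preceq> y \<otimes> y'"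
  using assms mult_mono_right[of x y x'] mult_mono_right[of x' y' y]
    hle_trans[of "x \<otimes> x'" "y \<otimes> x'" "y \<otimes> y'"] by (simp add: m_comm)

lemma impl_mono:
  assumes "x \<preceq> y" "x \<in> carrier A" "y \<in> carrier A" "z \<in> carrier A"
  shows "z \<rightarrow> x \<preceq> z \<rightarrow> y"
proof -
  have "(z \<rightarrow> x) \<otimes> z \<preceq> x" using assms by (simp add: residuated)
  hence "(z \<rightarrow> x) \<otimes> z \<preceq> y" using assms hle_trans[of "(z \<rightarrow> x) \<otimes> z" x y] by simp
  thus ?thesis using assms by (simp add: residuated)
qed

lemma impl_antimono:
  assumes "x \<preceq> y" "x \<in> carrier A" "y \<in> carrier A" "z \<in> carrier A"
  shows "y \<rightarrow> z \<preceq> x \<rightarrow> z"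
proof -
  have "(y \<rightarrow> z) \<otimes> x \<preceq> (y \<rightarrow> z) \<otimes> y"
    using assms by (simp add: mult_mono_right)
  moreover have "(y \<rightarrow> z) \<otimes> y \<preceq> z" using assms by (simp add: residuated)
  ultimately have "(y \<rightarrow> z) \<otimes> x \<preceq> z"
    using assms hle_trans[of "(y \<rightarrow> z) \<otimes> x" "(y \<rightarrow> z) \<otimes> y" z] by simp
  thus ?thesis using assms by (simp add: residuated)
qed

lemma le_impl_impl: "\<lbrakk>x \<in> carrier A; y \<in> carrier A\<rbrakk> \<Longrightarrow> x \<preceq> (x \<rightarrow> y) \<rightarrow> y"
  by (simp add: hoop_le_def impl_swap[of x] impl_refl)

lemma impl_impl_impl:
  assumes "x \<in> carrier A" "y \<in> carrier A"
  shows "((x \<rightarrow> y) \<rightarrow> y) \<rightarrow> y = x \<rightarrow> y"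
proof (rule hle_antisym)
  show "((x \<rightarrow> y) \<rightarrow> y) \<rightarrow> y \<preceq> x \<rightarrow> y" using assms by (simp add: impl_antimono le_impl_impl)
  show "x \<rightarrow> y \<preceq> ((x \<rightarrow> y) \<rightarrow> y) \<rightarrow> y" using assms by (simp add: le_impl_impl)
qed (use assms in simp_all)

end

section \<open>Components of totally ordered hoops\<close>

locale hoop_chain = hoop +
  assumes linear: "\<lbrakk>x \<in> carrier A; y \<in> carrier A\<rbrakk> \<Longrightarrow> hoop_le A x y \<or> hoop_le A y x"
begin

text \<open>In an ordinal sum of Wajsberg hoops, \<open>t \<rightarrow> x = x\<close> holds for \<open>x \<noteq> \<one>\<close> exactly when \<open>t\<close> is
  \<open>\<one>\<close> or lies in a component strictly above the one of \<open>x\<close>. Consequently \<open>x\<close> and \<open>y\<close> lie in the same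
  component iff \<open>above x = above y\<close>, and components can be compared without being constructed.\<close>

definition above :: "'a \<Rightarrow> 'a set" where
  "above x = {t \<in> carrier A. t \<rightarrow> x = x}"

text \<open>Put \<open>u = y \<rightarrow> x\<close>, \<open>z = u \<rightarrow> x\<close> and \<open>w = z \<rightarrow> y\<close>, so that \<open>y = z \<otimes> w\<close>. One finds \<open>w \<rightarrow> u = u\<close>: the defect
  \<open>w\<close> acts trivially on \<open>u\<close>. This triviality propagates from \<open>u\<close> to \<open>q = z \<rightarrow> u\<close> and to \<open>r = q \<rightarrow> u\<close>, and
  then down to \<open>z \<preceq> r\<close> (unless already \<open>z \<preceq> u\<close>), so \<open>y = z \<otimes> w = z\<close>.\<close>

lemma wajsberg:
  assumes C: "x \<in> carrier A" "y \<in> carrier A" and xy: "x \<preceq> y" "x \<noteq> y" and ne: "y \<notin> above x"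
  shows "(y \<rightarrow> x) \<rightarrow> x = y"
proof -
  define u where "u = y \<rightarrow> x"
  define z where "z = u \<rightarrow> x"
  define w where "w = z \<rightarrow> y"
  define q where "q = z \<rightarrow> u"
  define r where "r = q \<rightarrow> u"
  have CC [simp]: "u \<in> carrier A" "z \<in> carrier A" "w \<in> carrier A" "q \<in> carrier A" "r \<in> carrier A"
    unfolding u_def z_def w_def q_def r_def using C by simp_all
  have ux: "u \<noteq> x" using ne C by (auto simp: above_def u_def)
  have xu: "x \<preceq> u" using C by (simp add: u_def le_impl)
  have u1: "u \<noteq> \<one>" using xy C hle_antisym by (auto simp: u_def hoop_le_def)
  have yz: "y \<preceq> z" using C by (simp add: z_def u_def le_impl_impl)
  have zx: "z \<rightarrow> x = u" using C by (simp add: z_def u_def impl_impl_impl)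
  have zw: "z \<otimes> w = y" unfolding w_def using yz C by (simp add: inf_eq)
  have fixed: "w \<otimes> t = t \<or> t = \<one>" if t: "t \<in> carrier A" and wt: "w \<rightarrow> t = t" for t
    using linear[of w t] inf_eq[of t w] t wt by (auto simp: hoop_le_def)
  have "w \<rightarrow> u = (w \<otimes> z) \<rightarrow> x" using C zx by (simp add: impl_curry flip: zx)
  hence wu: "w \<rightarrow> u = u" using zw C by (simp add: m_comm u_def)
  hence wu': "w \<otimes> u = u" using fixed[of u] wu u1 by simp
  have down: "w \<otimes> z = z" if t: "t \<in> carrier A" and wt: "w \<otimes> t = t" and zt: "z \<preceq> t" for t
  proof -
    have "w \<otimes> (t \<otimes> (t \<rightarrow> z)) = t \<otimes> (t \<rightarrow> z)" using t wt by (simp flip: m_assoc)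
    thus ?thesis using zt t by (simp add: inf_eq)
  qed
  have "w \<otimes> z = z"
  proof (cases "z \<preceq> u")
    case True thus ?thesis using down[of u] wu' by simp
  next
    case False
    hence uz: "u \<preceq> z" using linear[of u z] by simp
    have "w \<rightarrow> q = z \<rightarrow> (w \<rightarrow> u)" unfolding q_def by (simp add: impl_swap)
    hence "w \<rightarrow> q = q" using wu by (simp add: q_def)
    moreover have "q \<noteq> \<one>" using False by (simp add: q_def hoop_le_def)
    ultimately have wq: "w \<otimes> q = q" using fixed[of q] by simp
    have "w \<rightarrow> r = (w \<otimes> q) \<rightarrow> u" by (simp add: r_def impl_curry)
    hence "w \<rightarrow> r = r" using wq by (simp add: r_def)
    moreover have "r \<noteq> \<one>"
    proof
      assume "r = \<one>"
      hence "q \<preceq> u" by (simp add: r_def hoop_le_def)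
      moreover have "u \<preceq> q" by (simp add: q_def le_impl)
      ultimately have "z \<rightarrow> u = u" using hle_antisym by (auto simp: q_def)
      hence "z \<otimes> u = u" using inf_eq[OF uz] by simp
      moreover have "u \<otimes> z = x" unfolding z_def using xu C by (simp add: inf_eq)
      ultimately show False using ux by (simp add: m_comm)
    qed
    ultimately have "w \<otimes> r = r" using fixed[of r] by simp
    moreover have "z \<preceq> r" by (simp add: r_def q_def le_impl_impl)
    ultimately show ?thesis using down[of r] by simp
  qed
  hence "z = y" using zw by (simp add: m_comm)
  thus ?thesis by (simp add: z_def u_def)
qed

lemma above_upward:
  assumes "t \<in> above x" "t \<preceq> s" "s \<in> carrier A" "x \<in> carrier A"
  shows "s \<in> above x"
proof -
  have "s \<rightarrow> x \<preceq> x" using assms impl_antimono[of t s x] by (auto simp: above_def)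
  thus ?thesis using assms hle_antisym[of "s \<rightarrow> x" x] by (simp add: above_def le_impl)
qed

lemma above_self: "x \<in> carrier A \<Longrightarrow> x \<in> above x \<longleftrightarrow> x = \<one>"
  by (auto simp: above_def impl_refl)

text \<open>By \<open>wajsberg\<close>, \<open>y = u \<rightarrow> x\<close> for \<open>u = y \<rightarrow> x\<close>. This carries \<open>t \<rightarrow> x = x\<close> over to \<open>y\<close>. For
  the converse let \<open>x' = t \<rightarrow> x\<close>; the assumption \<open>t \<rightarrow> y = y\<close> yields \<open>u \<rightarrow> x' = y\<close>, hence \<open>x' \<preceq> y\<close>, and
  multiplication by \<open>t\<close> fixes everything below \<open>y\<close>.\<close>

lemma above_eqI:
  assumes C: "x \<in> carrier A" "y \<in> carrier A" and xy: "x \<preceq> y" and ne: "y \<notin> above x"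
  shows "above x = above y"
proof (cases "x = y")
  case False
  define u where "u = y \<rightarrow> x"
  have uC [simp]: "u \<in> carrier A" using C by (simp add: u_def)
  have W: "u \<rightarrow> x = y" using wajsberg[OF C xy False ne] by (simp add: u_def)
  show ?thesis
  proof (intro equalityI subsetI)
    fix t assume t: "t \<in> above x"
    hence tC: "t \<in> carrier A" by (simp add: above_def)
    have "t \<rightarrow> (u \<rightarrow> x) = u \<rightarrow> (t \<rightarrow> x)" using C tC by (simp add: impl_swap)
    thus "t \<in> above y" using t W tC by (simp add: above_def)
  next
    fix t assume t: "t \<in> above y"
    hence tC [simp]: "t \<in> carrier A" and ty: "t \<rightarrow> y = y" by (simp_all add: above_def)
    have y1: "y \<noteq> \<one>" using ne C by (auto simp: above_def)
    have yt: "y \<preceq> t" using linear[of y t] ty y1 C by (auto simp: hoop_le_def)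
    have ty': "t \<otimes> y = y" using inf_eq[OF yt] ty C by simp
    define x' where "x' = t \<rightarrow> x"
    have x'C [simp]: "x' \<in> carrier A" using C by (simp add: x'_def)
    have tx': "t \<otimes> x' = x" unfolding x'_def using C hle_trans[OF xy yt] by (simp add: inf_eq)
    have "u \<rightarrow> x' = t \<rightarrow> (u \<rightarrow> x)" unfolding x'_def using C by (simp add: impl_swap)
    hence "u \<rightarrow> x' = y" using W ty by simp
    hence "x' \<preceq> y" using le_impl[of x' u] by simp
    hence x': "y \<otimes> (y \<rightarrow> x') = x'" using C by (simp add: inf_eq)
    have "t \<otimes> (y \<otimes> (y \<rightarrow> x')) = y \<otimes> (y \<rightarrow> x')" using ty' C by (simp flip: m_assoc)
    hence "x' = x" using tx' x' by simp
    thus "t \<in> above x" by (simp add: above_def x'_def)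
  qed
qed simp

lemma above_psubset:
  assumes C: "x \<in> carrier A" "y \<in> carrier A" and y1: "y \<noteq> \<one>" and yx: "y \<in> above x"
  shows "above y \<subset> above x"
proof -
  have "t \<in> above x" if t: "t \<in> above y" for t
  proof -
    have tC: "t \<in> carrier A" "t \<rightarrow> y = y" using t by (auto simp: above_def)
    hence "y \<preceq> t" using linear[of y t] y1 C by (auto simp: hoop_le_def)
    thus ?thesis using above_upward[OF yx] tC C by simp
  qed
  thus ?thesis using above_self[of y] C y1 yx by auto
qed

text \<open>The order of the components is reverse inclusion of the sets \<^const>\<open>above\<close>.\<close>

lemma above_less:
  assumes C: "x \<in> carrier A" "y \<in> carrier A" and x1: "x \<noteq> \<one>" and ps: "above y \<subset> above x"
  shows "y \<in> above x" "x \<preceq> y"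
proof -
  show xy: "x \<preceq> y"
  proof (rule ccontr)
    assume "\<not> x \<preceq> y"
    hence yx: "y \<preceq> x" using linear[of x y] C by auto
    show False
    proof (cases "x \<in> above y")
      case True
      thus False using above_psubset[of y x] C x1 ps by auto
    next
      case False
      thus False using above_eqI[of y x] yx C ps by auto
    qed
  qed
  show "y \<in> above x"
    using above_eqI[OF C xy] ps by auto
qed

lemma not_hle: "\<lbrakk>\<not> x \<preceq> y; x \<in> carrier A; y \<in> carrier A\<rbrakk> \<Longrightarrow> y \<preceq> x"
  using linear by blast

lemma above_trichotomy:
  assumes "x \<in> carrier A" "y \<in> carrier A" "x \<noteq> \<one>" "y \<noteq> \<one>"
  shows "above x = above y \<or> above x \<subset> above y \<or> above y \<subset> above x"
  using linear[of x y] above_eqI[of x y] above_eqI[of y x] above_psubset[of x y]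
    above_psubset[of y x] assms by blast

lemma above_one: "above \<one> = carrier A"
  by (auto simp: above_def)

lemma above_not_one: "\<lbrakk>x \<in> carrier A; x \<noteq> \<one>; above y = above x\<rbrakk> \<Longrightarrow> y \<noteq> \<one>"
  using above_self[of x] above_one by blast

lemma lower_component:
  assumes "x \<in> carrier A" "y \<in> carrier A" "x \<noteq> \<one>" "above y \<subset> above x"
  shows "x \<otimes> y = x" "y \<otimes> x = x" "y \<rightarrow> x = x" "x \<rightarrow> y = \<one>"
proof -
  note * = above_less[OF assms]
  show 1: "y \<rightarrow> x = x" and "x \<rightarrow> y = \<one>" using * by (auto simp: above_def hoop_le_def)
  show "y \<otimes> x = x" using inf_eq[OF *(2)] 1 assms by simp
  thus "x \<otimes> y = x" using assms by (simp add: m_comm)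
qed

lemma component_wajsberg:
  assumes "x \<in> carrier A" "y \<in> carrier A" "y = \<one> \<or> above y = above x" "x \<preceq> y"
  shows "(y \<rightarrow> x) \<rightarrow> x = y"
proof (cases "x = y \<or> y = \<one>")
  case True thus ?thesis using assms by (auto simp: impl_refl)
next
  case False
  thus ?thesis using wajsberg[of x y] above_self[of y] assms by auto
qed

lemma component_mult:
  assumes C: "x \<in> carrier A" "y \<in> carrier A" and "above x = above y"
  shows "above (x \<otimes> y) = above x"
proof (cases "x \<in> above (x \<otimes> y)")
  case False
  thus ?thesis using above_eqI[of "x \<otimes> y" x] C by (simp add: mult_le_left)
next
  case True
  hence "y \<preceq> x \<otimes> y" using C mult_le_right[of x y] residuated[of y x "x \<otimes> y"]
    by (simp add: above_def m_comm)
  hence "x \<otimes> y = y" using C hle_antisym mult_le_right by simp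
  thus ?thesis using assms by simp
qed

lemma component_impl:
  assumes C: "x \<in> carrier A" "y \<in> carrier A" and eq: "above x = above y" and 1: "x \<rightarrow> y \<noteq> \<one>"
  shows "above (x \<rightarrow> y) = above y"
proof -
  have yx: "y \<preceq> x" using 1 linear[of x y] C by (auto simp: hoop_le_def)
  have ne: "x \<noteq> y" using 1 C by (auto simp: impl_refl)
  have "(x \<rightarrow> y) \<rightarrow> y = x" using component_wajsberg[of y x] C eq yx by simp
  hence "x \<rightarrow> y \<notin> above y" using ne by (auto simp: above_def)
  thus ?thesis using above_eqI[of y "x \<rightarrow> y"] C by (simp add: le_impl)
qed

text \<open>By \<open>component_wajsberg\<close>, \<open>t \<mapsto> (t \<rightarrow> c)\<close> is injective on the part of the component above \<open>c\<close>. As long as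
  the product stays strictly above \<open>c\<close>, the negations relative to \<open>c\<close> of both candidates for the second
  factor lie below \<open>x\<close> and can be recovered from the product.\<close>

lemma component_cancel:
  assumes C: "c \<in> carrier A" "x \<in> carrier A" "y \<in> carrier A"
    and x: "x = \<one> \<or> above x = above c" and y: "y = \<one> \<or> above y = above c"
    and c: "c \<noteq> \<one>" and less: "c \<preceq> x \<otimes> y" "c \<noteq> x \<otimes> y"
  shows "x \<rightarrow> (x \<otimes> y) = y"
proof (cases "x = \<one> \<or> y = \<one>")
  case True thus ?thesis using C by (auto simp: impl_refl)
next
  case False
  hence x: "above x = above c" and y: "above y = above c" using x y by simp_all
  define t where "t = x \<rightarrow> (x \<otimes> y)"
  have tC [simp]: "t \<in> carrier A" using C by (simp add: t_def)
  have tcl: "t = \<one> \<or> above t = above c"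
    using component_impl[of x "x \<otimes> y"] component_mult[of x y] x y C by (auto simp: t_def)
  have yt: "y \<preceq> t" unfolding t_def using C residuated[of y x "x \<otimes> y"] by (simp add: m_comm)
  have cy: "c \<preceq> y" using hle_trans[OF less(1) mult_le_right] C by simp
  have ct: "c \<preceq> t" using hle_trans[OF cy yt] C by simp
  have xt: "x \<otimes> t = x \<otimes> y" unfolding t_def using C by (simp add: inf_eq mult_le_left)
  have nx: "\<not> x \<preceq> y \<rightarrow> c" using residuated[of x y c] less hle_antisym[of c "x \<otimes> y"] C by auto
  hence 1: "y \<rightarrow> c \<preceq> x" using not_hle C by simp
  have 2: "t \<rightarrow> c \<preceq> x"
    using hle_trans[OF impl_antimono[OF yt] 1] C by simp
  have "x \<rightarrow> (t \<rightarrow> c) = x \<rightarrow> (y \<rightarrow> c)" using C xt by (simp add: impl_curry)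
  hence "t \<rightarrow> c = y \<rightarrow> c" using inf_eq[OF 1] inf_eq[OF 2] C by simp
  hence "(t \<rightarrow> c) \<rightarrow> c = (y \<rightarrow> c) \<rightarrow> c" by simp
  hence "t = y" using component_wajsberg[of c t] component_wajsberg[of c y] C tcl ct cy y by simp
  thus ?thesis by (simp add: t_def)
qed

definition component :: "'a \<Rightarrow> 'a set" where
  "component c = {x \<in> carrier A. x = \<one> \<or> above x = above c}"

lemma componentD: "x \<in> component c \<Longrightarrow> x = \<one> \<or> above x = above c"
  by (simp add: component_def)

lemma componentI: "\<lbrakk>x \<in> carrier A; x = \<one> \<or> above x = above c\<rbrakk> \<Longrightarrow> x \<in> component c"
  by (simp add: component_def)

lemma component_closed: "x \<in> component c \<Longrightarrow> x \<in> carrier A"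
  by (simp add: component_def)

lemma one_component [simp]: "\<one> \<in> component c"
  by (rule componentI) simp_all

lemma component_mult_closed:
  assumes x: "x \<in> component c" and y: "y \<in> component c" shows "x \<otimes> y \<in> component c"
proof -
  have C: "x \<in> carrier A" "y \<in> carrier A" using x y component_closed by simp_all
  consider "x = \<one>" | "y = \<one>" | "above x = above c" "above y = above c"
    using componentD[OF x] componentD[OF y] by fast
  thus ?thesis
  proof cases
    case 1 thus ?thesis using y C by simp
  next
    case 2 thus ?thesis using x C by simp
  next
    case 3
    hence "above x = above y" by simp
    from component_mult[OF C this] 3 show ?thesis using C by (intro componentI) auto
  qed
qed

lemma component_impl_closed:
  assumes x: "x \<in> component c" and y: "y \<in> component c" shows "x \<rightarrow> y \<in> component c"
proof -
  have C: "x \<in> carrier A" "y \<in> carrier A" using x y component_closed by simp_all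
  consider "x = \<one>" | "y = \<one>" | "above x = above c" "above y = above c"
    using componentD[OF x] componentD[OF y] by fast
  thus ?thesis
  proof cases
    case 1 thus ?thesis using y C by simp
  next
    case 2 thus ?thesis using x C by simp
  next
    case 3
    hence "above x = above y" by simp
    from component_impl[OF C this] 3 show ?thesis using C by (intro componentI) auto
  qed
qed

end

section \<open>The radical of a bounded component\<close>

text \<open>The value of \<open>fm_double\<close>, whose two conjuncts coincide.\<close>

definition dbl :: "('a, 'm) hoop_scheme \<Rightarrow> 'a \<Rightarrow> 'a" where
  "dbl A x = (x \<rightarrow>\<^bsub>A\<^esub> (x \<otimes>\<^bsub>A\<^esub> x)) \<rightarrow>\<^bsub>A\<^esub> x"

text \<open>Either \<open>x \<otimes> x = b\<close> and \<open>x \<rightarrow> (x \<otimes> x)\<close> is the negation of \<open>x\<close>, or cancellation gives \<open>x \<rightarrow> (x \<otimes> x) = x\<close>; in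
  both cases it is at most \<open>x\<close>.\<close>

lemma (in hoop_chain) dbl_eq_one:
  assumes b: "b \<in> carrier A" "b \<noteq> \<one>" and x: "x \<in> component b" "x \<rightarrow> b \<preceq> x" and "b \<preceq> x \<otimes> x"
  shows "dbl A x = \<one>"
proof -
  have C: "x \<in> carrier A" using component_closed[OF x(1)] .
  have "x \<rightarrow> (x \<otimes> x) \<preceq> x"
  proof (cases "x \<otimes> x = b")
    case True thus ?thesis using x by simp
  next
    case False
    hence "x \<rightarrow> (x \<otimes> x) = x"
      using component_cancel[of b x x] componentD[OF x(1)] b C assms(5) by simp
    thus ?thesis using C by simp
  qed
  thus ?thesis by (simp add: dbl_def hoop_le_def)
qed

locale chang_chain = hoop_chain +
  assumes chang: "x \<in> carrier A \<Longrightarrow> dbl A x \<otimes> dbl A x = dbl A (x \<otimes> x)"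

locale bounded_component = chang_chain +
  fixes b
  assumes b_closed [simp]: "b \<in> carrier A" and b_not_one: "b \<noteq> \<one>"
    and b_least: "\<lbrakk>x \<in> carrier A; above x = above b\<rbrakk> \<Longrightarrow> b \<preceq> x"
begin

text \<open>Relative to the least element \<open>b\<close> of its component, \<open>x \<rightarrow> b\<close> is the negation of \<open>x\<close>. In the disconnected
  rotation of a cancellative hoop the radical is the original hoop.\<close>

definition radical :: "'a set" where
  "radical = {x \<in> component b. x \<rightarrow> b \<preceq> x}"

lemma b_component [simp]: "b \<in> component b"
  by (rule componentI) simp_all

lemma b_component_closed [simp]: "x \<in> component b \<Longrightarrow> x \<in> carrier A"
  by (rule component_closed)

lemma b_le: "x \<in> component b \<Longrightarrow> b \<preceq> x"
  using b_least[of x] componentD[of x b] by auto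

lemma neg_neg: "x \<in> component b \<Longrightarrow> (x \<rightarrow> b) \<rightarrow> b = x"
  using component_wajsberg[of b x] b_le[of x] componentD[of x b] by simp

lemma one_radical [simp]: "\<one> \<in> radical"
  by (simp add: radical_def)

lemma radicalI: "\<lbrakk>x \<in> component b; x \<rightarrow> b \<preceq> x\<rbrakk> \<Longrightarrow> x \<in> radical"
  by (simp add: radical_def)

lemma radical_le: "x \<in> radical \<Longrightarrow> x \<rightarrow> b \<preceq> x"
  by (simp add: radical_def)

lemma radical_component: "x \<in> radical \<Longrightarrow> x \<in> component b"
  by (simp add: radical_def)

lemma b_not_radical: "b \<notin> radical"
  using b_not_one by (auto simp: radical_def impl_refl one_hle)

lemma radical_closed [simp]: "x \<in> radical \<Longrightarrow> x \<in> carrier A"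
  by (simp add: radical_def)

lemma radical_upward:
  assumes "x \<in> radical" "x \<preceq> y" "y \<in> component b" shows "y \<in> radical"
proof -
  have "y \<rightarrow> b \<preceq> x \<rightarrow> b" using assms by (simp add: impl_antimono)
  moreover have "x \<rightarrow> b \<preceq> x" using assms by (simp add: radical_le)
  ultimately have "y \<rightarrow> b \<preceq> x" using assms hle_trans[of "y \<rightarrow> b" "x \<rightarrow> b" x] by simp
  thus ?thesis using assms hle_trans[of "y \<rightarrow> b" x y] by (simp add: radicalI)
qed

text \<open>The Chang identity enters here: it gives \<open>2(x\<^sup>2) = (2x)\<^sup>2 = 1\<close>, and this forces \<open>x\<^sup>2\<close> to lie above its
  negation, both when \<open>x\<^sup>4 = b\<close> and when \<open>x\<^sup>4 > b\<close>.\<close>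

lemma radical_square:
  assumes x: "x \<in> radical" shows "x \<otimes> x \<in> radical"
proof -
  have C [simp]: "x \<in> carrier A" using x by simp
  have cl: "x \<in> component b" "x \<otimes> x \<in> component b"
    using radical_component[OF x] component_mult_closed by auto
  have "dbl A x = \<one>"
    using dbl_eq_one[of b x] b_not_one cl b_le[OF cl(2)] x by (simp add: radical_le)
  hence d1: "dbl A (x \<otimes> x) = \<one>" using chang[of x] by simp
  define y where "y = x \<otimes> x"
  have yC [simp]: "y \<in> carrier A" by (simp add: y_def)
  have y: "y \<in> component b" "y \<rightarrow> (y \<otimes> y) \<preceq> y" using d1 cl by (simp_all add: y_def dbl_def hoop_le_def)
  have "y \<rightarrow> b \<preceq> y"
  proof (cases "y \<otimes> y = b")
    case True thus ?thesis using y by simp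
  next
    case False
    have "\<not> y \<preceq> y \<rightarrow> b"
    proof
      assume "y \<preceq> y \<rightarrow> b"
      hence "y \<otimes> y \<preceq> b" by (simp add: residuated)
      thus False using False b_le component_mult_closed[OF y(1) y(1)] hle_antisym[of "y \<otimes> y" b] by simp
    qed
    thus ?thesis using not_hle by simp
  qed
  thus ?thesis using cl by (simp add: radicalI y_def)
qed

lemma radical_mult:
  assumes "x \<in> radical" "y \<in> radical" shows "x \<otimes> y \<in> radical"
proof -
  have cl: "x \<otimes> y \<in> component b" using assms radical_component component_mult_closed by simp
  have C: "x \<in> carrier A" "y \<in> carrier A" using assms by simp_all
  from linear[OF this] show ?thesis
  proof
    assume "x \<preceq> y"
    hence "x \<otimes> x \<preceq> x \<otimes> y" using C by (simp add: mult_mono_right)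
    thus ?thesis using radical_upward[OF radical_square[OF assms(1)]] cl by simp
  next
    assume "y \<preceq> x"
    hence "y \<otimes> y \<preceq> y \<otimes> x" using C by (simp add: mult_mono_right)
    thus ?thesis using radical_upward[OF radical_square[OF assms(2)]] cl C by (simp add: m_comm)
  qed
qed

lemma radical_cancel:
  assumes x: "x \<in> radical" and y: "y \<in> radical" shows "x \<rightarrow> (x \<otimes> y) = y"
proof (rule component_cancel[of b])
  show "b \<preceq> x \<otimes> y" "b \<noteq> x \<otimes> y"
    using radical_mult[OF x y] b_not_radical b_le radical_component by auto
qed (use x y b_not_one componentD[of _ b] radical_component in auto)

lemma radical_or_neg: "x \<in> component b \<Longrightarrow> x \<in> radical \<or> x \<rightarrow> b \<in> radical"
  using linear[of x "x \<rightarrow> b"] neg_neg[of x] component_impl_closed[of x b]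
  by (auto intro: radicalI)

end

section \<open>Real weights for additive total preorders\<close>

lemma finite_real_gap:
  fixes L U :: "real set"
  assumes "finite L" "finite U" and less: "\<And>l u. l \<in> L \<Longrightarrow> u \<in> U \<Longrightarrow> l < u"
  shows "\<exists>x. (\<forall>l\<in>L. l < x) \<and> (\<forall>u\<in>U. x < u)"
proof -
  have L: "\<exists>a. (\<forall>l\<in>L. l < a)"
    using assms(1) by (metis Max_ge le_less_trans linordered_field_no_ub)
  have U: "\<exists>a. (\<forall>u\<in>U. a < u)"
    using assms(2) by (metis Min_le less_le_trans linordered_field_no_lb)
  show ?thesis
  proof (cases "L = {} \<or> U = {}")
    case True thus ?thesis using L U by auto
  next
    case False
    hence "Max L < Min U" using assms by simp
    then obtain x where "Max L < x" "x < Min U" using dense by blast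
    thus ?thesis using False assms by (meson Max_less_iff Min_gr_iff)
  qed
qed

text \<open>A predicate \<open>Q\<close> that is closed under addition and contains \<open>p\<close> or \<open>-p\<close> for each integer vector \<open>p\<close> is the
  nonnegative cone of a total preorder on the group of integer vectors. On finitely many vectors such a
  preorder agrees with the one given by a real linear functional. The proof eliminates one coordinate
  \<open>j\<close> at a time: a vector \<open>p\<close> with \<open>p j > 0\<close> bounds the weight of \<open>j\<close> by its root, the order of two
  roots is decided by a combination of the two vectors that vanishes at \<open>j\<close>, and a weight in
  the right position between the finitely many roots exists because the reals are dense.\<close>

lemma additive_total_real_weights:
  fixes Q :: "('v \<Rightarrow> int) \<Rightarrow> bool"
  assumes add: "\<And>p q. Q p \<Longrightarrow> Q q \<Longrightarrow> Q (\<lambda>i. p i + q i)"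
    and total: "\<And>p. Q p \<or> Q (\<lambda>i. - p i)"
    and "finite V" "finite P" "\<And>p i. p \<in> P \<Longrightarrow> i \<notin> V \<Longrightarrow> p i = 0"
  shows "\<exists>r. \<forall>p\<in>P. Q p \<longleftrightarrow> 0 \<le> (\<Sum>i\<in>V. real_of_int (p i) * r i)"
proof -
  have zero: "Q (\<lambda>i. 0)" using total[of "\<lambda>i. 0"] by simp
  have scale_nat: "Q (\<lambda>i. int k * p i)" if "Q p" for k p
  proof (induction k)
    case (Suc k)
    have "Q (\<lambda>i. int k * p i + p i)" using add[OF Suc that] .
    moreover have "(\<lambda>i. int k * p i + p i) = (\<lambda>i. int (Suc k) * p i)"
      by (auto simp: algebra_simps)
    ultimately show ?case by simp
  qed (use zero in simp)
  have scale: "Q (\<lambda>i. k * p i)" if "Q p" "k \<ge> 0" for k p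
    using scale_nat[OF that(1), of "nat k"] that(2) by simp
  have unscale: "Q p" if Q: "Q (\<lambda>i. k * p i)" and k: "k > 0" for k p
  proof (rule ccontr)
    assume n: "\<not> Q p"
    hence "Q (\<lambda>i. - p i)" using total by blast
    from add[OF Q scale[OF this, of "k - 1"]] have "Q (\<lambda>i. k * p i + (k - 1) * - p i)" using k by simp
    moreover have "(\<lambda>i. k * p i + (k - 1) * - p i) = p" by (auto simp: algebra_simps)
    ultimately show False using n by simp
  qed
  show ?thesis
    using assms(3-5)
  proof (induction V arbitrary: P rule: finite_induct)
    case empty
    hence "p = (\<lambda>i. 0)" if "p \<in> P" for p using that by auto
    thus ?case using zero by auto
  next
    case (insert j V)
    define S where "S r p = (\<Sum>i\<in>V. real_of_int (p i) * r i)" for r :: "'v \<Rightarrow> real" and p :: "'v \<Rightarrow> int"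
    define neg where "neg p = (\<lambda>i. - p i)" for p :: "'v \<Rightarrow> int"
    \<comment> \<open>the combination in which coordinate \<open>j\<close> cancels\<close>
    define comb where "comb p q = (\<lambda>i. q j * p i - p j * q i)" for p q :: "'v \<Rightarrow> int"
    \<comment> \<open>all vectors with a nonzero \<open>j\<close>-coordinate, normalised to a positive one\<close>
    define N where "N = {p \<in> P. p j > 0} \<union> neg ` {p \<in> P. p j < 0}"
    define P' where "P' = {p \<in> P. p j = 0} \<union> (\<lambda>(p, q). comb p q) ` (N \<times> N)"
    have N: "finite N" "\<And>p. p \<in> N \<Longrightarrow> p j > 0"
      using insert.prems(1) by (auto simp: N_def neg_def)
    have N0: "p i = 0" if "p \<in> N" "i \<notin> insert j V" for p i
      using that insert.prems(2) by (auto simp: N_def neg_def)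
    have c0: "comb p q i = 0" if "p \<in> N" "q \<in> N" "i \<notin> V" for p q i
      using N0[OF that(1), of i] N0[OF that(2), of i] that(3) by (cases "i = j") (auto simp: comb_def)
    have "finite P'" using insert.prems(1) N by (simp add: P'_def)
    moreover have "p i = 0" if "p \<in> P'" "i \<notin> V" for p i
      using that insert.prems(2)[of p i] c0 by (cases "i = j") (auto simp: P'_def)
    ultimately obtain r where r: "\<And>p. p \<in> P' \<Longrightarrow> Q p \<longleftrightarrow> 0 \<le> S r p"
      unfolding S_def using insert.IH[of P'] by blast
    \<comment> \<open>the weight of \<open>j\<close> at which \<open>p\<close> would change its sign\<close>
    define root where "root p = - S r p / p j" for p
    have root_le: "root p \<le> root q \<longleftrightarrow> Q (comb p q)" if pq: "p \<in> N" "q \<in> N" for p q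
    proof -
      have "S r (comb p q) = q j * S r p - p j * S r q"
        by (simp add: S_def comb_def sum_distrib_left sum_subtractf algebra_simps)
      moreover have "comb p q \<in> P'" using pq by (auto simp: P'_def)
      moreover have "root p \<le> root q \<longleftrightarrow> p j * S r q \<le> q j * S r p"
        using N(2)[OF pq(1)] N(2)[OF pq(2)] by (simp add: root_def field_simps)
      ultimately show ?thesis using r[of "comb p q"] by auto
    qed
    have le: "root p \<le> root q" if pq: "p \<in> N" "q \<in> N" and Q: "Q p" "Q (neg q)" for p q
    proof -
      have "Q (\<lambda>i. q j * p i + p j * neg q i)"
        using add[OF scale[OF Q(1)] scale[OF Q(2)]] N(2)[OF pq(1)] N(2)[OF pq(2)] by (simp add: less_imp_le)
      moreover have "(\<lambda>i. q j * p i + p j * neg q i) = comb p q"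
        by (auto simp: comb_def neg_def)
      ultimately show ?thesis using root_le[OF pq] by simp
    qed
    have less1: "root p < root q" if pq: "p \<in> N" "q \<in> N" and Q: "Q p" "\<not> Q q" for p q
    proof (rule ccontr)
      assume "\<not> root p < root q"
      hence "Q (comb q p)" using root_le[OF pq(2,1)] by simp
      hence "Q (\<lambda>i. comb q p i + q j * p i)"
        using add[OF _ scale[OF Q(1)]] N(2)[OF pq(2)] by (simp add: less_imp_le)
      moreover have "(\<lambda>i. comb q p i + q j * p i) = (\<lambda>i. p j * q i)" by (auto simp: comb_def)
      ultimately show False using unscale[of "p j" q] N(2)[OF pq(1)] Q by simp
    qed
    have less2: "root p < root q" if pq: "p \<in> N" "q \<in> N" and Q: "\<not> Q (neg p)" "Q (neg q)" for p q
    proof (rule ccontr)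
      assume "\<not> root p < root q"
      hence "Q (comb q p)" using root_le[OF pq(2,1)] by simp
      hence "Q (\<lambda>i. comb q p i + p j * neg q i)"
        using add[OF _ scale[OF Q(2)]] N(2)[OF pq(1)] by (simp add: less_imp_le)
      moreover have "(\<lambda>i. comb q p i + p j * neg q i) = (\<lambda>i. q j * neg p i)"
        by (auto simp: comb_def neg_def)
      ultimately show False using unscale[of "q j" "neg p"] N(2)[OF pq(2)] Q by simp
    qed
    have tot: "Q p \<or> Q (neg p)" for p using total[of p] by (simp add: neg_def)
    have "\<exists>x. \<forall>p\<in>N. (Q p \<longleftrightarrow> root p \<le> x) \<and> (Q (neg p) \<longleftrightarrow> x \<le> root p)"
    proof (cases "\<exists>e\<in>N. Q e \<and> Q (neg e)")
      case True
      then obtain e where e: "e \<in> N" "Q e" "Q (neg e)" by blast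
      show ?thesis
        using le less1 less2 e by (intro exI[of _ "root e"]) (meson not_le)
    next
      case False
      have "\<exists>x. (\<forall>l\<in>root ` {p \<in> N. Q p}. l < x) \<and> (\<forall>u\<in>root ` {p \<in> N. \<not> Q p}. x < u)"
        using N(1) less1 by (intro finite_real_gap) auto
      then obtain x where "\<forall>l\<in>root ` {p \<in> N. Q p}. l < x" "\<forall>u\<in>root ` {p \<in> N. \<not> Q p}. x < u"
        by (elim exE conjE)
      hence x: "\<And>p. p \<in> N \<Longrightarrow> Q p \<Longrightarrow> root p < x" "\<And>p. p \<in> N \<Longrightarrow> \<not> Q p \<Longrightarrow> x < root p"
        by simp_all
      have "(Q p \<longleftrightarrow> root p \<le> x) \<and> (Q (neg p) \<longleftrightarrow> x \<le> root p)" if "p \<in> N" for p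
        using x(1)[OF that] x(2)[OF that] False tot[of p] that by (cases "Q p") auto
      thus ?thesis by blast
    qed
    then obtain x where x: "\<And>p. p \<in> N \<Longrightarrow> Q p \<longleftrightarrow> root p \<le> x"
        "\<And>p. p \<in> N \<Longrightarrow> Q (neg p) \<longleftrightarrow> x \<le> root p" by blast
    have "Q p \<longleftrightarrow> 0 \<le> (\<Sum>i\<in>insert j V. real_of_int (p i) * (r(j := x)) i)" if p: "p \<in> P" for p
    proof -
      have "(\<Sum>i\<in>V. real_of_int (p i) * (r(j := x)) i) = S r p"
        unfolding S_def using insert.hyps by (intro sum.cong) auto
      hence s: "(\<Sum>i\<in>insert j V. real_of_int (p i) * (r(j := x)) i) = p j * x + S r p"
        using insert.hyps by simp
      consider "p j = 0" | "p j > 0" | "p j < 0" by linarith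
      thus ?thesis
      proof cases
        case 1
        hence "p \<in> P'" using p by (simp add: P'_def)
        thus ?thesis using r 1 s by simp
      next
        case 2
        hence "p \<in> N" using p by (simp add: N_def)
        moreover have "root p \<le> x \<longleftrightarrow> 0 \<le> p j * x + S r p"
          using 2 by (auto simp: root_def field_simps)
        ultimately show ?thesis using x(1)[of p] unfolding s by simp
      next
        case 3
        hence "neg p \<in> N" using p by (simp add: N_def)
        moreover have "neg (neg p) = p" by (simp add: neg_def)
        moreover have "S r (neg p) = - S r p" by (simp add: S_def neg_def sum_negf)
        moreover have "neg p j = - p j" by (simp add: neg_def)
        moreover have "x \<le> - S r p / p j \<longleftrightarrow> 0 \<le> p j * x + S r p"
          using 3 by (auto simp: field_simps)
        ultimately show ?thesis using x(2)[of "neg p"] unfolding s by (simp add: root_def)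
      qed
    qed
    thus ?case by blast
  qed
qed

section \<open>Finite embeddings of components\<close>

context hoop_chain
begin

text \<open>An exponent vector with negative entries is represented by a pair of monomials with natural exponents.
  By cancellation the comparison of the two monomials depends only on the difference of their exponents,
  so it defines an additive total preorder on integer vectors. The inequalities between \<open>x \<otimes> y\<close> and \<open>z\<close>
  correspond to finitely many vectors.\<close>

lemma cancellative_part_weights:
  assumes M: "M \<subseteq> carrier A" "\<one> \<in> M" and mult: "\<And>x y. x \<in> M \<Longrightarrow> y \<in> M \<Longrightarrow> x \<otimes> y \<in> M"
    and cancel: "\<And>x y. x \<in> M \<Longrightarrow> y \<in> M \<Longrightarrow> x \<rightarrow> (x \<otimes> y) = y"
    and G: "finite G" "G \<subseteq> M"
  shows "\<exists>r::'a \<Rightarrow> real. \<forall>x\<in>G. \<forall>y\<in>G. \<forall>z\<in>G.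
    (x \<otimes> y \<preceq> z \<longleftrightarrow> r x + r y \<le> r z) \<and> (z \<preceq> x \<otimes> y \<longleftrightarrow> r z \<le> r x + r y)"
proof -
  have MC: "x \<in> carrier A" if "x \<in> M" for x using M that by auto
  have pow: "x [^] n \<in> M" if "x \<in> M" for x and n :: nat
    using that M(2) mult MC by (induction n) simp_all
  define mon where "mon a = finprod A (\<lambda>x. x [^] a x) G" for a :: "'a \<Rightarrow> nat"
  have Gpow: "(\<lambda>x. x [^] a x) \<in> Pi H (\<lambda>_. carrier A)" if "H \<subseteq> M" for a :: "'a \<Rightarrow> nat" and H :: "'a set"
    using that MC by auto
  have "finprod A (\<lambda>x. x [^] a x) H \<in> M" if "finite H" "H \<subseteq> M" for a :: "'a \<Rightarrow> nat" and H :: "'a set"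
    using that
  proof (induction H rule: finite_induct)
    case (insert x H)
    thus ?case using Gpow[of H a] pow mult MC by simp
  qed (use M in simp)
  hence mon_M: "mon a \<in> M" for a using G by (simp add: mon_def)
  hence mon_C [simp]: "mon a \<in> carrier A" for a using MC by blast
  have mon_add: "mon (\<lambda>x. a x + b x) = mon a \<otimes> mon b" for a b
  proof -
    have "mon (\<lambda>x. a x + b x) = finprod A (\<lambda>x. x [^] a x \<otimes> x [^] b x) G"
      unfolding mon_def using G MC by (intro finprod_cong') (auto simp: nat_pow_mult)
    also have "\<dots> = mon a \<otimes> mon b" unfolding mon_def using Gpow G by (intro finprod_multf) auto
    finally show ?thesis .
  qed
  define e where "e x = (\<lambda>y. if y = x then 1 else 0 :: nat)" for x :: 'a
  have mon_e: "mon (e x) = x" if x: "x \<in> G" for x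
  proof -
    have "mon (e x) = finprod A (\<lambda>j. if x = j then j else \<one>) G"
      unfolding mon_def e_def using G MC by (intro finprod_cong') (auto split: if_splits)
    also have "\<dots> = x" using finprod_singleton[of x G "\<lambda>j. j"] G x MC by auto
    finally show ?thesis .
  qed
  \<comment> \<open>cancellation makes multiplication reflect the order\<close>
  have le_cancel: "x \<preceq> y" if u: "u \<in> M" and "x \<in> M" "y \<in> M" and le: "u \<otimes> x \<preceq> u \<otimes> y" for u x y
    using impl_mono[OF le, of u] cancel that MC by simp
  define Q where "Q p \<longleftrightarrow> (\<exists>a b. p = (\<lambda>x. int (a x) - int (b x)) \<and> mon b \<preceq> mon a)" for p
  have Q: "Q (\<lambda>x. int (a x) - int (b x)) \<longleftrightarrow> mon b \<preceq> mon a" for a b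
  proof
    assume "Q (\<lambda>x. int (a x) - int (b x))"
    then obtain a' b' where eq: "(\<lambda>x. int (a x) - int (b x)) = (\<lambda>x. int (a' x) - int (b' x))"
      and le: "mon b' \<preceq> mon a'" unfolding Q_def by blast
    have "a x + b' x = a' x + b x" for x using fun_cong[OF eq, of x] by linarith
    hence "mon a \<otimes> mon b' = mon a' \<otimes> mon b" by (simp flip: mon_add)
    moreover have "mon b \<otimes> mon b' \<preceq> mon b \<otimes> mon a'" using le by (simp add: mult_mono_right)
    ultimately have "mon b' \<otimes> mon b \<preceq> mon b' \<otimes> mon a" by (simp add: m_comm)
    thus "mon b \<preceq> mon a" using le_cancel mon_M by blast
  qed (auto simp: Q_def)
  have add: "Q (\<lambda>i. p i + q i)" if "Q p" "Q q" for p q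
  proof -
    obtain a b where 1: "p = (\<lambda>x. int (a x) - int (b x))" "mon b \<preceq> mon a"
      using \<open>Q p\<close> unfolding Q_def by blast
    obtain a' b' where 2: "q = (\<lambda>x. int (a' x) - int (b' x))" "mon b' \<preceq> mon a'"
      using \<open>Q q\<close> unfolding Q_def by blast
    note * = 1 2
    have eq: "(\<lambda>i. p i + q i) = (\<lambda>x. int (a x + a' x) - int (b x + b' x))" using * by auto
    have "mon (\<lambda>x. b x + b' x) \<preceq> mon (\<lambda>x. a x + a' x)"
      using * by (simp add: mon_add mult_mono)
    thus ?thesis unfolding eq Q .
  qed
  have total: "Q p \<or> Q (\<lambda>i. - p i)" for p
  proof -
    define a where "a x = nat (p x)" for x
    define b where "b x = nat (- p x)" for x
    have "p = (\<lambda>x. int (a x) - int (b x))" "(\<lambda>i. - p i) = (\<lambda>x. int (b x) - int (a x))"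
      by (auto simp: a_def b_def)
    thus ?thesis using Q[of a b] Q[of b a] linear[of "mon a" "mon b"] by auto
  qed
  \<comment> \<open>the vectors of \<open>x \<otimes> y / z\<close> and of \<open>z / (x \<otimes> y)\<close>\<close>
  define row where "row x y z = (\<lambda>i. int (e x i + e y i) - int (e z i))" for x y z
  define row' where "row' x y z = (\<lambda>i. int (e z i) - int (e x i + e y i))" for x y z
  define P where "P = (\<lambda>(x, y, z). row x y z) ` (G \<times> G \<times> G) \<union> (\<lambda>(x, y, z). row' x y z) ` (G \<times> G \<times> G)"
  have "finite P" using G by (simp add: P_def)
  moreover have "p i = 0" if "p \<in> P" "i \<notin> G" for p i
    using that by (auto simp: P_def row_def row'_def e_def)
  ultimately obtain r where r: "\<And>p. p \<in> P \<Longrightarrow> Q p \<longleftrightarrow> 0 \<le> (\<Sum>i\<in>G. real_of_int (p i) * r i)"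
    using additive_total_real_weights[of Q G P, OF add total] G(1) by blast
  have e_sum: "(\<Sum>i\<in>G. real (e x i) * r i) = r x" if "x \<in> G" for x
  proof -
    have "(\<Sum>i\<in>G. real (e x i) * r i) = (\<Sum>i\<in>G. if i = x then r i else 0)"
      unfolding e_def by (intro sum.cong) auto
    thus ?thesis using that G by simp
  qed
  have "(x \<otimes> y \<preceq> z \<longleftrightarrow> r x + r y \<le> r z) \<and> (z \<preceq> x \<otimes> y \<longleftrightarrow> r z \<le> r x + r y)"
    if xyz: "x \<in> G" "y \<in> G" "z \<in> G" for x y z
  proof -
    have "Q (row x y z) \<longleftrightarrow> z \<preceq> x \<otimes> y" "Q (row' x y z) \<longleftrightarrow> x \<otimes> y \<preceq> z"
      unfolding row_def row'_def Q by (simp_all add: mon_add mon_e xyz)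
    moreover have "(\<Sum>i\<in>G. real_of_int (row x y z i) * r i) = r x + r y - r z"
      "(\<Sum>i\<in>G. real_of_int (row' x y z i) * r i) = r z - (r x + r y)"
      unfolding row_def row'_def using xyz
      by (simp_all add: left_diff_distrib distrib_right sum.distrib sum_subtractf e_sum)
    moreover have "row x y z \<in> P"
      unfolding P_def using xyz by (intro UnI1 image_eqI[of _ _ "(x, y, z)"]) simp_all
    moreover have "row' x y z \<in> P"
      unfolding P_def using xyz by (intro UnI2 image_eqI[of _ _ "(x, y, z)"]) simp_all
    ultimately show ?thesis using r[of "row x y z"] r[of "row' x y z"] by simp
  qed
  thus ?thesis by blast
qed

definition interval_embedding :: "'a set \<Rightarrow> ('a \<Rightarrow> real) \<Rightarrow> bool" where
  "interval_embedding G g \<longleftrightarrow> g \<one> = 1 \<and> (\<forall>x\<in>G. 0 < g x \<and> g x \<le> 1 \<and> (g x = 1 \<longrightarrow> x = \<one>)) \<and>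
    (\<forall>x\<in>G. \<forall>y\<in>G. (x \<otimes> y \<in> G \<longrightarrow> g (x \<otimes> y) = g x * g y) \<and>
       (x \<rightarrow> y \<in> G \<longrightarrow> g (x \<rightarrow> y) = min 1 (g y / g x)))"

text \<open>The exponential turns the weights into numbers in \<open>(0, 1]\<close> and sums into products. For \<open>y \<preceq> x\<close> the
  residuum is determined by \<open>x \<otimes> (x \<rightarrow> y) = y\<close>.\<close>

lemma cancellative_part_embedding:
  assumes M: "M \<subseteq> carrier A" "\<one> \<in> M" and mult: "\<And>x y. x \<in> M \<Longrightarrow> y \<in> M \<Longrightarrow> x \<otimes> y \<in> M"
    and cancel: "\<And>x y. x \<in> M \<Longrightarrow> y \<in> M \<Longrightarrow> x \<rightarrow> (x \<otimes> y) = y"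
    and G: "finite G" "G \<subseteq> M"
  shows "\<exists>g. interval_embedding G g"
proof -
  have "\<exists>r::'a \<Rightarrow> real. \<forall>x\<in>insert \<one> G. \<forall>y\<in>insert \<one> G. \<forall>z\<in>insert \<one> G.
      (x \<otimes> y \<preceq> z \<longleftrightarrow> r x + r y \<le> r z) \<and> (z \<preceq> x \<otimes> y \<longleftrightarrow> r z \<le> r x + r y)"
    by (rule cancellative_part_weights[OF M mult cancel]) (use G M in simp_all)
  then obtain r :: "'a \<Rightarrow> real" where "\<forall>x\<in>insert \<one> G. \<forall>y\<in>insert \<one> G. \<forall>z\<in>insert \<one> G.
      (x \<otimes> y \<preceq> z \<longleftrightarrow> r x + r y \<le> r z) \<and> (z \<preceq> x \<otimes> y \<longleftrightarrow> r z \<le> r x + r y)" ..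
  hence r: "(x \<otimes> y \<preceq> z \<longleftrightarrow> r x + r y \<le> r z) \<and> (z \<preceq> x \<otimes> y \<longleftrightarrow> r z \<le> r x + r y)"
    if "x \<in> insert \<one> G" "y \<in> insert \<one> G" "z \<in> insert \<one> G" for x y z
    using that by blast
  have C [simp]: "x \<in> carrier A" if "x \<in> G" for x using that M G by auto
  have r1: "r \<one> = 0" using r[of \<one> \<one> \<one>] by simp
  have neg: "r x \<le> 0" "r x = 0 \<longrightarrow> x = \<one>" if x: "x \<in> G" for x
    using r[of x \<one> \<one>] x r1 by (auto simp: one_hle)
  have mult': "r (x \<otimes> y) = r x + r y" if "x \<in> G" "y \<in> G" "x \<otimes> y \<in> G" for x y
    using r[of x y "x \<otimes> y"] that by simp
  have imp: "r (x \<rightarrow> y) = min 0 (r y - r x)" if xy: "x \<in> G" "y \<in> G" "x \<rightarrow> y \<in> G" for x y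
  proof (cases "x \<preceq> y")
    case True
    thus ?thesis using r[of x \<one> y] xy r1 by (simp add: hoop_le_def)
  next
    case False
    hence "y \<preceq> x" using not_hle xy by simp
    hence "x \<otimes> (x \<rightarrow> y) = y" "r y \<le> r x" using r[of y \<one> x] r1 xy by (simp_all add: inf_eq)
    thus ?thesis using r[of x "x \<rightarrow> y" y] xy by simp
  qed
  show ?thesis unfolding interval_embedding_def
  proof (intro exI[of _ "\<lambda>x. exp (r x)"] conjI ballI impI)
    fix x y assume "x \<in> G" "y \<in> G" "x \<rightarrow> y \<in> G"
    thus "exp (r (x \<rightarrow> y)) = min 1 (exp (r y) / exp (r x))"
      using imp[of x y] by (auto simp: min_def exp_diff)
  qed (use neg mult' r1 in \<open>auto simp: exp_add\<close>)
qed

definition component_embedding :: "'a set \<Rightarrow> ('a \<Rightarrow> real rotation) \<Rightarrow> bool" where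
  "component_embedding S h \<longleftrightarrow> h \<one> = Orig 1 \<and>
     (\<forall>x\<in>S. h x \<in> carrier chang_V \<and> (h x = Orig 1 \<longrightarrow> x = \<one>)) \<and>
     (\<forall>x\<in>S. \<forall>y\<in>S.
        (x \<otimes> y \<in> S \<longrightarrow> h (x \<otimes> y) = rot_mult standard_cancellative_hoop (h x) (h y)) \<and>
        (x \<rightarrow> y \<in> S \<longrightarrow> h (x \<rightarrow> y) = rot_impl standard_cancellative_hoop (h x) (h y)))"

lemma carrier_chang_V: "carrier chang_V = Orig ` {0<..1} \<union> Copy ` {0<..1}"
  by (simp add: chang_V_def disconnected_rotation_def standard_cancellative_hoop_def)

text \<open>Without a least element every product in the component lies strictly above some element of it, so the
  whole component is cancellative and embeds into the upper half of \<open>\<V>\<close>.\<close>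

lemma unbounded_component_embedding:
  assumes c: "c \<in> carrier A" "c \<noteq> \<one>"
    and unbounded: "\<And>x. x \<in> carrier A \<Longrightarrow> above x = above c \<Longrightarrow>
      \<exists>y\<in>carrier A. above y = above c \<and> y \<preceq> x \<and> y \<noteq> x"
    and S: "finite S" "S \<subseteq> component c"
  shows "\<exists>h. component_embedding S h"
proof -
  have cancel: "x \<rightarrow> (x \<otimes> y) = y" if xy: "x \<in> component c" "y \<in> component c" for x y
  proof -
    have m: "x \<otimes> y \<in> component c" using component_mult_closed[OF xy] .
    have "\<exists>d\<in>carrier A. above d = above c \<and> d \<preceq> x \<otimes> y \<and> d \<noteq> x \<otimes> y"
    proof (cases "x \<otimes> y = \<one>")
      case False
      thus ?thesis using unbounded[of "x \<otimes> y"] component_closed[OF m] componentD[OF m] by simp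
    qed (use c in auto)
    then obtain d where d: "d \<in> carrier A" "above d = above c" "d \<preceq> x \<otimes> y" "d \<noteq> x \<otimes> y" by blast
    have "d \<noteq> \<one>" using above_not_one[OF c d(2)] .
    thus ?thesis using component_cancel[of d x y] d componentD[OF xy(1)] componentD[OF xy(2)]
        component_closed[OF xy(1)] component_closed[OF xy(2)]
      by simp
  qed
  have "component c \<subseteq> carrier A" by (auto simp: component_closed)
  from cancellative_part_embedding[OF this one_component component_mult_closed cancel S]
  obtain g where "interval_embedding S g" by blast
  hence g: "g \<one> = 1" "\<And>x. x \<in> S \<Longrightarrow> 0 < g x \<and> g x \<le> 1 \<and> (g x = 1 \<longrightarrow> x = \<one>)"
    "\<And>x y. x \<in> S \<Longrightarrow> y \<in> S \<Longrightarrow> x \<otimes> y \<in> S \<Longrightarrow> g (x \<otimes> y) = g x * g y"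
    "\<And>x y. x \<in> S \<Longrightarrow> y \<in> S \<Longrightarrow> x \<rightarrow> y \<in> S \<Longrightarrow> g (x \<rightarrow> y) = min 1 (g y / g x)"
    by (simp_all add: interval_embedding_def)
  show ?thesis unfolding component_embedding_def carrier_chang_V
    using g by (intro exI[of _ "\<lambda>x. Orig (g x)"]) (auto simp: standard_cancellative_hoop_def)
qed

end

context bounded_component
begin

text \<open>Radical elements go to \<^const>\<open>Orig\<close>, the others to the \<^const>\<open>Copy\<close> of the image of their negation. The set \<open>G\<close>
  on which the embedding of the radical has to be correct therefore contains the negations as well.\<close>

lemma bounded_component_embedding:
  assumes S: "finite S" "S \<subseteq> component b"
  shows "\<exists>h. component_embedding S h \<and> h b = Copy 1"
proof -
  define G where "G = (insert \<one> S \<union> (\<lambda>x. x \<rightarrow> b) ` S) \<inter> radical"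
  have G: "finite G" "G \<subseteq> radical" using S by (auto simp: G_def)
  have "radical \<subseteq> carrier A" by auto
  from cancellative_part_embedding[OF this one_radical radical_mult radical_cancel G]
  obtain g where "interval_embedding G g" by blast
  hence g1: "g \<one> = 1"
    and g: "\<And>x. x \<in> G \<Longrightarrow> 0 < g x \<and> g x \<le> 1 \<and> (g x = 1 \<longrightarrow> x = \<one>)"
    and gm: "\<And>x y. x \<in> G \<Longrightarrow> y \<in> G \<Longrightarrow> x \<otimes> y \<in> G \<Longrightarrow> g (x \<otimes> y) = g x * g y"
    and gi: "\<And>x y. x \<in> G \<Longrightarrow> y \<in> G \<Longrightarrow> x \<rightarrow> y \<in> G \<Longrightarrow> g (x \<rightarrow> y) = min 1 (g y / g x)"
    by (simp_all add: interval_embedding_def)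
  define h where "h x = (if x \<in> radical then Orig (g x) else Copy (g (x \<rightarrow> b)))" for x
  have W: "x \<in> component b" if "x \<in> S" for x using S that by auto
  have C: "x \<in> carrier A" if "x \<in> S" for x using W[OF that] by simp
  have inG: "x \<in> G" if "x \<in> S" "x \<in> radical" for x using that by (simp add: G_def)
  have negG: "x \<rightarrow> b \<in> G" if "x \<in> S" "x \<notin> radical" for x
    using radical_or_neg[OF W[OF that(1)]] that by (auto simp: G_def)
  have negR: "x \<rightarrow> b \<in> radical" if "x \<in> S" "x \<notin> radical" for x
    using negG[OF that] G by auto
  have nn: "(x \<rightarrow> b) \<rightarrow> b = x" if "x \<in> S" for x using neg_neg W that by blast
  have mult: "h (x \<otimes> y) = rot_mult standard_cancellative_hoop (h x) (h y)"
    if xy: "x \<in> S" "y \<in> S" "x \<otimes> y \<in> S" for x y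
  proof -
    have mixed: "h (x \<otimes> y) = Copy (min 1 (g (y \<rightarrow> b) / g x))"
      if xy: "x \<in> S" "y \<in> S" "x \<otimes> y \<in> S" and x: "x \<in> radical" and y: "y \<notin> radical" for x y
    proof -
      have "x \<otimes> y \<notin> radical"
        using radical_upward[of "x \<otimes> y" y] mult_le_right[of x y] y W C xy by blast
      moreover have "(x \<otimes> y) \<rightarrow> b = x \<rightarrow> (y \<rightarrow> b)" using C xy by (simp add: impl_curry)
      ultimately show ?thesis
        using gi[of x "y \<rightarrow> b"] inG[of x] negG[of y] negG[of "x \<otimes> y"] x y xy by (simp add: h_def)
    qed
    consider "x \<in> radical" "y \<in> radical" | "x \<in> radical" "y \<notin> radical"
      | "x \<notin> radical" "y \<in> radical" | "x \<notin> radical" "y \<notin> radical" by blast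
    thus ?thesis
    proof cases
      case 1
      thus ?thesis using gm[of x y] inG[of x] inG[of y] inG[of "x \<otimes> y"] xy radical_mult[OF 1]
        by (simp add: h_def standard_cancellative_hoop_def)
    next
      case 2
      thus ?thesis using mixed[OF xy 2] by (simp add: h_def standard_cancellative_hoop_def)
    next
      case 3
      have "y \<otimes> x \<in> S" using xy C by (simp add: m_comm)
      from mixed[OF xy(2,1) this 3(2,1)] show ?thesis
        using 3 xy C by (simp add: h_def standard_cancellative_hoop_def m_comm)
    next
      case 4
      \<comment> \<open>co-radical elements lie below radical ones, hence below the negation of each other\<close>
      have "x \<preceq> y \<rightarrow> b"
      proof (rule ccontr)
        assume "\<not> x \<preceq> y \<rightarrow> b"
        hence "y \<rightarrow> b \<preceq> x" using not_hle xy C by simp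
        thus False using radical_upward[OF negR[OF xy(2) 4(2)]] W[OF xy(1)] 4 by blast
      qed
      hence "x \<otimes> y \<preceq> b" using xy C by (simp add: residuated)
      hence "x \<otimes> y = b" using b_le[OF W[OF xy(3)]] hle_antisym xy C by simp
      thus ?thesis using 4 b_not_radical g1
        by (simp add: h_def standard_cancellative_hoop_def impl_refl)
    qed
  qed
  have impl: "h (x \<rightarrow> y) = rot_impl standard_cancellative_hoop (h x) (h y)"
    if xy: "x \<in> S" "y \<in> S" "x \<rightarrow> y \<in> S" for x y
  proof -
    consider "x \<in> radical" "y \<in> radical" | "x \<in> radical" "y \<notin> radical"
      | "x \<notin> radical" "y \<in> radical" | "x \<notin> radical" "y \<notin> radical" by blast
    thus ?thesis
    proof cases
      case 1
      have "x \<rightarrow> y \<in> radical"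
        using radical_upward[OF 1(2) _ W[OF xy(3)]] le_impl[of y x] C xy by blast
      thus ?thesis using gi[of x y] inG[of x] inG[of y] inG[of "x \<rightarrow> y"] xy 1
        by (simp add: h_def standard_cancellative_hoop_def)
    next
      case 2
      have yx: "y \<preceq> x"
        using radical_upward[OF 2(1) _ W[OF xy(2)]] 2 not_hle C xy by blast
      have n: "x \<rightarrow> y \<notin> radical"
        using radical_mult[OF 2(1), of "x \<rightarrow> y"] inf_eq[OF yx] C xy 2 by auto
      have "x \<otimes> (y \<rightarrow> b) \<in> radical" using radical_mult[OF 2(1) negR[OF xy(2) 2(2)]] .
      hence "((x \<otimes> (y \<rightarrow> b)) \<rightarrow> b) \<rightarrow> b = x \<otimes> (y \<rightarrow> b)"
        using neg_neg radical_component by blast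
      moreover have "(x \<otimes> (y \<rightarrow> b)) \<rightarrow> b = x \<rightarrow> y"
        using C xy nn[OF xy(2)] by (simp flip: impl_curry)
      ultimately have "(x \<rightarrow> y) \<rightarrow> b = x \<otimes> (y \<rightarrow> b)" by simp
      thus ?thesis
        using gm[of x "y \<rightarrow> b"] inG[of x] negG[of y] negG[of "x \<rightarrow> y"] 2 n xy
        by (simp add: h_def standard_cancellative_hoop_def)
    next
      case 3
      have "x \<preceq> y"
        using radical_upward[OF 3(2) _ W[OF xy(1)]] 3 not_hle C xy by blast
      hence "x \<rightarrow> y = \<one>" by (simp add: hoop_le_def)
      thus ?thesis using 3 g1 by (simp add: h_def standard_cancellative_hoop_def)
    next
      case 4
      have eq: "x \<rightarrow> y = (y \<rightarrow> b) \<rightarrow> (x \<rightarrow> b)"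
        using impl_swap[of x "y \<rightarrow> b" b] C xy nn[OF xy(2)] by simp
      have "x \<rightarrow> y \<in> radical" unfolding eq
        using radical_upward[OF negR[OF xy(1) 4(1)], of "(y \<rightarrow> b) \<rightarrow> (x \<rightarrow> b)"] 
          le_impl[of "x \<rightarrow> b" "y \<rightarrow> b"] W[OF xy(3)] C xy eq by simp
      thus ?thesis
        using gi[of "y \<rightarrow> b" "x \<rightarrow> b"] negG[of x] negG[of y] inG[of "x \<rightarrow> y"] 4 xy eq
        by (simp add: h_def standard_cancellative_hoop_def)
    qed
  qed
  have "h x \<in> carrier chang_V \<and> (h x = Orig 1 \<longrightarrow> x = \<one>)" if "x \<in> S" for x
    using g[OF inG[OF that]] g[OF negG[OF that]] by (auto simp: h_def carrier_chang_V)
  moreover have "h \<one> = Orig 1" "h b = Copy 1"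
    using g1 b_not_radical by (simp_all add: h_def impl_refl)
  ultimately show ?thesis using mult impl unfolding component_embedding_def by blast
qed

end

section \<open>Finite embeddings of chains satisfying the Chang identity\<close>

lemma omegaV_simps:
  "monoid.mult omegaV = os_mult {(m, n). m \<le> n} (\<lambda>_. chang_V)"
  "impl omegaV = os_impl {(m, n). m \<le> n} (\<lambda>_. chang_V)"
  "one omegaV = None"
  "carrier omegaV = (\<Union>i. os_emb (\<lambda>_. chang_V) (i :: nat) ` carrier chang_V)"
  by (simp_all add: omegaV_def ordinal_sum_def Let_def)

lemma chang_V_simps:
  "monoid.mult chang_V = rot_mult standard_cancellative_hoop"
  "impl chang_V = rot_impl standard_cancellative_hoop"
  "one chang_V = Orig 1"
  by (simp_all add: chang_V_def disconnected_rotation_def standard_cancellative_hoop_def)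

context chang_chain
begin

lemma component_embeds:
  assumes c: "c \<in> carrier A" "c \<noteq> \<one>" and z: "z \<in> carrier A" "\<And>x. x \<in> carrier A \<Longrightarrow> z \<preceq> x"
    and S: "finite S" "S \<subseteq> component c"
  shows "\<exists>h. component_embedding S h \<and> (above c = above z \<longrightarrow> h z = Copy 1)"
proof (cases "\<exists>b\<in>carrier A. above b = above c \<and> (\<forall>x\<in>carrier A. above x = above c \<longrightarrow> b \<preceq> x)")
  case True
  then obtain b where b: "b \<in> carrier A" "above b = above c"
    "\<And>x. x \<in> carrier A \<Longrightarrow> above x = above c \<Longrightarrow> b \<preceq> x" by blast
  have cb: "component c = component b" using b(2) by (simp add: component_def)
  interpret bounded_component A b
  proof unfold_locales
    show "b \<in> carrier A" by (fact b(1))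
    show "b \<noteq> \<one>" by (fact above_not_one[OF c b(2)])
    show "b \<preceq> x" if "x \<in> carrier A" "above x = above b" for x
      using b(3)[OF that(1)] that(2) b(2) by simp
  qed
  have "\<exists>h. component_embedding S h \<and> h b = Copy 1"
    using bounded_component_embedding[OF S(1) S(2)[unfolded cb]] .
  moreover have "b = z" if "above c = above z"
    using b(3)[OF z(1)] z(2)[OF b(1)] that b(1) z(1) hle_antisym by simp
  ultimately show ?thesis by blast
next
  case False
  have "\<exists>y\<in>carrier A. above y = above c \<and> y \<preceq> x \<and> y \<noteq> x"
    if x: "x \<in> carrier A" "above x = above c" for x
  proof -
    obtain y where y: "y \<in> carrier A" "above y = above c" "\<not> x \<preceq> y" using False x by blast
    moreover have "y \<preceq> x" using not_hle x y by blast
    ultimately show ?thesis using x by (intro bexI[of _ y]) auto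
  qed
  hence "\<exists>h. component_embedding S h" using unbounded_component_embedding[OF c _ S] by blast
  moreover have "above c \<noteq> above z" using False z by metis
  ultimately show ?thesis by blast
qed

definition omegaV_embedding :: "'a \<Rightarrow> 'a set \<Rightarrow> ('a \<Rightarrow> omegaV_elem) \<Rightarrow> bool" where
  "omegaV_embedding z S H \<longleftrightarrow> H z = Some (0, Copy 1) \<and>
     (\<forall>x\<in>S. H x \<in> carrier omegaV \<and> (H x = \<one>\<^bsub>omegaV\<^esub> \<longleftrightarrow> x = \<one>)) \<and>
     (\<forall>x\<in>S. \<forall>y\<in>S. (x \<otimes> y \<in> S \<longrightarrow> H (x \<otimes> y) = H x \<otimes>\<^bsub>omegaV\<^esub> H y) \<and>
        (x \<rightarrow> y \<in> S \<longrightarrow> H (x \<rightarrow> y) = H x \<rightarrow>\<^bsub>omegaV\<^esub> H y))"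

text \<open>The components meeting \<open>S\<close> are embedded into successive copies of \<open>\<V>\<close>. The index \<open>idx x\<close> counts the
  components of \<open>S\<close> strictly below the one of \<open>x\<close>; these are the larger sets \<^const>\<open>above\<close>.\<close>

theorem finite_part_embeds_in_omegaV:
  assumes z: "z \<in> carrier A" "\<And>x. x \<in> carrier A \<Longrightarrow> z \<preceq> x" "z \<noteq> \<one>"
    and S: "finite S" "S \<subseteq> carrier A" "z \<in> S"
  shows "\<exists>H. omegaV_embedding z S H"
proof -
  define F where "F = above ` (S - {\<one>})"
  have finF: "finite F" using S by (simp add: F_def)
  have "\<forall>\<Phi>\<in>F. \<exists>h. component_embedding {x \<in> S. x = \<one> \<or> above x = \<Phi>} h \<and>
      (\<Phi> = above z \<longrightarrow> h z = Copy 1)"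
  proof
    fix \<Phi> assume "\<Phi> \<in> F"
    then obtain c where c: "c \<in> S" "c \<noteq> \<one>" "\<Phi> = above c" by (auto simp: F_def)
    have "finite {x \<in> S. x = \<one> \<or> above x = \<Phi>}" "{x \<in> S. x = \<one> \<or> above x = \<Phi>} \<subseteq> component c"
      using S c by (auto simp: component_def)
    from component_embeds[OF _ c(2) z(1,2) this] c(1,3) S(2)
    show "\<exists>h. component_embedding {x \<in> S. x = \<one> \<or> above x = \<Phi>} h \<and> (\<Phi> = above z \<longrightarrow> h z = Copy 1)"
      by auto
  qed
  from bchoice[OF this] obtain h where h: "\<forall>\<Phi>\<in>F. component_embedding {x \<in> S. x = \<one> \<or> above x = \<Phi>} (h \<Phi>) \<and>
      (\<Phi> = above z \<longrightarrow> h \<Phi> z = Copy 1)"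
    by blast
  define idx where "idx x = card {\<Phi> \<in> F. above x \<subset> \<Phi>}" for x
  define H where "H x = (if x = \<one> then None else Some (idx x, h (above x) x))" for x
  have C: "x \<in> carrier A" if "x \<in> S" for x using S that by auto
  have inF: "above x \<in> F" if "x \<in> S" "x \<noteq> \<one>" for x using that by (auto simp: F_def)
  have idx_less: "idx x < idx y" if "x \<in> S" "x \<noteq> \<one>" "above y \<subset> above x" for x y
    unfolding idx_def using finF inF[OF that(1,2)] that(3) by (intro psubset_card_mono) auto
  have idx_eq: "idx x = idx y" if "above x = above y" for x y using that by (simp add: idx_def)
  have "\<not> above z \<subset> \<Phi>" if "\<Phi> \<in> F" for \<Phi>
  proof
    assume ps: "above z \<subset> \<Phi>"
    obtain x where x: "x \<in> S" "x \<noteq> \<one>" "\<Phi> = above x" using \<open>\<Phi> \<in> F\<close> by (auto simp: F_def)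
    have "x \<preceq> z" using above_less(2)[of x z] C x z ps by simp
    hence "x = z" using z C x hle_antisym by simp
    thus False using ps x by simp
  qed
  hence "{\<Phi> \<in> F. above z \<subset> \<Phi>} = {}" by blast
  hence idx_z: "idx z = 0" unfolding idx_def by (simp only: card.empty)
  have E: "component_embedding {t \<in> S. t = \<one> \<or> above t = above x} (h (above x))"
    if "x \<in> S" "x \<noteq> \<one>" for x
    using h inF[OF that] by blast
  have emb: "h (above x) \<one> = Orig 1" "h (above x) x \<in> carrier chang_V" "h (above x) x \<noteq> Orig 1"
    if "x \<in> S" "x \<noteq> \<one>" for x
    using E[OF that] that unfolding component_embedding_def by auto
  have emb_mult: "h (above x) (x \<otimes> y) = rot_mult standard_cancellative_hoop (h (above x) x) (h (above x) y)"
    if xy: "x \<in> S" "y \<in> S" "x \<otimes> y \<in> S" "x \<noteq> \<one>" "above y = above x" for x y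
  proof -
    have "above (x \<otimes> y) = above x" using component_mult[OF C[OF xy(1)] C[OF xy(2)] xy(5)[symmetric]] .
    thus ?thesis using E[OF xy(1,4)] xy unfolding component_embedding_def by blast
  qed
  have emb_impl: "h (above x) (x \<rightarrow> y) = rot_impl standard_cancellative_hoop (h (above x) x) (h (above x) y)"
    if xy: "x \<in> S" "y \<in> S" "x \<rightarrow> y \<in> S" "x \<noteq> \<one>" "above y = above x" for x y
  proof -
    have "x \<rightarrow> y = \<one> \<or> above (x \<rightarrow> y) = above x"
      using component_impl[OF C[OF xy(1)] C[OF xy(2)] xy(5)[symmetric]] xy(5) by blast
    thus ?thesis using E[OF xy(1,4)] xy unfolding component_embedding_def by blast
  qed
  have H_mult: "H (x \<otimes> y) = H x \<otimes>\<^bsub>omegaV\<^esub> H y" if xy: "x \<in> S" "y \<in> S" "x \<otimes> y \<in> S" for x y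
  proof (cases "x = \<one> \<or> y = \<one>")
    case True
    thus ?thesis using C xy by (auto simp: H_def omegaV_simps)
  next
    case False
    hence 1: "x \<noteq> \<one>" "y \<noteq> \<one>" by auto
    from above_trichotomy[OF C[OF xy(1)] C[OF xy(2)] 1] show ?thesis
    proof (elim disjE)
      assume e: "above x = above y"
      have m: "above (x \<otimes> y) = above x" using component_mult[OF C[OF xy(1)] C[OF xy(2)] e] .
      have "x \<otimes> y \<noteq> \<one>" using above_not_one[OF C[OF xy(1)] 1(1) m] .
      thus ?thesis using emb_mult[OF xy 1(1) e[symmetric]] e m idx_eq[OF e] idx_eq[OF m] 1 emb(3)[OF xy(3)]
        by (simp add: H_def omegaV_simps os_emb_def chang_V_simps)
    next
      assume "above x \<subset> above y"
      thus ?thesis using lower_component[of y x] idx_less[of y x] 1 C xy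
        by (simp add: H_def omegaV_simps)
    next
      assume "above y \<subset> above x"
      thus ?thesis using lower_component[of x y] idx_less[of x y] 1 C xy
        by (simp add: H_def omegaV_simps)
    qed
  qed
  have H_impl: "H (x \<rightarrow> y) = H x \<rightarrow>\<^bsub>omegaV\<^esub> H y" if xy: "x \<in> S" "y \<in> S" "x \<rightarrow> y \<in> S" for x y
  proof (cases "x = \<one> \<or> y = \<one>")
    case True
    thus ?thesis using C xy by (auto simp: H_def omegaV_simps)
  next
    case False
    hence 1: "x \<noteq> \<one>" "y \<noteq> \<one>" by auto
    from above_trichotomy[OF C[OF xy(1)] C[OF xy(2)] 1] show ?thesis
    proof (elim disjE)
      assume e: "above x = above y"
      show ?thesis
      proof (cases "x \<rightarrow> y = \<one>")
        case True
        thus ?thesis using emb_impl[OF xy 1(1) e[symmetric]] e idx_eq[OF e] 1 emb(1)[OF xy(1) 1(1)]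
          by (simp add: H_def omegaV_simps os_emb_def chang_V_simps)
      next
        case False
        have m: "above (x \<rightarrow> y) = above y" using component_impl[OF C[OF xy(1)] C[OF xy(2)] e False] .
        thus ?thesis using emb_impl[OF xy 1(1) e[symmetric]] e idx_eq[OF e] idx_eq[OF m] 1 False emb(3)[OF xy(3)]
          by (simp add: H_def omegaV_simps os_emb_def chang_V_simps)
      qed
    next
      assume "above x \<subset> above y"
      thus ?thesis using lower_component[of y x] idx_less[of y x] 1 C xy
        by (simp add: H_def omegaV_simps)
    next
      assume "above y \<subset> above x"
      thus ?thesis using lower_component[of x y] idx_less[of x y] 1 C xy
        by (simp add: H_def omegaV_simps)
    qed
  qed
  have "H x \<in> carrier omegaV" if x: "x \<in> S" for x
  proof (cases "x = \<one>")
    case True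
    have "Orig 1 \<in> carrier chang_V" by (simp add: carrier_chang_V)
    thus ?thesis using True by (force simp: H_def omegaV_simps os_emb_def chang_V_simps)
  next
    case False
    thus ?thesis using emb(2,3)[OF x False]
      by (force simp: H_def omegaV_simps os_emb_def chang_V_simps)
  qed
  moreover have "H z = Some (0, Copy 1)" using h inF[OF S(3) z(3)] idx_z z(3) by (simp add: H_def)
  ultimately have "omegaV_embedding z S H"
    unfolding omegaV_embedding_def using H_mult H_impl by (simp add: H_def omegaV_simps)
  thus ?thesis by blast
qed

end

section \<open>BL-algebras as hoops\<close>

context BL_algebra
begin

lemma ble_refl: "x \<in> carrier A \<Longrightarrow> bl_le A x x"
  unfolding bl_le_def by (metis inf_sup_absorb sup_closed sup_inf_absorb)

lemma ble_antisym: "\<lbrakk>bl_le A x y; bl_le A y x; x \<in> carrier A; y \<in> carrier A\<rbrakk> \<Longrightarrow> x = y"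
  unfolding bl_le_def by (metis inf_commute)

lemma ble_impl: "\<lbrakk>x \<in> carrier A; y \<in> carrier A\<rbrakk> \<Longrightarrow> bl_le A x y \<longleftrightarrow> x \<rightarrow> y = \<one>"
proof
  assume C: "x \<in> carrier A" "y \<in> carrier A"
  have "bl_le A \<one> (x \<rightarrow> y) \<longleftrightarrow> bl_le A x y" using residuation[of x y \<one>] C by simp
  moreover have "bl_le A \<one> (x \<rightarrow> y) \<longleftrightarrow> x \<rightarrow> y = \<one>"
    using ble_antisym[of \<one> "x \<rightarrow> y"] one_greatest[of "x \<rightarrow> y"] ble_refl[of \<one>] C impl_closed by auto
  ultimately show "bl_le A x y \<Longrightarrow> x \<rightarrow> y = \<one>" "x \<rightarrow> y = \<one> \<Longrightarrow> bl_le A x y" by blast+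
qed

lemma ble_of_below:
  assumes C: "x \<in> carrier A" "y \<in> carrier A"
    and "\<And>w. w \<in> carrier A \<Longrightarrow> bl_le A w x \<longleftrightarrow> bl_le A w y"
  shows "x = y"
  using assms ble_antisym ble_refl by blast

end

sublocale BL_algebra \<subseteq> hoop
proof unfold_locales
  show "x \<rightarrow> x = \<one>" if "x \<in> carrier A" for x using that ble_impl[of x x] ble_refl by simp
  show "x \<rightarrow> (y \<rightarrow> z) = x \<otimes> y \<rightarrow> z" if C: "x \<in> carrier A" "y \<in> carrier A" "z \<in> carrier A" for x y z
  proof (rule ble_of_below)
    fix w assume w: "w \<in> carrier A"
    have "bl_le A w (x \<rightarrow> (y \<rightarrow> z)) \<longleftrightarrow> bl_le A ((w \<otimes> x) \<otimes> y) z"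
      using C w impl_closed by (simp add: residuation[symmetric])
    also have "\<dots> \<longleftrightarrow> bl_le A w (x \<otimes> y \<rightarrow> z)"
      using C w residuation[of "x \<otimes> y" z w] by (simp add: m_assoc)
    finally show "bl_le A w (x \<rightarrow> (y \<rightarrow> z)) \<longleftrightarrow> bl_le A w (x \<otimes> y \<rightarrow> z)" .
  qed (use C impl_closed in auto)
  show "x \<otimes> (x \<rightarrow> y) = y \<otimes> (y \<rightarrow> x)" if "x \<in> carrier A" "y \<in> carrier A" for x y
    using that divisibility[of x y] divisibility[of y x] inf_commute[of x y] by simp
qed (fact impl_closed)

context BL_algebra
begin

lemma ble_hle: "\<lbrakk>x \<in> carrier A; y \<in> carrier A\<rbrakk> \<Longrightarrow> bl_le A x y \<longleftrightarrow> hoop_le A x y"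
  by (simp add: ble_impl hoop_le_def)

lemma inf_hle: "\<lbrakk>x \<in> carrier A; y \<in> carrier A\<rbrakk> \<Longrightarrow> x \<curlywedge> y = x \<otimes> (x \<rightarrow> y)"
  by (fact divisibility)

lemma zero_hle: "x \<in> carrier A \<Longrightarrow> hoop_le A \<zero> x"
  using ble_hle zero_least zero_closed by blast

lemma sup_upper:
  assumes C: "x \<in> carrier A" "y \<in> carrier A"
  shows "hoop_le A x (x \<curlyvee> y)" "hoop_le A y (x \<curlyvee> y)"
proof -
  have "bl_le A x (x \<curlyvee> y)" unfolding bl_le_def using C by (rule inf_sup_absorb)
  thus "hoop_le A x (x \<curlyvee> y)" using ble_hle C sup_closed by blast
  have "bl_le A y (y \<curlyvee> x)" unfolding bl_le_def using C inf_sup_absorb by blast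
  thus "hoop_le A y (x \<curlyvee> y)" using ble_hle C sup_closed sup_commute by metis
qed

lemma sup_least:
  assumes C: "x \<in> carrier A" "y \<in> carrier A" "z \<in> carrier A" and "hoop_le A x z" "hoop_le A y z"
  shows "hoop_le A (x \<curlyvee> y) z"
proof -
  have absorb: "a \<curlyvee> z = z" if "hoop_le A a z" "a \<in> carrier A" for a
  proof -
    have "a \<curlywedge> z = a" using that C ble_hle bl_le_def by metis
    hence "z \<curlyvee> a = z" using sup_inf_absorb[of z a] inf_commute[of a z] that C by simp
    thus ?thesis using sup_commute that C by metis
  qed
  have "(x \<curlyvee> y) \<curlyvee> z = z" using absorb assms sup_assoc by metis
  hence "bl_le A (x \<curlyvee> y) z" unfolding bl_le_def using inf_sup_absorb[of "x \<curlyvee> y" z] C sup_closed by simp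
  thus ?thesis using ble_hle C sup_closed by blast
qed

text \<open>Multiplication preserves joins, so prelinearity bounds the right-hand side by \<open>x \<curlyvee> y\<close>; this makes the
  join definable from the hoop operations.\<close>

lemma sup_definable:
  assumes C: "x \<in> carrier A" "y \<in> carrier A"
  shows "x \<curlyvee> y = ((x \<rightarrow> y) \<rightarrow> y) \<curlywedge> ((y \<rightarrow> x) \<rightarrow> x)"
proof -
  define s where "s = x \<curlyvee> y"
  define a where "a = (x \<rightarrow> y) \<rightarrow> y"
  define b where "b = (y \<rightarrow> x) \<rightarrow> x"
  define m where "m = a \<curlywedge> b"
  have sC [simp]: "s \<in> carrier A" "a \<in> carrier A" "b \<in> carrier A" "m \<in> carrier A"
    using C sup_closed inf_closed by (simp_all add: s_def a_def b_def m_def)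
  have xs: "x \<preceq> s" "y \<preceq> s" using sup_upper[OF C] by (simp_all add: s_def)
  have mm: "m = a \<otimes> (a \<rightarrow> b)" "m = b \<otimes> (b \<rightarrow> a)"
    by (simp_all add: m_def inf_hle divisibility[of b a, symmetric] inf_commute[of a b] del: divisibility)
      (simp add: inf_hle[symmetric] inf_commute)
  have ma: "m \<preceq> a" "m \<preceq> b" using mm mult_le_left sC by (metis impl_closed)+
  have "m \<otimes> (x \<rightarrow> y) \<preceq> y" "m \<otimes> (y \<rightarrow> x) \<preceq> x"
    using ma C by (simp_all add: residuated a_def b_def)
  hence "m \<otimes> (x \<rightarrow> y) \<preceq> s" "m \<otimes> (y \<rightarrow> x) \<preceq> s"
    using xs C hle_trans[of "m \<otimes> (x \<rightarrow> y)" y s] hle_trans[of "m \<otimes> (y \<rightarrow> x)" x s] by simp_all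
  hence "x \<rightarrow> y \<preceq> m \<rightarrow> s" "y \<rightarrow> x \<preceq> m \<rightarrow> s"
    using C by (simp_all add: residuated[symmetric] m_comm)
  hence "\<one> \<preceq> m \<rightarrow> s"
    using sup_least[of "x \<rightarrow> y" "y \<rightarrow> x" "m \<rightarrow> s"] prelinearity[OF C] C by simp
  hence ms: "m \<preceq> s" by (simp add: one_hle hoop_le_def)
  have "x \<preceq> a" "y \<preceq> a" "x \<preceq> b" "y \<preceq> b"
    using C by (simp_all add: a_def b_def le_impl_impl le_impl)
  hence "s \<preceq> a" "s \<preceq> b" unfolding s_def using C sC sup_least by blast+
  hence "bl_le A s a" "bl_le A s b" using ble_hle by simp_all
  hence "bl_le A s m" unfolding m_def bl_le_def using inf_assoc[of s a b] by simp
  hence "s \<preceq> m" using ble_hle by simp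
  hence "s = m" using ms hle_antisym by simp
  thus ?thesis by (simp add: s_def m_def a_def b_def)
qed

end

lemma glb_in_chain:
  assumes "x \<in> C" "y \<in> C" "R x y" and R: "\<And>z. z \<in> C \<Longrightarrow> R z z"
    and anti: "\<And>a b. a \<in> C \<Longrightarrow> b \<in> C \<Longrightarrow> R a b \<Longrightarrow> R b a \<Longrightarrow> a = b"
  shows "glb_in C R x y = x" "glb_in C R y x = x" "lub_in C R x y = y" "lub_in C R y x = y"
proof -
  show "glb_in C R x y = x" "glb_in C R y x = x"
    unfolding glb_in_def by (rule the_equality; use assms in blast)+
  show "lub_in C R x y = y" "lub_in C R y x = y"
    unfolding lub_in_def by (rule the_equality; use assms in blast)+
qed

text \<open>In a chain the lattice operations are determined by the order, and prelinearity is totality.\<close>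

lemma BL_chain_of_hoop_chain:
  fixes A :: "('a, 'm) bl_scheme" (structure)
  assumes "hoop_chain A" and z: "zero A \<in> carrier A" "\<And>x. x \<in> carrier A \<Longrightarrow> hoop_le A (zero A) x"
    and inf: "\<And>x y. inf_op A x y = glb_in (carrier A) (hoop_le A) x y"
    and sup: "\<And>x y. sup_op A x y = lub_in (carrier A) (hoop_le A) x y"
  shows "BL_chain A"
proof -
  interpret hoop_chain A by fact
  have ops: "x \<curlywedge>\<^bsub>A\<^esub> y = x" "y \<curlywedge>\<^bsub>A\<^esub> x = x" "x \<curlyvee>\<^bsub>A\<^esub> y = y" "y \<curlyvee>\<^bsub>A\<^esub> x = y"
    if "x \<preceq> y" "x \<in> carrier A" "y \<in> carrier A" for x y
    using glb_in_chain[of x "carrier A" y "hoop_le A"] that hle_antisym by (simp_all add: inf sup)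
  have le: "bl_le A x y \<longleftrightarrow> x \<preceq> y" if "x \<in> carrier A" "y \<in> carrier A" for x y
    unfolding bl_le_def using ops[of x y] ops[of y x] linear[OF that] that hle_refl by metis
  show ?thesis
  proof unfold_locales
    fix x y assume C: "x \<in> carrier A" "y \<in> carrier A"
    show "x \<curlywedge>\<^bsub>A\<^esub> y \<in> carrier A" "x \<curlyvee>\<^bsub>A\<^esub> y \<in> carrier A"
      "x \<curlywedge>\<^bsub>A\<^esub> y = y \<curlywedge>\<^bsub>A\<^esub> x" "x \<curlyvee>\<^bsub>A\<^esub> y = y \<curlyvee>\<^bsub>A\<^esub> x"
      using linear[OF C] ops[of x y] ops[of y x] C by auto
    show "x \<curlywedge>\<^bsub>A\<^esub> (x \<curlyvee>\<^bsub>A\<^esub> y) = x" "x \<curlyvee>\<^bsub>A\<^esub> (x \<curlywedge>\<^bsub>A\<^esub> y) = x"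
      using linear[OF C] ops[of x y] ops[of y x] ops[of x x] C by auto
    show "x \<curlywedge>\<^bsub>A\<^esub> y = x \<otimes> (x \<rightarrow> y)"
      using linear[OF C]
    proof
      assume "x \<preceq> y"
      thus ?thesis using ops[of x y] C by (simp add: hoop_le_def)
    next
      assume "y \<preceq> x"
      thus ?thesis using ops[of y x] C by (simp add: inf_eq)
    qed
    show "(x \<rightarrow> y) \<curlyvee>\<^bsub>A\<^esub> (y \<rightarrow> x) = \<one>"
      using linear[OF C] ops[of "x \<rightarrow> y" \<one>] ops[of "y \<rightarrow> x" \<one>] C by (auto simp: hoop_le_def)
    show "bl_le A x y \<or> bl_le A y x" using linear le C by blast
    fix u assume u: "u \<in> carrier A"
    show "bl_le A (u \<otimes> x) y \<longleftrightarrow> bl_le A u (x \<rightarrow> y)" using C u by (simp add: le residuated)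
    show "(x \<curlywedge>\<^bsub>A\<^esub> y) \<curlywedge>\<^bsub>A\<^esub> u = x \<curlywedge>\<^bsub>A\<^esub> (y \<curlywedge>\<^bsub>A\<^esub> u)"
      "(x \<curlyvee>\<^bsub>A\<^esub> y) \<curlyvee>\<^bsub>A\<^esub> u = x \<curlyvee>\<^bsub>A\<^esub> (y \<curlyvee>\<^bsub>A\<^esub> u)"
    proof -
      have tr: "a \<preceq> d" if "a \<preceq> c" "c \<preceq> d" "a \<in> {x, y, u}" "c \<in> {x, y, u}" "d \<in> {x, y, u}" for a c d
        using hle_trans[OF that(1,2)] that C u by auto
      consider "x \<preceq> y" "y \<preceq> u" "x \<preceq> u" | "x \<preceq> u" "u \<preceq> y" "x \<preceq> y" | "u \<preceq> x" "x \<preceq> y" "u \<preceq> y"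
        | "y \<preceq> x" "x \<preceq> u" "y \<preceq> u" | "y \<preceq> u" "u \<preceq> x" "y \<preceq> x" | "u \<preceq> y" "y \<preceq> x" "u \<preceq> x"
        using linear[of x y] linear[of x u] linear[of y u] C u tr by (metis insertCI)
      thus "(x \<curlywedge>\<^bsub>A\<^esub> y) \<curlywedge>\<^bsub>A\<^esub> u = x \<curlywedge>\<^bsub>A\<^esub> (y \<curlywedge>\<^bsub>A\<^esub> u)"
        "(x \<curlyvee>\<^bsub>A\<^esub> y) \<curlyvee>\<^bsub>A\<^esub> u = x \<curlyvee>\<^bsub>A\<^esub> (y \<curlyvee>\<^bsub>A\<^esub> u)"
        using C u by (cases; simp add: ops)+
    qed
  next
    fix x assume "x \<in> carrier A"
    thus "bl_le A \<zero>\<^bsub>A\<^esub> x" "bl_le A x \<one>" using le z by simp_all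
  qed (use z in simp_all)
qed

section \<open>Disconnected rotations\<close>

lemma disconnected_rotation_simps:
  "carrier (disconnected_rotation A) = Orig ` carrier A \<union> Copy ` carrier A"
  "monoid.mult (disconnected_rotation A) = rot_mult A"
  "impl (disconnected_rotation A) = rot_impl A"
  "one (disconnected_rotation A) = Orig (one A)"
  "zero (disconnected_rotation A) = Copy (one A)"
  "inf_op (disconnected_rotation A) = glb_in (carrier (disconnected_rotation A)) (rot_le A)"
  "sup_op (disconnected_rotation A) = lub_in (carrier (disconnected_rotation A)) (rot_le A)"
  by (simp_all add: disconnected_rotation_def Let_def)

lemma rot_le_eq: "rot_le A = hoop_le (disconnected_rotation A)"
proof (intro ext)
  fix x y show "rot_le A x y = hoop_le (disconnected_rotation A) x y"
    by (cases x; cases y) (simp_all add: hoop_le_def disconnected_rotation_simps)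
qed

text \<open>Most instances of the hoop identities reduce to identities of \<open>A\<close> by moving between \<^const>\<open>Orig\<close> and
  \<^const>\<open>Copy\<close>. Cancellation is used for divisibility: for arguments of different kinds it is
  \<open>a \<rightarrow> (a \<otimes> b) = b\<close>, for two copies it is \<open>(a \<rightarrow> b) \<rightarrow> b = (b \<rightarrow> a) \<rightarrow> a\<close>. Powers of originals remain
  originals, while the product of two copies is the bottom element.\<close>

lemma rotation_perfect_MV_chain:
  assumes "hoop_chain A" "cancellative_hoop A"
  shows "perfect_MV_chain (disconnected_rotation A)"
proof -
  interpret hoop_chain A by fact
  interpret cancellative_hoop A by fact
  let ?R = "disconnected_rotation A"
  note R = disconnected_rotation_simps[of A]
  have cancel_left: "x \<rightarrow>\<^bsub>A\<^esub> (x \<otimes>\<^bsub>A\<^esub> y) = y" if "x \<in> carrier A" "y \<in> carrier A" for x y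
    using cancel[of y x] that by (simp add: m_comm)
  have waj: "(a \<rightarrow>\<^bsub>A\<^esub> b) \<rightarrow>\<^bsub>A\<^esub> b = a" if "b \<preceq> a" "a \<in> carrier A" "b \<in> carrier A" for a b
    using cancel[of a "a \<rightarrow>\<^bsub>A\<^esub> b"] inf_eq[OF that] that by simp
  have wajsberg: "(a \<rightarrow>\<^bsub>A\<^esub> b) \<rightarrow>\<^bsub>A\<^esub> b = (b \<rightarrow>\<^bsub>A\<^esub> a) \<rightarrow>\<^bsub>A\<^esub> a" if C: "a \<in> carrier A" "b \<in> carrier A" for a b
    using linear[OF C] waj[of a b] waj[of b a] C by (auto simp: hoop_le_def)
  have "comm_monoid ?R"
  proof (rule comm_monoidI)
    fix x y z assume C: "x \<in> carrier ?R" "y \<in> carrier ?R" "z \<in> carrier ?R"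
    show "x \<otimes>\<^bsub>?R\<^esub> y \<otimes>\<^bsub>?R\<^esub> z = x \<otimes>\<^bsub>?R\<^esub> (y \<otimes>\<^bsub>?R\<^esub> z)"
      using C by (cases x; cases y; cases z) (auto simp: R impl_curry m_assoc m_comm m_lcomm)
  next
    fix x y assume C: "x \<in> carrier ?R" "y \<in> carrier ?R"
    show "x \<otimes>\<^bsub>?R\<^esub> y = y \<otimes>\<^bsub>?R\<^esub> x"
      using C by (cases x; cases y) (auto simp: R m_comm)
  qed (auto simp: R)
  moreover have "hoop_axioms ?R"
  proof
    fix x y z assume C: "x \<in> carrier ?R" "y \<in> carrier ?R" "z \<in> carrier ?R"
    show "x \<rightarrow>\<^bsub>?R\<^esub> (y \<rightarrow>\<^bsub>?R\<^esub> z) = (x \<otimes>\<^bsub>?R\<^esub> y) \<rightarrow>\<^bsub>?R\<^esub> z"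
      using C by (cases x; cases y; cases z) (auto simp: R impl_curry m_assoc m_comm m_lcomm)
  next
    fix x y assume C: "x \<in> carrier ?R" "y \<in> carrier ?R"
    show "x \<otimes>\<^bsub>?R\<^esub> (x \<rightarrow>\<^bsub>?R\<^esub> y) = y \<otimes>\<^bsub>?R\<^esub> (y \<rightarrow>\<^bsub>?R\<^esub> x)"
      using C by (cases x; cases y) (auto simp: R cancel_left divisibility wajsberg)
  qed (auto simp: R impl_refl)
  moreover have lin: "hoop_le ?R x y \<or> hoop_le ?R y x" if C: "x \<in> carrier ?R" "y \<in> carrier ?R" for x y
    using C linear unfolding rot_le_eq[symmetric] by (cases x; cases y) (auto simp: R)
  ultimately have hc: "hoop_chain ?R"
    by (intro hoop_chain.intro hoop.intro hoop_chain_axioms.intro)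
  have "BL_chain ?R"
    by (rule BL_chain_of_hoop_chain[OF hc]) (auto simp: R rot_le_eq hoop_le_def)
  then interpret R: BL_chain ?R .
  have neg: "bl_neg ?R (Orig a) = Copy a" "bl_neg ?R (Copy a) = Orig a" if "a \<in> carrier A" for a
    using that by (simp_all add: bl_neg_def R)
  have pow: "Orig a [^]\<^bsub>?R\<^esub> n = Orig (a [^]\<^bsub>A\<^esub> n)" for a and n :: nat
    by (induction n) (simp_all add: R)
  have ordO: "bl_ord ?R (Orig a) = \<infinity>" for a
    by (simp add: bl_ord_def pow R)
  have ordC: "bl_ord ?R (Copy a) < \<infinity>" if "a \<in> carrier A" for a
  proof -
    have "Copy a [^]\<^bsub>?R\<^esub> (2::nat) = \<zero>\<^bsub>?R\<^esub>" using that by (simp add: numeral_2_eq_2 R)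
    hence "\<exists>n::nat>0. Copy a [^]\<^bsub>?R\<^esub> n = \<zero>\<^bsub>?R\<^esub>" by (intro exI[of _ 2]) simp
    thus ?thesis by (simp add: bl_ord_def)
  qed
  show ?thesis
  proof unfold_locales
    fix x assume "x \<in> carrier ?R"
    then consider a where "a \<in> carrier A" "x = Orig a" | a where "a \<in> carrier A" "x = Copy a"
      by (auto simp: R)
    thus "x = bl_neg ?R (bl_neg ?R x)" "bl_ord ?R x < \<infinity> \<longleftrightarrow> bl_ord ?R (bl_neg ?R x) = \<infinity>"
      by (cases; use ordO ordC in \<open>auto simp: neg\<close>)+
  qed
qed

lemma standard_cancellative_hoop_simps:
  "carrier standard_cancellative_hoop = {0<..1}"
  "monoid.mult standard_cancellative_hoop = (\<lambda>x y. x * y)"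
  "one standard_cancellative_hoop = 1"
  "impl standard_cancellative_hoop = (\<lambda>x y. min 1 (y / x))"
  by (simp_all add: standard_cancellative_hoop_def)

lemma standard_hoop_chain: "hoop_chain standard_cancellative_hoop"
proof -
  let ?H = standard_cancellative_hoop
  note H = standard_cancellative_hoop_simps
  have "comm_monoid ?H"
    by (rule comm_monoidI) (auto simp: H mult_le_one)
  moreover have "hoop_axioms ?H"
  proof
    fix x y z assume C: "x \<in> carrier ?H" "y \<in> carrier ?H" "z \<in> carrier ?H"
    have "min 1 (min 1 (z / y) / x) = min 1 (z / (x * y))"
    proof (cases "z / y \<le> 1")
      case True thus ?thesis using C by (simp add: H mult.commute)
    next
      case False
      hence "1 \<le> z / y" by simp
      also have "\<dots> \<le> (z / y) / x" using C by (simp add: H field_simps mult_left_le)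
      finally have "1 \<le> z / (x * y)" by (simp add: mult.commute)
      moreover have "1 \<le> 1 / x" using C by (simp add: H)
      ultimately show ?thesis using False by (simp add: min_def)
    qed
    thus "x \<rightarrow>\<^bsub>?H\<^esub> (y \<rightarrow>\<^bsub>?H\<^esub> z) = (x \<otimes>\<^bsub>?H\<^esub> y) \<rightarrow>\<^bsub>?H\<^esub> z" by (simp add: H)
  next
    fix x y assume C: "x \<in> carrier ?H" "y \<in> carrier ?H"
    show "x \<otimes>\<^bsub>?H\<^esub> (x \<rightarrow>\<^bsub>?H\<^esub> y) = y \<otimes>\<^bsub>?H\<^esub> (y \<rightarrow>\<^bsub>?H\<^esub> x)"
      using C by (auto simp: H min_def field_simps)
  qed (auto simp: H)
  moreover have "hoop_le ?H x y \<or> hoop_le ?H y x" if "x \<in> carrier ?H" "y \<in> carrier ?H" for x y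
    using that by (auto simp: H hoop_le_def min_def field_simps)
  ultimately show ?thesis
    by (intro hoop_chain.intro hoop.intro hoop_chain_axioms.intro)
qed

lemma standard_cancellative: "cancellative_hoop standard_cancellative_hoop"
proof -
  interpret hoop_chain standard_cancellative_hoop by (rule standard_hoop_chain)
  show ?thesis by unfold_locales (auto simp: standard_cancellative_hoop_simps)
qed

lemma chang_V_perfect: "perfect_MV_chain chang_V"
  unfolding chang_V_def
  by (rule rotation_perfect_MV_chain[OF standard_hoop_chain standard_cancellative])

section \<open>The Chang identity in perfect MV-chains\<close>

sublocale BL_chain \<subseteq> hoop_chain
  by unfold_locales (use total ble_hle in blast)

lemma (in hoop) pow_mono: "\<lbrakk>x \<preceq> y; x \<in> carrier A; y \<in> carrier A\<rbrakk> \<Longrightarrow> x [^] (n::nat) \<preceq> y [^] n"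
  by (induction n) (simp_all add: mult_mono)

context perfect_MV_chain
begin

definition nilpotent :: "'a \<Rightarrow> bool" where
  "nilpotent x \<longleftrightarrow> (\<exists>n::nat>0. x [^] n = \<zero>)"

lemma nilpotent_neg: "x \<in> carrier A \<Longrightarrow> nilpotent (x \<rightarrow> \<zero>) \<longleftrightarrow> \<not> nilpotent x"
proof -
  assume x: "x \<in> carrier A"
  have o: "bl_ord A y < \<infinity> \<longleftrightarrow> nilpotent y" "bl_ord A y = \<infinity> \<longleftrightarrow> \<not> nilpotent y" for y
    by (auto simp: bl_ord_def nilpotent_def)
  from perfect[OF x] show ?thesis unfolding o bl_neg_def by simp
qed

lemma hle_zero: "x \<in> carrier A \<Longrightarrow> x \<preceq> \<zero> \<longleftrightarrow> x = \<zero>"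
  using hle_antisym[of x \<zero>] zero_hle zero_closed by auto

lemma zero_neq_one: "\<zero> \<noteq> \<one>"
proof
  assume "\<zero> = \<one>"
  hence "\<one> [^] (1::nat) = \<zero>" "(\<one> \<rightarrow> \<zero>) [^] (1::nat) = \<zero>" using zero_closed by simp_all
  hence "nilpotent \<one>" "nilpotent (\<one> \<rightarrow> \<zero>)" unfolding nilpotent_def using zero_less_one by blast+
  thus False using nilpotent_neg[of \<one>] by simp
qed

lemma nilpotent_antimono:
  assumes "x \<preceq> y" "x \<in> carrier A" "y \<in> carrier A" "nilpotent y"
  shows "nilpotent x"
proof -
  obtain n :: nat where n: "n > 0" "y [^] n = \<zero>" using assms(4) by (auto simp: nilpotent_def)
  have "x [^] n \<preceq> \<zero>" using pow_mono[OF assms(1-3), of n] n by simp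
  hence "x [^] n = \<zero>" using assms hle_zero by simp
  thus ?thesis using n by (auto simp: nilpotent_def)
qed

text \<open>An element above its negation is not nilpotent, for otherwise its negation would be nilpotent too,
  which perfectness excludes. Then
  \<open>x \<otimes> x\<close> is not nilpotent either, its negation is nilpotent, and so \<open>x \<otimes> x\<close> cannot lie below its negation.\<close>

lemma square_radical:
  assumes x: "x \<in> carrier A" "x \<rightarrow> \<zero> \<preceq> x"
  shows "(x \<otimes> x) \<rightarrow> \<zero> \<preceq> x \<otimes> x"
proof (rule ccontr)
  have z: "\<zero> \<in> carrier A" by (rule zero_closed)
  assume "\<not> ?thesis"
  hence le: "x \<otimes> x \<preceq> (x \<otimes> x) \<rightarrow> \<zero>" using not_hle x z by simp
  have inf: "\<not> nilpotent x"
    using nilpotent_antimono[of "x \<rightarrow> \<zero>" x] nilpotent_neg[of x] x z by auto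
  have "\<not> nilpotent (x \<otimes> x)"
  proof
    assume "nilpotent (x \<otimes> x)"
    then obtain n :: nat where n: "n > 0" "(x \<otimes> x) [^] n = \<zero>" by (auto simp: nilpotent_def)
    have "x [^] (n + n) = \<zero>" using n x by (simp add: nat_pow_mult[symmetric] nat_pow_distrib)
    thus False using inf n unfolding nilpotent_def by (metis add_pos_pos)
  qed
  thus False using nilpotent_antimono[OF le] nilpotent_neg[of "x \<otimes> x"] x z by simp
qed

lemma dbl_radical:
  assumes x: "x \<in> carrier A" "x \<rightarrow> \<zero> \<preceq> x" shows "dbl A x = \<one>"
proof -
  have z: "\<zero> \<in> carrier A" by (rule zero_closed)
  have "x \<in> component \<zero>"
  proof (cases "x \<in> above \<zero>")
    case True
    hence "x = \<zero> \<rightarrow> \<zero>" using involutive[OF x(1)] by (simp add: above_def bl_neg_def)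
    thus ?thesis using z by (simp add: impl_refl)
  next
    case False
    thus ?thesis using above_eqI[OF z x(1) zero_hle[OF x(1)]] x(1) by (intro componentI) auto
  qed
  thus ?thesis using dbl_eq_one[OF z zero_neq_one _ x(2)] x by (simp add: zero_hle)
qed

text \<open>If \<open>x\<close> lies above its negation, so does its square and both sides are \<open>\<one>\<close>. Otherwise \<open>x \<otimes> x = \<zero>\<close> and \<open>2x\<close> is
  the negation of \<open>y \<otimes> y\<close>, where \<open>y\<close> is the negation of \<open>x\<close>; by \<open>square_radical\<close> it lies below \<open>y \<otimes> y\<close>, so
  its square is \<open>\<zero>\<close>.\<close>

lemma chang_identity:
  assumes x: "x \<in> carrier A"
  shows "dbl A x \<otimes> dbl A x = dbl A (x \<otimes> x)"
proof -
  have z [simp]: "\<zero> \<in> carrier A" by (rule zero_closed)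
  show ?thesis
  proof (cases "x \<rightarrow> \<zero> \<preceq> x")
    case True
    thus ?thesis using dbl_radical square_radical x by simp
  next
    case False
    hence le: "x \<preceq> x \<rightarrow> \<zero>" using not_hle x by simp
    hence xx: "x \<otimes> x = \<zero>" using hle_zero[of "x \<otimes> x"] residuated[of x x \<zero>] x by simp
    define y where "y = x \<rightarrow> \<zero>"
    have y: "y \<in> carrier A" "y \<rightarrow> \<zero> = x"
      using involutive[OF x] x by (simp_all add: y_def bl_neg_def)
    have "y \<rightarrow> \<zero> \<preceq> y" using le y by (simp add: y_def)
    hence sq: "(y \<otimes> y) \<rightarrow> \<zero> \<preceq> y \<otimes> y" using square_radical y by simp
    have d: "dbl A x = (y \<otimes> y) \<rightarrow> \<zero>"
      using impl_curry[of y y \<zero>] y by (simp add: dbl_def xx flip: y_def)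
    have "dbl A x \<otimes> dbl A x \<preceq> ((y \<otimes> y) \<rightarrow> \<zero>) \<otimes> (y \<otimes> y)"
      unfolding d using sq y by (intro mult_mono_right) simp_all
    moreover have "((y \<otimes> y) \<rightarrow> \<zero>) \<otimes> (y \<otimes> y) \<preceq> \<zero>" using y by (simp add: residuated)
    ultimately have "dbl A x \<otimes> dbl A x \<preceq> \<zero>"
      using hle_trans[of _ "((y \<otimes> y) \<rightarrow> \<zero>) \<otimes> (y \<otimes> y)" \<zero>] y d by simp
    hence "dbl A x \<otimes> dbl A x = \<zero>" using hle_zero y d by simp
    moreover have "dbl A (x \<otimes> x) = \<zero>"
      using hle_zero[of "\<zero> \<otimes> \<zero>"] mult_le_left[of \<zero> \<zero>] by (simp add: xx dbl_def impl_refl)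
    ultimately show ?thesis by simp
  qed
qed

end

sublocale perfect_MV_chain \<subseteq> chang_chain
  by unfold_locales (rule chang_identity)

section \<open>Ordinal sums\<close>

lemma ordinal_sum_simps:
  "carrier (ordinal_sum I r A) = (\<Union>i\<in>I. os_emb A i ` carrier (A i))"
  "monoid.mult (ordinal_sum I r A) = os_mult r A"
  "impl (ordinal_sum I r A) = os_impl r A"
  "one (ordinal_sum I r A) = None"
  "zero (ordinal_sum I r A) = os_bottom I r A"
  "inf_op (ordinal_sum I r A) = glb_in (carrier (ordinal_sum I r A)) (hoop_le (ordinal_sum I r A))"
  "sup_op (ordinal_sum I r A) = lub_in (carrier (ordinal_sum I r A)) (hoop_le (ordinal_sum I r A))"
proof -
  have "hoop_le (ordinal_sum I r A) = (\<lambda>x y. os_impl r A x y = None)"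
    by (intro ext) (simp add: hoop_le_def ordinal_sum_def Let_def)
  thus "inf_op (ordinal_sum I r A) = glb_in (carrier (ordinal_sum I r A)) (hoop_le (ordinal_sum I r A))"
    "sup_op (ordinal_sum I r A) = lub_in (carrier (ordinal_sum I r A)) (hoop_le (ordinal_sum I r A))"
    by (simp_all add: ordinal_sum_def Let_def)
qed (simp_all add: ordinal_sum_def Let_def)

lemma os_mult_None [simp]: "os_mult r A x None = x"
  by (cases x) simp_all

lemma os_impl_None [simp]: "os_impl r A x None = None"
  by (cases x) simp_all

lemma (in hoop) mult_eq_one:
  assumes "x \<in> carrier A" "y \<in> carrier A" "x \<otimes> y = \<one>" shows "x = \<one>"
  using mult_le_left[of x y] assms by (simp add: one_hle)

locale ordinal_sum_family =
  fixes I :: "'i set" and r :: "('i \<times> 'i) set" and A :: "'i \<Rightarrow> ('a, 'm) hoop_scheme"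
  assumes order: "linear_order_on I r" and nonempty: "I \<noteq> {}"
    and components: "i \<in> I \<Longrightarrow> hoop_chain (A i)"
begin

abbreviation "S \<equiv> ordinal_sum I r A"

lemma r_total: "i \<in> I \<Longrightarrow> j \<in> I \<Longrightarrow> i \<noteq> j \<Longrightarrow> (i, j) \<notin> r \<Longrightarrow> (j, i) \<in> r"
  using order by (auto simp: linear_order_on_def total_on_def)

lemma r_antisym: "(i, j) \<in> r \<Longrightarrow> (j, i) \<in> r \<Longrightarrow> i = j"
  using order by (auto simp: linear_order_on_def partial_order_on_def antisym_def)

lemma r_trans: "(i, j) \<in> r \<Longrightarrow> (j, k) \<in> r \<Longrightarrow> (i, k) \<in> r"
  using order by (auto simp: linear_order_on_def partial_order_on_def preorder_on_def trans_def)

lemma comp_hoop: "i \<in> I \<Longrightarrow> hoop (A i)"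
  using components by (simp add: hoop_chain_def)

lemmas comp_monoid = hoop.axioms(1)[OF comp_hoop]
lemmas comp_closed [simp] =
  monoid.m_closed[OF comm_monoid.axioms(1)[OF comp_monoid]] hoop.impl_closed[OF comp_hoop]
  monoid.one_closed[OF comm_monoid.axioms(1)[OF comp_monoid]]
lemmas comp_simps [simp] =
  monoid.l_one[OF comm_monoid.axioms(1)[OF comp_monoid]]
  monoid.r_one[OF comm_monoid.axioms(1)[OF comp_monoid]]
  hoop.one_impl[OF comp_hoop] hoop.impl_one[OF comp_hoop] hoop.impl_refl[OF comp_hoop]

lemma emb_closed: "i \<in> I \<Longrightarrow> x \<in> carrier (A i) \<Longrightarrow> os_emb A i x \<in> carrier S"
  by (auto simp: ordinal_sum_simps)

lemma None_closed: "None \<in> carrier S"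
proof -
  obtain i where "i \<in> I" using nonempty by blast
  thus ?thesis using emb_closed[of i "\<one>\<^bsub>A i\<^esub>"] by (simp add: os_emb_def)
qed

lemma Some_closed: "Some (i, x) \<in> carrier S \<longleftrightarrow> i \<in> I \<and> x \<in> carrier (A i) \<and> x \<noteq> \<one>\<^bsub>A i\<^esub>"
  by (auto simp: ordinal_sum_simps os_emb_def split: if_splits)

lemma carrier_cases [consumes 1, case_names None Some]:
  assumes "X \<in> carrier S"
  obtains "X = None" | i x where "X = Some (i, x)" "i \<in> I" "x \<in> carrier (A i)" "x \<noteq> \<one>\<^bsub>A i\<^esub>"
  using assms by (cases X) (auto simp: Some_closed)

lemma emb_mult: "i \<in> I \<Longrightarrow> x \<in> carrier (A i) \<Longrightarrow> y \<in> carrier (A i) \<Longrightarrow>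
    os_mult r A (os_emb A i x) (os_emb A i y) = os_emb A i (x \<otimes>\<^bsub>A i\<^esub> y)"
  by (auto simp: os_emb_def)

lemma emb_impl: "i \<in> I \<Longrightarrow> x \<in> carrier (A i) \<Longrightarrow> y \<in> carrier (A i) \<Longrightarrow>
    os_impl r A (os_emb A i x) (os_emb A i y) = os_emb A i (x \<rightarrow>\<^bsub>A i\<^esub> y)"
  by (auto simp: os_emb_def)

lemma mult_Some:
  assumes "i \<in> I" "x \<in> carrier (A i)" "y \<in> carrier (A i)" "x \<noteq> \<one>\<^bsub>A i\<^esub>"
  shows "os_emb A i (x \<otimes>\<^bsub>A i\<^esub> y) = Some (i, x \<otimes>\<^bsub>A i\<^esub> y)"
  using hoop.mult_eq_one[OF comp_hoop, of i x y] assms by (auto simp: os_emb_def)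

lemma mult_closed:
  assumes "X \<in> carrier S" "Y \<in> carrier S" shows "os_mult r A X Y \<in> carrier S"
  using assms(1)
proof (cases rule: carrier_cases)
  case None thus ?thesis using assms by simp
next
  case X: (Some i x)
  show ?thesis using assms(2)
  proof (cases rule: carrier_cases)
    case None thus ?thesis using assms by simp
  next
    case Y: (Some j y)
    thus ?thesis using X Y emb_closed[of i "x \<otimes>\<^bsub>A i\<^esub> y"] assms by auto
  qed
qed

lemma impl_closed:
  assumes "X \<in> carrier S" "Y \<in> carrier S" shows "os_impl r A X Y \<in> carrier S"
  using assms(1)
proof (cases rule: carrier_cases)
  case None thus ?thesis using assms by simp
next
  case X: (Some i x)
  show ?thesis using assms(2)
  proof (cases rule: carrier_cases)
    case None thus ?thesis using assms by simp
  next
    case Y: (Some j y)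
    thus ?thesis using X Y emb_closed[of i "x \<rightarrow>\<^bsub>A i\<^esub> y"] assms None_closed by auto
  qed
qed

lemma mult_comm:
  assumes "X \<in> carrier S" "Y \<in> carrier S" shows "os_mult r A X Y = os_mult r A Y X"
  using assms(1)
proof (cases rule: carrier_cases)
  case None thus ?thesis by simp
next
  case X: (Some i x)
  show ?thesis using assms(2)
  proof (cases rule: carrier_cases)
    case None thus ?thesis by simp
  next
    case Y: (Some j y)
    thus ?thesis using X comm_monoid.m_comm[OF comp_monoid, of i x y] r_total[of i j] r_antisym[of i j]
      by auto
  qed
qed

lemma divisible:
  assumes "X \<in> carrier S" "Y \<in> carrier S"
  shows "os_mult r A X (os_impl r A X Y) = os_mult r A Y (os_impl r A Y X)"
  using assms(1)
proof (cases rule: carrier_cases)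
  case None thus ?thesis by simp
next
  case X: (Some i x)
  show ?thesis using assms(2)
  proof (cases rule: carrier_cases)
    case None thus ?thesis using X by simp
  next
    case Y: (Some j y)
    show ?thesis
    proof (cases "i = j")
      case True
      hence XY: "X = os_emb A i x" "Y = os_emb A i y" "i \<in> I" "x \<in> carrier (A i)" "y \<in> carrier (A i)"
        using X Y by (simp_all add: os_emb_def)
      thus ?thesis using hoop.divisibility[OF comp_hoop, of i x y] by (simp add: emb_mult emb_impl)
    next
      case False
      thus ?thesis using X Y r_total[of i j] r_antisym[of i j] by auto
    qed
  qed
qed

lemma total:
  assumes "X \<in> carrier S" "Y \<in> carrier S"
  shows "os_impl r A X Y = None \<or> os_impl r A Y X = None"
  using assms(1)
proof (cases rule: carrier_cases)
  case None thus ?thesis by simp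
next
  case X: (Some i x)
  show ?thesis using assms(2)
  proof (cases rule: carrier_cases)
    case None thus ?thesis using X by simp
  next
    case Y: (Some j y)
    thus ?thesis using X hoop_chain.linear[OF components, of i x y] r_total[of i j]
      by (auto simp: hoop_le_def os_emb_def)
  qed
qed

lemma impl_self:
  assumes "X \<in> carrier S" shows "os_impl r A X X = None"
  using assms by (cases rule: carrier_cases) (simp_all add: os_emb_def)

lemma mult_assoc:
  assumes "X \<in> carrier S" "Y \<in> carrier S" "Z \<in> carrier S"
  shows "os_mult r A (os_mult r A X Y) Z = os_mult r A X (os_mult r A Y Z)"
proof (cases "X = None \<or> Y = None \<or> Z = None")
  case True thus ?thesis by auto
next
  case False
  then obtain i x j y k z where XYZ: "X = Some (i, x)" "Y = Some (j, y)" "Z = Some (k, z)"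
    by (metis not_None_eq surj_pair)
  hence C: "i \<in> I" "x \<in> carrier (A i)" "x \<noteq> \<one>\<^bsub>A i\<^esub>" "j \<in> I" "y \<in> carrier (A j)" "y \<noteq> \<one>\<^bsub>A j\<^esub>"
      "k \<in> I" "z \<in> carrier (A k)" "z \<noteq> \<one>\<^bsub>A k\<^esub>"
    using assms by (simp_all add: Some_closed)
  consider "i = j" "j = k" | "i = j" "j \<noteq> k" | "i \<noteq> j" "j = k" | "i \<noteq> j" "i = k" | "i \<noteq> j" "j \<noteq> k" "i \<noteq> k"
    by blast
  thus ?thesis
  proof cases
    case 1
    thus ?thesis using XYZ C monoid.m_assoc[OF comm_monoid.axioms(1)[OF comp_monoid], of i x y z]
      by (simp add: mult_Some)
  next
    case 2
    thus ?thesis using XYZ C by (auto simp: mult_Some)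
  next
    case 3
    thus ?thesis using XYZ C by (auto simp: mult_Some)
  next
    case 4
    thus ?thesis using XYZ C r_antisym[of i j] r_total[of i j] by (auto simp: mult_Some)
  next
    case 5
    thus ?thesis using XYZ C r_total[of i j] r_total[of j k] r_total[of i k]
        r_antisym[of i j] r_antisym[of j k] r_antisym[of i k] r_trans[of i j k] r_trans[of k j i]
      by auto
  qed
qed

lemma residuation:
  assumes "X \<in> carrier S" "Y \<in> carrier S" "Z \<in> carrier S"
  shows "os_impl r A X (os_impl r A Y Z) = os_impl r A (os_mult r A X Y) Z"
proof (cases "X = None \<or> Y = None \<or> Z = None")
  case True thus ?thesis by auto
next
  case False
  then obtain i x j y k z where XYZ: "X = Some (i, x)" "Y = Some (j, y)" "Z = Some (k, z)"
    by (metis not_None_eq surj_pair)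
  hence C: "i \<in> I" "x \<in> carrier (A i)" "x \<noteq> \<one>\<^bsub>A i\<^esub>" "j \<in> I" "y \<in> carrier (A j)" "y \<noteq> \<one>\<^bsub>A j\<^esub>"
      "k \<in> I" "z \<in> carrier (A k)" "z \<noteq> \<one>\<^bsub>A k\<^esub>"
    using assms by (simp_all add: Some_closed)
  consider "i = j" "j = k" | "i = j" "j \<noteq> k" | "i \<noteq> j" "j = k" | "i \<noteq> j" "i = k" | "i \<noteq> j" "j \<noteq> k" "i \<noteq> k"
    by blast
  thus ?thesis
  proof cases
    case 1
    hence "X = os_emb A i x" "Y = os_emb A i y" "Z = os_emb A i z" using XYZ C by (simp_all add: os_emb_def)
    thus ?thesis using 1 C hoop.impl_curry[OF comp_hoop, of i x y z]
      by (simp add: emb_mult emb_impl)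
  next
    case 2
    thus ?thesis using XYZ C by (auto simp: mult_Some)
  next
    case 3
    thus ?thesis using XYZ C by (auto simp: mult_Some os_emb_def)
  next
    case 4
    thus ?thesis using XYZ C r_antisym[of i j] r_total[of i j] by auto
  next
    case 5
    thus ?thesis using XYZ r_total[of j k] C r_trans[of i j k] r_trans[of i k j] by auto
  qed
qed

lemma hoop_chain_sum: "hoop_chain S"
proof -
  have "comm_monoid S"
    by (rule comm_monoidI, unfold ordinal_sum_simps(2,4))
      (auto intro: mult_closed None_closed mult_assoc mult_comm)
  moreover have "hoop_axioms S"
    by (rule hoop_axioms.intro)
      (simp_all add: ordinal_sum_simps(2-4) impl_closed impl_self residuation divisible)
  ultimately show ?thesis
    by (intro hoop_chain.intro hoop.intro hoop_chain_axioms.intro)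
      (simp_all add: hoop_le_def ordinal_sum_simps(2-4) total)
qed

text \<open>\<^const>\<open>dbl\<close> is computed inside the component of its argument.\<close>

lemma chang_chain_sum:
  assumes "\<And>i. i \<in> I \<Longrightarrow> chang_chain (A i)" shows "chang_chain S"
proof (intro chang_chain.intro chang_chain_axioms.intro hoop_chain_sum)
  fix X assume "X \<in> carrier S"
  then obtain i x where i: "i \<in> I" "x \<in> carrier (A i)" "X = os_emb A i x"
    by (auto simp: ordinal_sum_simps)
  have dbl: "dbl S (os_emb A i y) = os_emb A i (dbl (A i) y)" if "y \<in> carrier (A i)" for y
    using that i(1) by (simp add: dbl_def ordinal_sum_simps(2,3) emb_mult emb_impl)
  have "dbl (A i) x \<in> carrier (A i)" using i by (simp add: dbl_def)
  thus "dbl S X \<otimes>\<^bsub>S\<^esub> dbl S X = dbl S (X \<otimes>\<^bsub>S\<^esub> X)"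
    using chang_chain.chang[OF assms, of i x] i
    by (simp add: dbl ordinal_sum_simps(2) emb_mult)
qed

text \<open>If the least element of the first component were its unit, it would be identified with the common top
  and the sum would lack a least element; hence the condition \<open>m \<noteq> \<one>\<close>.\<close>

lemma sum_bottom:
  assumes i0: "i0 \<in> I" "\<And>i. i \<in> I \<Longrightarrow> (i0, i) \<in> r"
    and m: "m \<in> carrier (A i0)" "\<And>x. x \<in> carrier (A i0) \<Longrightarrow> hoop_le (A i0) m x" "m \<noteq> \<one>\<^bsub>A i0\<^esub>"
  shows "\<zero>\<^bsub>S\<^esub> = Some (i0, m)" and "BL_chain S"
proof -
  interpret A0: hoop_chain "A i0" using components i0(1) .
  have "(THE i. i \<in> I \<and> (\<forall>j\<in>I. (i, j) \<in> r)) = i0"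
    using i0 r_antisym by (intro the_equality) auto
  moreover have "(THE m. m \<in> carrier (A i0) \<and> (\<forall>x\<in>carrier (A i0). hoop_le (A i0) m x)) = m"
    using m A0.hle_antisym by (intro the_equality) auto
  ultimately show zero: "\<zero>\<^bsub>S\<^esub> = Some (i0, m)"
    using m(3) by (simp add: ordinal_sum_simps(5) os_bottom_def os_emb_def)
  have least: "hoop_le S (Some (i0, m)) X" if "X \<in> carrier S" for X
    using that
  proof (cases rule: carrier_cases)
    case None thus ?thesis by (simp add: hoop_le_def ordinal_sum_simps(3,4))
  next
    case (Some i x)
    thus ?thesis using i0 m(2)[of x] by (auto simp: hoop_le_def ordinal_sum_simps(3,4) os_emb_def)
  qed
  show "BL_chain S"
    by (rule BL_chain_of_hoop_chain[OF hoop_chain_sum])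
      (use i0 m least in \<open>simp_all add: zero Some_closed ordinal_sum_simps(6,7)\<close>)
qed

end

lemma ordinal_sum_of_perfect:
  fixes S :: "('i \<times> 'a) option bl"
  assumes "S \<in> ordinal_sums_of_perfect_MV_chains"
  shows "BL_chain S" "chang_chain S"
proof -
  obtain I r i0 and A :: "'i \<Rightarrow> 'a bl" where S: "S = ordinal_sum I r A"
    and r: "linear_order_on I r" and i0: "i0 \<in> I" "\<And>i. i \<in> I \<Longrightarrow> (i0, i) \<in> r"
    and A: "\<And>i. i \<in> I \<Longrightarrow> perfect_MV_chain (A i)"
    using assms unfolding ordinal_sums_of_perfect_MV_chains_def by blast
  have ch: "chang_chain (A i)" if "i \<in> I" for i
  proof -
    interpret perfect_MV_chain "A i" using A that .
    show ?thesis by (rule chang_chain_axioms)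
  qed
  interpret ordinal_sum_family I r A
    by (rule ordinal_sum_family.intro) (use r i0 ch in \<open>auto simp: chang_chain_def\<close>)
  interpret A0: perfect_MV_chain "A i0" using A i0(1) .
  show "BL_chain S" unfolding S
    using sum_bottom(2)[OF i0 A0.zero_closed A0.zero_hle A0.zero_neq_one] .
  show "chang_chain S" unfolding S using chang_chain_sum[OF ch] .
qed

lemma omegaV_family: "ordinal_sum_family (UNIV :: nat set) {(m, n). m \<le> n} (\<lambda>_. chang_V)"
proof -
  interpret perfect_MV_chain chang_V by (rule chang_V_perfect)
  show ?thesis
    by (rule ordinal_sum_family.intro)
      (auto simp: hoop_chain_axioms linear_order_on_def partial_order_on_def preorder_on_def total_on_def
        refl_on_def intro: transI antisymI)
qed

lemma omegaV_in_sums: "omegaV \<in> ordinal_sums_of_perfect_MV_chains"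
proof -
  interpret ordinal_sum_family "UNIV :: nat set" "{(m, n). m \<le> n}" "\<lambda>_. chang_V"
    by (rule omegaV_family)
  show ?thesis unfolding ordinal_sums_of_perfect_MV_chains_def omegaV_def
    using order chang_V_perfect by blast
qed

lemma omegaV_zero: "\<zero>\<^bsub>omegaV\<^esub> = Some (0, Copy 1)"
proof -
  interpret V: perfect_MV_chain chang_V by (rule chang_V_perfect)
  interpret ordinal_sum_family "UNIV :: nat set" "{(m, n). m \<le> n}" "\<lambda>_. chang_V"
    by (rule omegaV_family)
  have "\<zero>\<^bsub>chang_V\<^esub> = Copy 1"
    by (simp add: chang_V_def disconnected_rotation_simps standard_cancellative_hoop_simps)
  thus ?thesis unfolding omegaV_def
    using sum_bottom(1)[of 0 "\<zero>\<^bsub>chang_V\<^esub>"] V.zero_closed V.zero_hle V.zero_neq_one by simp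
qed

section \<open>Derivations and linear theories\<close>

text \<open>Iterated implications \<open>\<alpha> \<rightarrow> (\<dots> \<rightarrow> (\<alpha> \<rightarrow> \<phi>))\<close> are provably equivalent to \<open>\<alpha>\<^sup>n \<rightarrow> \<phi>\<close>.\<close>

primrec imps :: "nat \<Rightarrow> fm \<Rightarrow> fm \<Rightarrow> fm" where
  "imps 0 \<alpha> \<phi> = \<phi>"
| "imps (Suc n) \<alpha> \<phi> = \<alpha> \<^bold>\<rightarrow> imps n \<alpha> \<phi>"

lemma imps_add: "imps (n + m) \<alpha> \<phi> = imps n \<alpha> (imps m \<alpha> \<phi>)"
  by (induction n) simp_all

lemma imps_Suc': "imps (Suc n) \<alpha> \<phi> = imps n \<alpha> (\<alpha> \<^bold>\<rightarrow> \<phi>)"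
  by (induction n) simp_all

lemma derivable_mono: "derivable L T \<phi> \<Longrightarrow> T \<subseteq> T' \<Longrightarrow> derivable L T' \<phi>"
  by (induction rule: derivable.induct) (blast intro: derivable.intros)+

locale BL_theory =
  fixes L T :: "fm set"
  assumes BL: "BL_axioms \<subseteq> L"
begin

abbreviation proves :: "fm \<Rightarrow> bool" ("\<turnstile> _" [40] 40) where "\<turnstile> \<phi> \<equiv> derivable L T \<phi>"

lemma BL_axiom: "\<phi> \<in> BL_axioms \<Longrightarrow> \<turnstile> \<phi>"
  using BL by (blast intro: derivable.ax)

lemma imp_trans:
  assumes "\<turnstile> \<phi> \<^bold>\<rightarrow> \<psi>" "\<turnstile> \<psi> \<^bold>\<rightarrow> \<chi>" shows "\<turnstile> \<phi> \<^bold>\<rightarrow> \<chi>"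
  using derivable.mp[OF assms(2) derivable.mp[OF assms(1) BL_axiom[OF A1]]] .

lemma curry: "\<turnstile> (\<phi> \<^bold>& \<psi>) \<^bold>\<rightarrow> \<chi> \<Longrightarrow> \<turnstile> \<phi> \<^bold>\<rightarrow> (\<psi> \<^bold>\<rightarrow> \<chi>)"
  using derivable.mp[OF _ BL_axiom[OF A5b]] .

lemma uncurry: "\<turnstile> \<phi> \<^bold>\<rightarrow> (\<psi> \<^bold>\<rightarrow> \<chi>) \<Longrightarrow> \<turnstile> (\<phi> \<^bold>& \<psi>) \<^bold>\<rightarrow> \<chi>"
  using derivable.mp[OF _ BL_axiom[OF A5a]] .

lemma weaken: "\<turnstile> \<phi> \<^bold>\<rightarrow> (\<psi> \<^bold>\<rightarrow> \<phi>)"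
  by (rule curry, rule BL_axiom, rule A2)

lemma fuse_snd: "\<turnstile> (\<phi> \<^bold>& \<psi>) \<^bold>\<rightarrow> \<psi>"
  by (rule imp_trans, rule BL_axiom, rule A3, rule BL_axiom, rule A2)

lemma imp_refl: "\<turnstile> \<phi> \<^bold>\<rightarrow> \<phi>"
  using derivable.mp[OF BL_axiom[OF A2[of Falsum Falsum]] curry[OF fuse_snd]] .

lemma pairing: "\<turnstile> \<phi> \<^bold>\<rightarrow> (\<psi> \<^bold>\<rightarrow> (\<phi> \<^bold>& \<psi>))"
  by (rule curry, rule imp_refl)

lemma fuse_mono:
  assumes 1: "\<turnstile> \<phi> \<^bold>\<rightarrow> \<psi>" and 2: "\<turnstile> \<phi>' \<^bold>\<rightarrow> \<psi>'" shows "\<turnstile> (\<phi> \<^bold>& \<phi>') \<^bold>\<rightarrow> (\<psi> \<^bold>& \<psi>')"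
proof -
  have *: "\<turnstile> (\<alpha> \<^bold>& \<gamma>) \<^bold>\<rightarrow> (\<beta> \<^bold>& \<gamma>)" if "\<turnstile> \<alpha> \<^bold>\<rightarrow> \<beta>" for \<alpha> \<beta> \<gamma>
    by (rule uncurry, rule imp_trans, rule that, rule pairing)
  have "\<turnstile> (\<psi> \<^bold>& \<phi>') \<^bold>\<rightarrow> (\<phi>' \<^bold>& \<psi>)" "\<turnstile> (\<psi>' \<^bold>& \<psi>) \<^bold>\<rightarrow> (\<psi> \<^bold>& \<psi>')" by (rule BL_axiom, rule A3)+
  thus ?thesis using *[OF 1, of \<phi>'] *[OF 2, of \<psi>] by (blast intro: imp_trans)
qed

lemma imp_mono: "\<turnstile> \<phi> \<^bold>\<rightarrow> \<psi> \<Longrightarrow> \<turnstile> (\<chi> \<^bold>\<rightarrow> \<phi>) \<^bold>\<rightarrow> (\<chi> \<^bold>\<rightarrow> \<psi>)"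
  by (rule curry, rule imp_trans, rule uncurry, rule imp_refl)

lemma imp_antimono: "\<turnstile> \<phi> \<^bold>\<rightarrow> \<psi> \<Longrightarrow> \<turnstile> (\<psi> \<^bold>\<rightarrow> \<chi>) \<^bold>\<rightarrow> (\<phi> \<^bold>\<rightarrow> \<chi>)"
  using derivable.mp[OF _ BL_axiom[OF A1]] .

lemma exchange: "\<turnstile> (\<alpha> \<^bold>\<rightarrow> (\<beta> \<^bold>\<rightarrow> \<gamma>)) \<^bold>\<rightarrow> (\<beta> \<^bold>\<rightarrow> (\<alpha> \<^bold>\<rightarrow> \<gamma>))"
  using imp_trans[OF imp_trans[OF BL_axiom[OF A5a] imp_antimono[OF BL_axiom[OF A3]]] BL_axiom[OF A5b]] .

lemma imps_mono: "\<turnstile> \<phi> \<^bold>\<rightarrow> \<psi> \<Longrightarrow> \<turnstile> imps n \<alpha> \<phi> \<^bold>\<rightarrow> imps n \<alpha> \<psi>"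
  by (induction n) (simp_all add: imp_mono)

lemma imps_exchange: "\<turnstile> imps m \<alpha> (\<phi> \<^bold>\<rightarrow> \<psi>) \<^bold>\<rightarrow> (\<phi> \<^bold>\<rightarrow> imps m \<alpha> \<psi>)"
proof (induction m)
  case (Suc m)
  show ?case using imp_trans[OF imp_mono[OF Suc] exchange] by simp
qed (simp add: imp_refl)

text \<open>The deduction theorem of BL is only local: the number of uses of the hypothesis has to be recorded.\<close>

lemma deduction:
  assumes "derivable L (insert \<alpha> T) \<phi>" shows "\<exists>n. \<turnstile> imps n \<alpha> \<phi>"
  using assms
proof (induction rule: derivable.induct)
  case (ax \<phi>)
  hence "\<turnstile> imps 0 \<alpha> \<phi>" by (simp add: derivable.ax)
  thus ?case by blast
next
  case (hyp \<phi>)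
  hence "\<turnstile> imps 0 \<alpha> \<phi> \<or> \<turnstile> imps 1 \<alpha> \<phi>" using imp_refl by (auto intro: derivable.hyp)
  thus ?case by blast
next
  case (mp \<phi> \<psi>)
  then obtain n m where 1: "\<turnstile> imps n \<alpha> \<phi>" and 2: "\<turnstile> imps m \<alpha> (\<phi> \<^bold>\<rightarrow> \<psi>)" by blast
  have "\<turnstile> \<phi> \<^bold>\<rightarrow> imps m \<alpha> \<psi>" using derivable.mp[OF 2 imps_exchange] .
  hence "\<turnstile> imps (n + m) \<alpha> \<psi>" unfolding imps_add using derivable.mp[OF 1 imps_mono] by blast
  thus ?case by blast
qed

lemma prelinearity_step:
  assumes "\<turnstile> (\<alpha> \<^bold>\<rightarrow> \<beta>) \<^bold>\<rightarrow> \<chi>" "\<turnstile> (\<beta> \<^bold>\<rightarrow> \<alpha>) \<^bold>\<rightarrow> \<chi>" shows "\<turnstile> \<chi>"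
  using derivable.mp[OF assms(2) derivable.mp[OF assms(1) BL_axiom[OF A6]]] .

text \<open>The prelinearity axiom lifts from an implication and its converse to their powers, one factor at a time:
  a factor \<open>\<beta> \<rightarrow> \<alpha>\<close> is absorbed into \<open>\<chi>\<close>, and the other assumption remains true by weakening.\<close>

lemma prelinearity_power:
  assumes "\<turnstile> imps n (\<alpha> \<^bold>\<rightarrow> \<beta>) \<chi>" "\<turnstile> imps m (\<beta> \<^bold>\<rightarrow> \<alpha>) \<chi>" shows "\<turnstile> \<chi>"
proof -
  have one: "\<turnstile> \<chi>" if "\<turnstile> (\<alpha> \<^bold>\<rightarrow> \<beta>) \<^bold>\<rightarrow> \<chi>" "\<turnstile> imps m (\<beta> \<^bold>\<rightarrow> \<alpha>) \<chi>" for m \<chi>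
    using that
  proof (induction m arbitrary: \<chi>)
    case (Suc m)
    have "\<turnstile> (\<alpha> \<^bold>\<rightarrow> \<beta>) \<^bold>\<rightarrow> ((\<beta> \<^bold>\<rightarrow> \<alpha>) \<^bold>\<rightarrow> \<chi>)" using imp_trans[OF Suc.prems(1) weaken] .
    hence "\<turnstile> (\<beta> \<^bold>\<rightarrow> \<alpha>) \<^bold>\<rightarrow> \<chi>" using Suc.IH Suc.prems(2) unfolding imps_Suc' by blast
    thus ?case using prelinearity_step Suc.prems(1) by blast
  qed simp
  show ?thesis using assms
  proof (induction n arbitrary: \<chi>)
    case (Suc n)
    have "\<turnstile> imps m (\<beta> \<^bold>\<rightarrow> \<alpha>) ((\<alpha> \<^bold>\<rightarrow> \<beta>) \<^bold>\<rightarrow> \<chi>)" using derivable.mp[OF Suc.prems(2) imps_mono[OF weaken]] .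
    hence "\<turnstile> (\<alpha> \<^bold>\<rightarrow> \<beta>) \<^bold>\<rightarrow> \<chi>" using Suc.IH Suc.prems(1) unfolding imps_Suc' by blast
    thus ?case using one Suc.prems(2) by blast
  qed simp
qed

end

text \<open>Take a maximal \<open>M \<supseteq> T\<close> that does not derive \<open>\<phi>\<close>. If neither \<open>\<alpha> \<rightarrow> \<beta>\<close> nor its converse were derivable from
  \<open>M\<close>, each of them would yield \<open>\<phi>\<close> as an additional hypothesis, and \<open>prelinearity_power\<close> would derive \<open>\<phi>\<close> from \<open>M\<close>.\<close>

lemma linear_extension:
  assumes BL: "BL_axioms \<subseteq> L" and T: "\<not> derivable L T \<phi>"
  shows "\<exists>M. T \<subseteq> M \<and> \<not> derivable L M \<phi> \<and>
    (\<forall>\<alpha> \<beta>. derivable L M (\<alpha> \<^bold>\<rightarrow> \<beta>) \<or> derivable L M (\<beta> \<^bold>\<rightarrow> \<alpha>))"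
proof -
  define \<A> where "\<A> = {M. T \<subseteq> M \<and> \<not> derivable L M \<phi>}"
  have chain: "\<exists>M\<in>\<C>. derivable L M \<psi>"
    if "derivable L (\<Union>\<C>) \<psi>" and ne: "\<C> \<noteq> {}" and ch: "subset.chain \<A> \<C>" for \<C> \<psi>
    using that(1)
  proof (induction rule: derivable.induct)
    case (ax \<psi>) thus ?case using ne by (blast intro: derivable.ax)
  next
    case (hyp \<psi>) thus ?case by (blast intro: derivable.hyp)
  next
    case (mp \<psi> \<chi>)
    then obtain M N where MN: "M \<in> \<C>" "N \<in> \<C>" "derivable L M \<psi>" "derivable L N (\<psi> \<^bold>\<rightarrow> \<chi>)" by blast
    hence "M \<subseteq> N \<or> N \<subseteq> M" using ch unfolding subset.chain_def by blast
    thus ?case using MN by (meson derivable.mp derivable_mono)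
  qed
  have "\<exists>M\<in>\<A>. \<forall>X\<in>\<A>. M \<subseteq> X \<longrightarrow> X = M"
  proof (rule subset_Zorn_nonempty)
    show "\<A> \<noteq> {}" using T by (auto simp: \<A>_def)
    fix \<C> assume ne: "\<C> \<noteq> {}" and ch: "subset.chain \<A> \<C>"
    have sub: "\<C> \<subseteq> \<A>" using ch by (simp add: subset.chain_def)
    have "\<not> derivable L (\<Union>\<C>) \<phi>" using chain[OF _ ne ch] sub by (auto simp: \<A>_def)
    moreover have "T \<subseteq> \<Union>\<C>" using ne sub by (auto simp: \<A>_def)
    ultimately show "\<Union>\<C> \<in> \<A>" by (simp add: \<A>_def)
  qed
  then obtain M where M: "M \<in> \<A>" and max: "\<And>X. X \<in> \<A> \<Longrightarrow> M \<subseteq> X \<Longrightarrow> X = M" by blast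
  interpret BL_theory L M by unfold_locales (fact BL)
  have step: "\<exists>n. derivable L M (imps n \<gamma> \<phi>)" if \<gamma>: "\<not> derivable L M \<gamma>" for \<gamma>
  proof (rule deduction, rule ccontr)
    assume "\<not> derivable L (insert \<gamma> M) \<phi>"
    hence "insert \<gamma> M = M" using max[of "insert \<gamma> M"] M by (auto simp: \<A>_def)
    thus False using \<gamma> derivable.hyp[of \<gamma> M L] by blast
  qed
  have "derivable L M (\<alpha> \<^bold>\<rightarrow> \<beta>) \<or> derivable L M (\<beta> \<^bold>\<rightarrow> \<alpha>)" for \<alpha> \<beta>
  proof (rule ccontr)
    assume "\<not> ?thesis"
    then obtain n m where "derivable L M (imps n (\<alpha> \<^bold>\<rightarrow> \<beta>) \<phi>)" "derivable L M (imps m (\<beta> \<^bold>\<rightarrow> \<alpha>) \<phi>)"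
      using step by blast
    thus False using prelinearity_power M by (auto simp: \<A>_def)
  qed
  thus ?thesis using M by (auto simp: \<A>_def)
qed

section \<open>Lindenbaum chains\<close>

context BL_theory
begin

definition equivalent :: "fm \<Rightarrow> fm \<Rightarrow> bool" where
  "equivalent \<phi> \<psi> \<longleftrightarrow> (\<turnstile> \<phi> \<^bold>\<rightarrow> \<psi>) \<and> (\<turnstile> \<psi> \<^bold>\<rightarrow> \<phi>)"

definition cls :: "fm \<Rightarrow> fm set" where
  "cls \<phi> = {\<psi>. equivalent \<phi> \<psi>}"

definition rep :: "fm set \<Rightarrow> fm" where
  "rep X = (SOME \<phi>. cls \<phi> = X)"

text \<open>The operations are given by representatives; \<open>lindenbaum_mult\<close> and \<open>lindenbaum_impl\<close> show that the choice
  is irrelevant.\<close>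

definition lindenbaum :: "fm set hoop" where
  "lindenbaum = \<lparr>carrier = range cls, monoid.mult = (\<lambda>X Y. cls (rep X \<^bold>& rep Y)),
     one = cls (Falsum \<^bold>\<rightarrow> Falsum), impl = (\<lambda>X Y. cls (rep X \<^bold>\<rightarrow> rep Y))\<rparr>"

lemma cls_eq: "cls \<phi> = cls \<psi> \<longleftrightarrow> equivalent \<phi> \<psi>"
  unfolding cls_def equivalent_def set_eq_iff mem_Collect_eq by (blast intro: imp_refl imp_trans)

lemma equivalent_rep: "equivalent (rep (cls \<phi>)) \<phi>"
  unfolding cls_eq[symmetric] rep_def by (rule someI[of _ \<phi>]) simp

lemma lindenbaum_mult: "cls \<phi> \<otimes>\<^bsub>lindenbaum\<^esub> cls \<psi> = cls (\<phi> \<^bold>& \<psi>)"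
  using equivalent_rep[of \<phi>] equivalent_rep[of \<psi>]
  by (simp add: lindenbaum_def cls_eq equivalent_def fuse_mono)

lemma lindenbaum_impl: "cls \<phi> \<rightarrow>\<^bsub>lindenbaum\<^esub> cls \<psi> = cls (\<phi> \<^bold>\<rightarrow> \<psi>)"
  using equivalent_rep[of \<phi>] equivalent_rep[of \<psi>] unfolding lindenbaum_def
  by (simp add: cls_eq equivalent_def) (blast intro: imp_trans imp_mono imp_antimono)

lemma lindenbaum_one: "cls \<phi> = \<one>\<^bsub>lindenbaum\<^esub> \<longleftrightarrow> (\<turnstile> \<phi>)"
proof -
  have "\<turnstile> \<phi> \<Longrightarrow> \<turnstile> \<psi> \<^bold>\<rightarrow> \<phi>" for \<phi> \<psi> using derivable.mp[OF _ weaken] .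
  moreover have "\<turnstile> \<phi>" if "\<turnstile> (Falsum \<^bold>\<rightarrow> Falsum) \<^bold>\<rightarrow> \<phi>" using derivable.mp[OF imp_refl that] .
  ultimately show ?thesis by (auto simp: lindenbaum_def cls_eq equivalent_def imp_refl)
qed

lemma cls_imp_refl: "cls (\<phi> \<^bold>\<rightarrow> \<phi>) = \<one>\<^bsub>lindenbaum\<^esub>"
  by (subst lindenbaum_one) (rule imp_refl)

lemma lindenbaum_le: "hoop_le lindenbaum (cls \<phi>) (cls \<psi>) \<longleftrightarrow> (\<turnstile> \<phi> \<^bold>\<rightarrow> \<psi>)"
  by (simp add: hoop_le_def lindenbaum_impl lindenbaum_one)

lemma lindenbaum_carrier: "carrier lindenbaum = range cls"
  by (simp add: lindenbaum_def)

lemma fuse_assoc: "cls ((\<phi> \<^bold>& \<psi>) \<^bold>& \<chi>) = cls (\<phi> \<^bold>& (\<psi> \<^bold>& \<chi>))"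
proof -
  have "\<turnstile> ((\<phi> \<^bold>& \<psi>) \<^bold>& \<chi>) \<^bold>\<rightarrow> (\<phi> \<^bold>& (\<psi> \<^bold>& \<chi>))"
    using uncurry[OF uncurry[OF imp_trans[OF pairing BL_axiom[OF A5b]]]] .
  moreover have "\<turnstile> (\<phi> \<^bold>& (\<psi> \<^bold>& \<chi>)) \<^bold>\<rightarrow> ((\<phi> \<^bold>& \<psi>) \<^bold>& \<chi>)"
    using uncurry[OF imp_trans[OF curry[OF pairing] BL_axiom[OF A5a]]] .
  ultimately show ?thesis by (simp add: cls_eq equivalent_def)
qed

lemma lindenbaum_hoop: "hoop lindenbaum"
proof -
  have 1: "\<turnstile> Falsum \<^bold>\<rightarrow> Falsum" by (rule imp_refl)
  have one: "\<one>\<^bsub>lindenbaum\<^esub> = cls (Falsum \<^bold>\<rightarrow> Falsum)" by (simp add: lindenbaum_def)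
  have unit: "cls ((Falsum \<^bold>\<rightarrow> Falsum) \<^bold>& \<phi>) = cls \<phi>" for \<phi>
    unfolding cls_eq equivalent_def using derivable.mp[OF 1 pairing] fuse_snd by blast
  have comm: "cls (\<phi> \<^bold>& \<psi>) = cls (\<psi> \<^bold>& \<phi>)" for \<phi> \<psi>
    unfolding cls_eq equivalent_def by (blast intro: BL_axiom A3)
  have "comm_monoid lindenbaum"
  proof (rule comm_monoidI)
    fix X Y assume "X \<in> carrier lindenbaum" "Y \<in> carrier lindenbaum"
    then obtain \<phi> \<psi> where "X = cls \<phi>" "Y = cls \<psi>" by (auto simp: lindenbaum_carrier)
    thus "X \<otimes>\<^bsub>lindenbaum\<^esub> Y = Y \<otimes>\<^bsub>lindenbaum\<^esub> X" using comm by (simp add: lindenbaum_mult)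
  qed (auto simp: lindenbaum_carrier lindenbaum_mult one fuse_assoc unit)
  moreover have "cls (\<phi> \<^bold>\<rightarrow> (\<psi> \<^bold>\<rightarrow> \<chi>)) = cls ((\<phi> \<^bold>& \<psi>) \<^bold>\<rightarrow> \<chi>)" for \<phi> \<psi> \<chi>
    unfolding cls_eq equivalent_def by (blast intro: BL_axiom A5a A5b)
  moreover have "cls (\<phi> \<^bold>& (\<phi> \<^bold>\<rightarrow> \<psi>)) = cls (\<psi> \<^bold>& (\<psi> \<^bold>\<rightarrow> \<phi>))" for \<phi> \<psi>
    unfolding cls_eq equivalent_def by (blast intro: BL_axiom A4)
  ultimately show ?thesis
    by (intro hoop.intro hoop_axioms.intro)
      (auto simp: lindenbaum_carrier lindenbaum_mult lindenbaum_impl cls_imp_refl)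
qed

lemma cls_double: "cls (fm_double \<phi>) = dbl lindenbaum (cls \<phi>)"
proof -
  interpret lin: hoop lindenbaum by (rule lindenbaum_hoop)
  define t where "t = (\<phi> \<^bold>\<rightarrow> (\<phi> \<^bold>& \<phi>)) \<^bold>\<rightarrow> \<phi>"
  have "cls (fm_double \<phi>) = cls t \<otimes>\<^bsub>lindenbaum\<^esub> (cls t \<rightarrow>\<^bsub>lindenbaum\<^esub> cls t)"
    unfolding fm_double_def fm_veebar_def fm_and_def t_def lindenbaum_mult lindenbaum_impl ..
  also have "\<dots> = cls t" by (simp add: lin.impl_refl lindenbaum_carrier)
  finally show ?thesis by (simp add: t_def dbl_def lindenbaum_mult lindenbaum_impl)
qed

lemma lindenbaum_chang_chain:
  assumes chang: "\<And>\<phi>. fm_square (fm_double \<phi>) \<^bold>\<leftrightarrow> fm_double (fm_square \<phi>) \<in> L"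
    and linear: "\<And>\<alpha> \<beta>. (\<turnstile> \<alpha> \<^bold>\<rightarrow> \<beta>) \<or> (\<turnstile> \<beta> \<^bold>\<rightarrow> \<alpha>)"
  shows "chang_chain lindenbaum"
proof -
  interpret lin: hoop lindenbaum by (rule lindenbaum_hoop)
  have "cls (fm_square (fm_double \<phi>)) = cls (fm_double (fm_square \<phi>))" for \<phi>
  proof -
    have "\<turnstile> fm_square (fm_double \<phi>) \<^bold>\<leftrightarrow> fm_double (fm_square \<phi>)" using chang by (rule derivable.ax)
    thus ?thesis unfolding fm_iff_def cls_eq equivalent_def
      using derivable.mp[OF _ BL_axiom[OF A2]] derivable.mp[OF _ fuse_snd] by blast
  qed
  hence "dbl lindenbaum (cls \<phi>) \<otimes>\<^bsub>lindenbaum\<^esub> dbl lindenbaum (cls \<phi>)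
      = dbl lindenbaum (cls \<phi> \<otimes>\<^bsub>lindenbaum\<^esub> cls \<phi>)" for \<phi>
    by (simp add: fm_square_def lindenbaum_mult flip: cls_double)
  moreover have "hoop_le lindenbaum X Y \<or> hoop_le lindenbaum Y X"
    if XY: "X \<in> carrier lindenbaum" "Y \<in> carrier lindenbaum" for X Y
  proof -
    obtain \<phi> \<psi> where "X = cls \<phi>" "Y = cls \<psi>" using XY by (auto simp: lindenbaum_carrier)
    thus ?thesis using linear[of \<phi> \<psi>] by (simp add: lindenbaum_le)
  qed
  ultimately show ?thesis
    by unfold_locales (auto simp: lindenbaum_carrier)
qed

end

section \<open>Soundness and completeness\<close>

lemma (in hoop) impl_trans:
  assumes C: "x \<in> carrier A" "y \<in> carrier A" "z \<in> carrier A"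
  shows "x \<rightarrow> y \<preceq> (y \<rightarrow> z) \<rightarrow> (x \<rightarrow> z)"
proof -
  have "(x \<rightarrow> y) \<otimes> x \<preceq> y" using C by (simp add: residuated)
  hence "y \<rightarrow> z \<preceq> ((x \<rightarrow> y) \<otimes> x) \<rightarrow> z" using C by (intro impl_antimono) simp_all
  hence "y \<rightarrow> z \<preceq> (x \<rightarrow> y) \<rightarrow> (x \<rightarrow> z)" using C by (simp add: impl_curry)
  thus ?thesis using C impl_swap[of "x \<rightarrow> y" "y \<rightarrow> z" "x \<rightarrow> z"] by (simp add: hoop_le_def)
qed

lemma (in BL_algebra) fm_eval_closed:
  "range v \<subseteq> carrier A \<Longrightarrow> fm_eval A v \<phi> \<in> carrier A"
  by (induction \<phi>) (auto simp: zero_closed)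

lemma (in BL_chain) BL_axioms_valid:
  assumes "\<phi> \<in> BL_axioms" and v: "range v \<subseteq> carrier A" shows "fm_eval A v \<phi> = \<one>"
proof -
  note [simp] = fm_eval_closed[OF v]
  from assms(1) show ?thesis
  proof cases
    case (A1 \<phi> \<psi> \<chi>)
    thus ?thesis using impl_trans by (simp add: hoop_le_def)
  next
    case (A2 \<phi> \<psi>)
    thus ?thesis using mult_le_left by (simp add: hoop_le_def)
  next
    case (A3 \<phi> \<psi>)
    thus ?thesis using m_comm[of "fm_eval A v \<phi>" "fm_eval A v \<psi>"] by (simp add: impl_refl)
  next
    case (A4 \<phi> \<psi>)
    thus ?thesis using hoop.divisibility[OF hoop_axioms, of "fm_eval A v \<phi>" "fm_eval A v \<psi>"]
      by (simp add: impl_refl)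
  next
    case (A6 \<phi> \<psi> \<chi>)
    let ?a = "fm_eval A v \<phi>" and ?b = "fm_eval A v \<psi>" and ?c = "fm_eval A v \<chi>"
    have "?a \<preceq> ?b \<or> ?b \<preceq> ?a" by (rule linear) simp_all
    hence "((?a \<rightarrow> ?b) \<rightarrow> ?c) \<rightarrow> (((?b \<rightarrow> ?a) \<rightarrow> ?c) \<rightarrow> ?c) = \<one>"
    proof
      assume "?a \<preceq> ?b"
      thus ?thesis using le_impl[of ?c "(?b \<rightarrow> ?a) \<rightarrow> ?c"] by (simp add: hoop_le_def)
    qed (simp add: hoop_le_def impl_refl)
    thus ?thesis using A6 by simp
  next
    case (A7 \<phi>)
    thus ?thesis using zero_hle by (simp add: hoop_le_def)
  qed (simp_all add: impl_curry impl_refl)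
qed

lemma L_algebra_BL_Chang:
  assumes "BL_chain A" "chang_chain A" shows "L_algebra BL_Chang A"
proof -
  interpret BL_chain A by fact
  have "fm_eval A v \<phi> = \<one>\<^bsub>A\<^esub>" if "\<phi> \<in> BL_Chang" and v: "range v \<subseteq> carrier A" for \<phi> v
    using that(1) unfolding BL_Chang_def
  proof (elim UnE CollectE exE conjE)
    fix \<psi> assume \<phi>: "\<phi> = fm_square (fm_double \<psi>) \<^bold>\<leftrightarrow> fm_double (fm_square \<psi>)"
    have dbl: "fm_eval A v (fm_double \<chi>) = dbl A (fm_eval A v \<chi>)" for \<chi>
      using fm_eval_closed[OF v, of \<chi>]
      by (simp add: fm_double_def fm_veebar_def fm_and_def dbl_def impl_refl)
    have "fm_eval A v (fm_square (fm_double \<psi>)) = fm_eval A v (fm_double (fm_square \<psi>))"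
      using chang_chain.chang[OF assms(2) fm_eval_closed[OF v, of \<psi>]]
      by (simp add: dbl) (simp add: fm_square_def dbl)
    thus ?thesis using fm_eval_closed[OF v] by (simp add: \<phi> fm_iff_def impl_refl)
  qed (use BL_axioms_valid v in blast)
  thus ?thesis unfolding L_algebra_def using BL_algebra_axioms by blast
qed

lemma soundness:
  assumes "L_algebra L A" and "derivable L T \<phi>"
    and v: "range v \<subseteq> carrier A" "\<And>\<psi>. \<psi> \<in> T \<Longrightarrow> fm_eval A v \<psi> = \<one>\<^bsub>A\<^esub>"
  shows "fm_eval A v \<phi> = \<one>\<^bsub>A\<^esub>"
proof -
  interpret BL_algebra A using assms(1) by (simp add: L_algebra_def)
  from assms(2) show ?thesis
  proof (induction rule: derivable.induct)
    case (ax \<phi>) thus ?case using assms(1) v(1) unfolding L_algebra_def by blast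
  next
    case (hyp \<phi>) thus ?case by (rule v(2))
  next
    case (mp \<phi> \<psi>) thus ?case using fm_eval_closed[OF v(1), of \<psi>] by simp
  qed
qed

primrec subformulas :: "fm \<Rightarrow> fm set" where
  "subformulas (Var n) = {Var n}"
| "subformulas Falsum = {Falsum}"
| "subformulas (\<phi> \<^bold>& \<psi>) = insert (\<phi> \<^bold>& \<psi>) (subformulas \<phi> \<union> subformulas \<psi>)"
| "subformulas (\<phi> \<^bold>\<rightarrow> \<psi>) = insert (\<phi> \<^bold>\<rightarrow> \<psi>) (subformulas \<phi> \<union> subformulas \<psi>)"

lemma finite_subformulas: "finite (subformulas \<phi>)"
  by (induction \<phi>) simp_all

lemma subformulas_self: "\<phi> \<in> subformulas \<phi>"
  by (cases \<phi>) simp_all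

lemma subformulas_trans: "\<psi> \<in> subformulas \<phi> \<Longrightarrow> subformulas \<psi> \<subseteq> subformulas \<phi>"
  by (induction \<phi>) auto

text \<open>The finite part to be embedded consists of the classes of all subformulas of \<open>T\<close>, \<open>\<phi>\<close> and \<open>\<bottom>\<close>. The
  evaluation induced by the embedding sends each of these formulas to the image of its class, hence it satisfies \<open>T\<close> and
  refutes \<open>\<phi>\<close>.\<close>

theorem completeness_omegaV:
  assumes fin: "finite T" and ent: "entails omegaV T \<phi>"
  shows "derivable BL_Chang T \<phi>"
proof (rule ccontr)
  assume "\<not> derivable BL_Chang T \<phi>"
  have BL: "BL_axioms \<subseteq> BL_Chang" by (auto simp: BL_Chang_def)
  obtain M where M: "T \<subseteq> M" "\<not> derivable BL_Chang M \<phi>"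
    and lin: "\<And>\<alpha> \<beta>. derivable BL_Chang M (\<alpha> \<^bold>\<rightarrow> \<beta>) \<or> derivable BL_Chang M (\<beta> \<^bold>\<rightarrow> \<alpha>)"
    using linear_extension[OF BL \<open>\<not> derivable BL_Chang T \<phi>\<close>] by blast
  interpret BL_theory BL_Chang M by unfold_locales (rule BL)
  interpret C: chang_chain lindenbaum
    by (rule lindenbaum_chang_chain) (use lin in \<open>auto simp: BL_Chang_def\<close>)
  define Sub where "Sub = (\<Union>\<psi>\<in>insert Falsum (insert \<phi> T). subformulas \<psi>)"
  have Sub: "finite Sub" "insert Falsum (insert \<phi> T) \<subseteq> Sub"
    using fin finite_subformulas subformulas_self by (auto simp: Sub_def)
  have closed: "subformulas \<psi> \<subseteq> Sub" if "\<psi> \<in> Sub" for \<psi>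
    using that subformulas_trans by (auto simp: Sub_def)
  have "\<exists>H. C.omegaV_embedding (cls Falsum) (cls ` Sub) H"
  proof (rule C.finite_part_embeds_in_omegaV)
    show "cls Falsum \<noteq> \<one>\<^bsub>lindenbaum\<^esub>"
      using M(2) derivable.mp[OF _ BL_axiom[OF A7]] by (auto simp: lindenbaum_one)
  qed (use Sub in \<open>auto simp: lindenbaum_carrier lindenbaum_le BL_axiom A7\<close>)
  then obtain H where "C.omegaV_embedding (cls Falsum) (cls ` Sub) H" ..
  hence H0: "H (cls Falsum) = \<zero>\<^bsub>omegaV\<^esub>"
    and H: "\<And>\<psi>. \<psi> \<in> Sub \<Longrightarrow> H (cls \<psi>) \<in> carrier omegaV"
      "\<And>\<psi>. \<psi> \<in> Sub \<Longrightarrow> H (cls \<psi>) = \<one>\<^bsub>omegaV\<^esub> \<longleftrightarrow> derivable BL_Chang M \<psi>"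
    and Hm: "\<And>\<alpha> \<beta>. \<alpha> \<in> Sub \<Longrightarrow> \<beta> \<in> Sub \<Longrightarrow> (\<alpha> \<^bold>& \<beta>) \<in> Sub \<Longrightarrow>
        H (cls (\<alpha> \<^bold>& \<beta>)) = H (cls \<alpha>) \<otimes>\<^bsub>omegaV\<^esub> H (cls \<beta>)"
    and Hi: "\<And>\<alpha> \<beta>. \<alpha> \<in> Sub \<Longrightarrow> \<beta> \<in> Sub \<Longrightarrow> (\<alpha> \<^bold>\<rightarrow> \<beta>) \<in> Sub \<Longrightarrow>
        H (cls (\<alpha> \<^bold>\<rightarrow> \<beta>)) = H (cls \<alpha>) \<rightarrow>\<^bsub>omegaV\<^esub> H (cls \<beta>)"
    unfolding C.omegaV_embedding_def by (auto simp: omegaV_zero lindenbaum_mult lindenbaum_impl lindenbaum_one)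
  define v where "v n = (if Var n \<in> Sub then H (cls (Var n)) else \<one>\<^bsub>omegaV\<^esub>)" for n
  have eval: "fm_eval omegaV v \<psi> = H (cls \<psi>)" if "subformulas \<psi> \<subseteq> Sub" for \<psi>
    using that
  proof (induction \<psi>)
    case (Fuse \<alpha> \<beta>)
    thus ?case using Hm[of \<alpha> \<beta>] subformulas_self by (simp add: subset_iff)
  next
    case (Impl \<alpha> \<beta>)
    thus ?case using Hi[of \<alpha> \<beta>] subformulas_self by (simp add: subset_iff)
  qed (simp_all add: v_def H0)
  have "\<one>\<^bsub>omegaV\<^esub> \<in> carrier omegaV"
    using ordinal_sum_family.None_closed[OF omegaV_family] by (simp add: omegaV_def ordinal_sum_simps(4))
  hence "range v \<subseteq> carrier omegaV" using H by (auto simp: v_def)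
  moreover have "fm_eval omegaV v \<psi> = \<one>\<^bsub>omegaV\<^esub>" if "\<psi> \<in> T" for \<psi>
  proof -
    have "\<psi> \<in> Sub" "\<psi> \<in> M" using that Sub M by auto
    thus ?thesis using eval[OF closed, of \<psi>] H(2)[of \<psi>] derivable.hyp[of \<psi> M] by simp
  qed
  ultimately have "fm_eval omegaV v \<phi> = \<one>\<^bsub>omegaV\<^esub>" using ent unfolding entails_def by blast
  thus False using eval[OF closed, of \<phi>] H(2)[of \<phi>] Sub M by auto
qed

lemma omegaV_L_algebra: "L_algebra BL_Chang omegaV"
  using L_algebra_BL_Chang ordinal_sum_of_perfect omegaV_in_sums by blast

theorem finite_strong_completeness: "finitely_strongly_complete BL_Chang omegaV"
  unfolding finitely_strongly_complete_def
proof (intro conjI allI impI iffI omegaV_L_algebra)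
  fix T \<phi> assume "derivable BL_Chang T \<phi>"
  thus "entails omegaV T \<phi>"
    unfolding entails_def using soundness[OF omegaV_L_algebra] by blast
qed (rule completeness_omegaV)

section \<open>Identities of BL-algebras\<close>

text \<open>The lattice operations are replaced by their definitions from the hoop operations.\<close>

primrec fm_of_term :: "bl_term \<Rightarrow> fm" where
  "fm_of_term (TVar n) = Var n"
| "fm_of_term TZero = Falsum"
| "fm_of_term TOne = (Falsum \<^bold>\<rightarrow> Falsum)"
| "fm_of_term (TMult s t) = (fm_of_term s \<^bold>& fm_of_term t)"
| "fm_of_term (TImpl s t) = (fm_of_term s \<^bold>\<rightarrow> fm_of_term t)"
| "fm_of_term (TInf s t) = (fm_of_term s \<^bold>\<and> fm_of_term t)"
| "fm_of_term (TSup s t) =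
     (((fm_of_term s \<^bold>\<rightarrow> fm_of_term t) \<^bold>\<rightarrow> fm_of_term t) \<^bold>\<and>
      ((fm_of_term t \<^bold>\<rightarrow> fm_of_term s) \<^bold>\<rightarrow> fm_of_term s))"

primrec term_of_fm :: "fm \<Rightarrow> bl_term" where
  "term_of_fm (Var n) = TVar n"
| "term_of_fm Falsum = TZero"
| "term_of_fm (\<phi> \<^bold>& \<psi>) = TMult (term_of_fm \<phi>) (term_of_fm \<psi>)"
| "term_of_fm (\<phi> \<^bold>\<rightarrow> \<psi>) = TImpl (term_of_fm \<phi>) (term_of_fm \<psi>)"

lemma term_eval_term_of_fm: "term_eval A v (term_of_fm \<phi>) = fm_eval A v \<phi>"
  by (induction \<phi>) simp_all

lemma fm_eval_fm_of_term:
  assumes "BL_algebra A" and v: "range v \<subseteq> carrier A"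
  shows "fm_eval A v (fm_of_term t) = term_eval A v t"
proof -
  interpret BL_algebra A by fact
  have C: "term_eval A v t \<in> carrier A" for t
    by (induction t) (use v in \<open>auto simp: zero_closed inf_closed sup_closed\<close>)
  show ?thesis
    by (induction t) (simp_all add: fm_and_def impl_refl zero_closed C inf_hle sup_definable)
qed

definition omegaV_identities :: "(bl_term \<times> bl_term) set" where
  "omegaV_identities = {(s, t). \<forall>v. range v \<subseteq> carrier omegaV \<longrightarrow> term_eval omegaV v s = term_eval omegaV v t}"

text \<open>An identity \<open>s = t\<close> valid in \<open>\<omega>\<V>\<close> makes the two implications between the corresponding formulas
  theorems of the logic, and these give both inequalities between the values of \<open>s\<close> and \<open>t\<close>.\<close>

lemma BL_Chang_algebra_identities: "BL_Chang_algebras \<subseteq> variety omegaV_identities"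
proof
  fix A :: "'a bl" assume "A \<in> BL_Chang_algebras"
  hence L: "L_algebra BL_Chang A" by (simp add: BL_Chang_algebras_def)
  hence BL: "BL_algebra A" by (simp add: L_algebra_def)
  interpret BL_algebra A by (rule BL)
  interpret W: BL_chain omegaV using ordinal_sum_of_perfect(1)[OF omegaV_in_sums] .
  have le: "hoop_le A (term_eval A v s) (term_eval A v t)"
    if st: "\<And>w. range w \<subseteq> carrier omegaV \<Longrightarrow> term_eval omegaV w s = term_eval omegaV w t"
      and v: "range v \<subseteq> carrier A" for s t v
  proof -
    have "entails omegaV {} (fm_of_term s \<^bold>\<rightarrow> fm_of_term t)"
      unfolding entails_def
    proof (intro allI impI)
      fix w assume "range w \<subseteq> carrier omegaV \<and> (\<forall>\<psi>\<in>{}. fm_eval omegaV w \<psi> = \<one>\<^bsub>omegaV\<^esub>)"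
      hence w: "range w \<subseteq> carrier omegaV" by simp
      have "fm_eval omegaV w (fm_of_term s) = fm_eval omegaV w (fm_of_term t)"
        using st[OF w] fm_eval_fm_of_term[OF W.BL_algebra_axioms w] by simp
      thus "fm_eval omegaV w (fm_of_term s \<^bold>\<rightarrow> fm_of_term t) = \<one>\<^bsub>omegaV\<^esub>"
        using W.fm_eval_closed[OF w] by (simp add: W.impl_refl)
    qed
    hence "derivable BL_Chang {} (fm_of_term s \<^bold>\<rightarrow> fm_of_term t)" by (intro completeness_omegaV) simp_all
    hence "fm_eval A v (fm_of_term s \<^bold>\<rightarrow> fm_of_term t) = \<one>\<^bsub>A\<^esub>" using soundness[OF L _ v] by blast
    thus ?thesis using fm_eval_fm_of_term[OF BL v] by (simp add: hoop_le_def)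
  qed
  have "term_eval A v s = term_eval A v t" if st: "(s, t) \<in> omegaV_identities" and v: "range v \<subseteq> carrier A" for s t v
  proof (rule hle_antisym)
    show "hoop_le A (term_eval A v s) (term_eval A v t)" "hoop_le A (term_eval A v t) (term_eval A v s)"
      using le[of s t v] le[of t s v] st v by (auto simp: omegaV_identities_def)
  qed (use fm_eval_closed[OF v, of "fm_of_term s"] fm_eval_closed[OF v, of "fm_of_term t"]
      fm_eval_fm_of_term[OF BL v] in simp_all)
  moreover have "bl_closed (carrier A) A"
    by (simp add: bl_closed_def zero_closed inf_closed sup_closed)
  ultimately show "A \<in> variety omegaV_identities" by (auto simp: variety_def)
qed

text \<open>Residuation is the only defining condition of a BL-algebra that is not an identity. It follows from
  divisibility together with the identities \<open>x \<rightarrow> x = \<one>\<close>, \<open>x \<rightarrow> \<one> = \<one>\<close> and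
  \<open>x \<rightarrow> (y \<rightarrow> z) = (x \<otimes> y) \<rightarrow> z\<close>.\<close>

lemma variety_BL_Chang: "variety omegaV_identities \<subseteq> BL_Chang_algebras"
proof
  fix A :: "'a bl" assume A: "A \<in> variety omegaV_identities"
  interpret W: BL_chain omegaV using ordinal_sum_of_perfect(1)[OF omegaV_in_sums] .
  have identity: "term_eval A v s = term_eval A v t"
    if "\<And>w. (\<And>n. w n \<in> carrier omegaV) \<Longrightarrow> term_eval omegaV w s = term_eval omegaV w t"
      and "\<And>n. v n \<in> carrier A" for s t v
  proof -
    have "(s, t) \<in> omegaV_identities" using that(1) unfolding omegaV_identities_def by blast
    thus ?thesis using A that(2) unfolding variety_def by blast
  qed
  have cl [simp]: "\<one>\<^bsub>A\<^esub> \<in> carrier A" "\<zero>\<^bsub>A\<^esub> \<in> carrier A"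
    "\<And>x y. x \<in> carrier A \<Longrightarrow> y \<in> carrier A \<Longrightarrow> x \<otimes>\<^bsub>A\<^esub> y \<in> carrier A \<and> x \<rightarrow>\<^bsub>A\<^esub> y \<in> carrier A
      \<and> x \<curlywedge>\<^bsub>A\<^esub> y \<in> carrier A \<and> x \<curlyvee>\<^bsub>A\<^esub> y \<in> carrier A"
    using A by (auto simp: variety_def bl_closed_def)
  \<comment> \<open>an assignment for identities in the variables \<open>0\<close>, \<open>1\<close> and \<open>2\<close>\<close>
  define val where "val x y z n = (if n = 0 then x else if n = 1 then y else z)" for x y z :: 'a and n :: nat
  have val: "val x y z n \<in> carrier A" if "x \<in> carrier A" "y \<in> carrier A" "z \<in> carrier A" for x y z n
    using that by (simp add: val_def)
  let ?x = "TVar 0" and ?y = "TVar 1" and ?z = "TVar 2"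
  note W = W.zero_closed W.inf_closed W.sup_closed
  have mult_assoc: "x \<otimes>\<^bsub>A\<^esub> y \<otimes>\<^bsub>A\<^esub> z = x \<otimes>\<^bsub>A\<^esub> (y \<otimes>\<^bsub>A\<^esub> z)"
    and inf_assoc: "(x \<curlywedge>\<^bsub>A\<^esub> y) \<curlywedge>\<^bsub>A\<^esub> z = x \<curlywedge>\<^bsub>A\<^esub> (y \<curlywedge>\<^bsub>A\<^esub> z)"
    and sup_assoc: "(x \<curlyvee>\<^bsub>A\<^esub> y) \<curlyvee>\<^bsub>A\<^esub> z = x \<curlyvee>\<^bsub>A\<^esub> (y \<curlyvee>\<^bsub>A\<^esub> z)"
    and curry: "x \<rightarrow>\<^bsub>A\<^esub> (y \<rightarrow>\<^bsub>A\<^esub> z) = (x \<otimes>\<^bsub>A\<^esub> y) \<rightarrow>\<^bsub>A\<^esub> z"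
    if C: "x \<in> carrier A" "y \<in> carrier A" "z \<in> carrier A" for x y z
    using identity[of "TMult (TMult ?x ?y) ?z" "TMult ?x (TMult ?y ?z)" "val x y z", OF _ val[OF C]]
      identity[of "TInf (TInf ?x ?y) ?z" "TInf ?x (TInf ?y ?z)" "val x y z", OF _ val[OF C]]
      identity[of "TSup (TSup ?x ?y) ?z" "TSup ?x (TSup ?y ?z)" "val x y z", OF _ val[OF C]]
      identity[of "TImpl ?x (TImpl ?y ?z)" "TImpl (TMult ?x ?y) ?z" "val x y z", OF _ val[OF C]]
    by (simp_all add: val_def W W.m_assoc W.inf_assoc W.sup_assoc W.impl_curry)
  have mult_comm: "x \<otimes>\<^bsub>A\<^esub> y = y \<otimes>\<^bsub>A\<^esub> x" and inf_comm: "x \<curlywedge>\<^bsub>A\<^esub> y = y \<curlywedge>\<^bsub>A\<^esub> x"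
    and sup_comm: "x \<curlyvee>\<^bsub>A\<^esub> y = y \<curlyvee>\<^bsub>A\<^esub> x"
    if C: "x \<in> carrier A" "y \<in> carrier A" for x y
    using identity[of "TMult ?x ?y" "TMult ?y ?x" "val x y x", OF _ val[OF C C(1)]]
      identity[of "TInf ?x ?y" "TInf ?y ?x" "val x y x", OF _ val[OF C C(1)]]
      identity[of "TSup ?x ?y" "TSup ?y ?x" "val x y x", OF _ val[OF C C(1)]]
    by (simp_all add: val_def W.m_comm W.inf_commute W.sup_commute)
  have absorb1: "x \<curlywedge>\<^bsub>A\<^esub> (x \<curlyvee>\<^bsub>A\<^esub> y) = x" and absorb2: "x \<curlyvee>\<^bsub>A\<^esub> (x \<curlywedge>\<^bsub>A\<^esub> y) = x"
    and prelin: "(x \<rightarrow>\<^bsub>A\<^esub> y) \<curlyvee>\<^bsub>A\<^esub> (y \<rightarrow>\<^bsub>A\<^esub> x) = \<one>\<^bsub>A\<^esub>"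
    if C: "x \<in> carrier A" "y \<in> carrier A" for x y
    using identity[of "TInf ?x (TSup ?x ?y)" ?x "val x y x", OF _ val[OF C C(1)]]
      identity[of "TSup ?x (TInf ?x ?y)" ?x "val x y x", OF _ val[OF C C(1)]]
      identity[of "TSup (TImpl ?x ?y) (TImpl ?y ?x)" TOne "val x y x", OF _ val[OF C C(1)]]
    by (simp_all add: val_def W.inf_sup_absorb W.sup_inf_absorb W.prelinearity)
  have div: "x \<curlywedge>\<^bsub>A\<^esub> y = x \<otimes>\<^bsub>A\<^esub> (x \<rightarrow>\<^bsub>A\<^esub> y)"
    if C: "x \<in> carrier A" "y \<in> carrier A" for x y
    using identity[of "TInf ?x ?y" "TMult ?x (TImpl ?x ?y)" "val x y x", OF _ val[OF C C(1)]]
    by (simp add: val_def W.inf_hle)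
  have unit: "\<one>\<^bsub>A\<^esub> \<otimes>\<^bsub>A\<^esub> x = x" and zero: "\<zero>\<^bsub>A\<^esub> \<curlywedge>\<^bsub>A\<^esub> x = \<zero>\<^bsub>A\<^esub>" and one: "x \<curlywedge>\<^bsub>A\<^esub> \<one>\<^bsub>A\<^esub> = x"
    and refl: "x \<rightarrow>\<^bsub>A\<^esub> x = \<one>\<^bsub>A\<^esub>" and impl_one: "x \<rightarrow>\<^bsub>A\<^esub> \<one>\<^bsub>A\<^esub> = \<one>\<^bsub>A\<^esub>"
    if C: "x \<in> carrier A" for x
    using identity[of "TMult TOne ?x" ?x "val x x x", OF _ val[OF C C C]]
      identity[of "TInf TZero ?x" TZero "val x x x", OF _ val[OF C C C]]
      identity[of "TInf ?x TOne" ?x "val x x x", OF _ val[OF C C C]]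
      identity[of "TImpl ?x ?x" TOne "val x x x", OF _ val[OF C C C]]
      identity[of "TImpl ?x TOne" TOne "val x x x", OF _ val[OF C C C]]
      W.zero_least[unfolded bl_le_def] W.one_greatest[unfolded bl_le_def]
    by (simp_all add: val_def W.impl_refl)
  have le: "x \<curlywedge>\<^bsub>A\<^esub> y = x \<longleftrightarrow> x \<rightarrow>\<^bsub>A\<^esub> y = \<one>\<^bsub>A\<^esub>" if C: "x \<in> carrier A" "y \<in> carrier A" for x y
  proof
    assume "x \<curlywedge>\<^bsub>A\<^esub> y = x"
    hence "x = (y \<rightarrow>\<^bsub>A\<^esub> x) \<otimes>\<^bsub>A\<^esub> y" using inf_comm[OF C] div[OF C(2,1)] mult_comm C by simp
    hence "x \<rightarrow>\<^bsub>A\<^esub> y = (y \<rightarrow>\<^bsub>A\<^esub> x) \<rightarrow>\<^bsub>A\<^esub> (y \<rightarrow>\<^bsub>A\<^esub> y)" using curry[of "y \<rightarrow>\<^bsub>A\<^esub> x" y y] C by simp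
    thus "x \<rightarrow>\<^bsub>A\<^esub> y = \<one>\<^bsub>A\<^esub>" using refl impl_one C by simp
  next
    assume "x \<rightarrow>\<^bsub>A\<^esub> y = \<one>\<^bsub>A\<^esub>"
    thus "x \<curlywedge>\<^bsub>A\<^esub> y = x" using div[OF C] mult_comm[of x "\<one>\<^bsub>A\<^esub>"] unit C by simp
  qed
  have monoid: "comm_monoid A"
  proof (rule comm_monoidI)
    show "x \<otimes>\<^bsub>A\<^esub> y = y \<otimes>\<^bsub>A\<^esub> x" if "x \<in> carrier A" "y \<in> carrier A" for x y
      using that by (rule mult_comm)
  qed (simp_all add: mult_assoc unit)
  have "BL_algebra_axioms A"
  proof (rule BL_algebra_axioms.intro)
    show "bl_le A (z \<otimes>\<^bsub>A\<^esub> x) y \<longleftrightarrow> bl_le A z (x \<rightarrow>\<^bsub>A\<^esub> y)"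
      if "x \<in> carrier A" "y \<in> carrier A" "z \<in> carrier A" for x y z
      using that by (simp add: bl_le_def le curry)
    show "x \<curlywedge>\<^bsub>A\<^esub> y = y \<curlywedge>\<^bsub>A\<^esub> x" "x \<curlyvee>\<^bsub>A\<^esub> y = y \<curlyvee>\<^bsub>A\<^esub> x"
      if "x \<in> carrier A" "y \<in> carrier A" for x y
      using inf_comm[OF that] sup_comm[OF that] by this+
    show "x \<curlywedge>\<^bsub>A\<^esub> y = x \<otimes>\<^bsub>A\<^esub> (x \<rightarrow>\<^bsub>A\<^esub> y)"
      if "x \<in> carrier A" "y \<in> carrier A" for x y
      using that by (rule div)
  qed (simp_all add: bl_le_def inf_assoc sup_assoc absorb1 absorb2 prelin zero one)
  hence "BL_algebra A" using monoid by (simp add: BL_algebra_def)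
  moreover have "fm_eval A v \<phi> = \<one>\<^bsub>A\<^esub>" if "\<phi> \<in> BL_Chang" "range v \<subseteq> carrier A" for \<phi> v
  proof -
    have "term_eval A v (term_of_fm \<phi>) = term_eval A v TOne"
      using omegaV_L_algebra that unfolding L_algebra_def
      by (intro identity) (auto simp: term_eval_term_of_fm image_subset_iff)
    thus ?thesis by (simp add: term_eval_term_of_fm)
  qed
  ultimately show "A \<in> BL_Chang_algebras"
    unfolding BL_Chang_algebras_def L_algebra_def by blast
qed

lemma BL_Chang_variety: "BL_Chang_algebras = variety omegaV_identities"
  using BL_Chang_algebra_identities variety_BL_Chang by blast

lemma ordinal_sums_subset: "ordinal_sums_of_perfect_MV_chains \<subseteq> BL_Chang_algebras"
  using L_algebra_BL_Chang ordinal_sum_of_perfect by (auto simp: BL_Chang_algebras_def)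

section \<open>Varieties\<close>

lemma term_eval_closed:
  assumes "bl_closed S A" "range v \<subseteq> S" shows "term_eval A v t \<in> S"
  using assms by (induction t) (auto simp: bl_closed_def)

lemma term_eval_carrier_update [simp]: "term_eval (A\<lparr>carrier := S\<rparr>) v t = term_eval A v t"
  by (induction t) simp_all

lemma term_eval_product:
  assumes v: "range v \<subseteq> carrier (bl_product J B)"
  shows "term_eval (bl_product J B) v t = (\<lambda>j\<in>J. term_eval (B j) (\<lambda>n. v n j) t)"
proof (induction t)
  case (TVar n)
  have "v n \<in> (\<Pi>\<^sub>E j\<in>J. carrier (B j))" using v by (auto simp: bl_product_def)
  thus ?case by (auto simp: PiE_iff extensional_def fun_eq_iff)
qed (auto simp: bl_product_def fun_eq_iff)

lemma term_eval_hom: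
  assumes h: "h \<in> bl_hom A B" and c: "bl_closed (carrier A) A" and v: "range v \<subseteq> carrier A"
  shows "h (term_eval A v t) = term_eval B (h \<circ> v) t"
  using term_eval_closed[OF c v] h by (induction t) (simp_all add: bl_hom_def)

lemma HSP_subset_variety:
  fixes K :: "'b bl set"
  assumes K: "K \<subseteq> variety E"
  shows "HSP TYPE('j) K \<subseteq> (variety E :: 'a bl set)"
proof
  fix B :: "'a bl" assume "B \<in> HSP TYPE('j) K"
  then obtain J :: "'j set" and F S h where F: "\<forall>j\<in>J. F j \<in> K"
    and S: "S \<subseteq> carrier (bl_product J F)" "bl_closed S (bl_product J F)"
    and h: "h \<in> bl_hom ((bl_product J F)\<lparr>carrier := S\<rparr>) B" "h ` S = carrier B"
    unfolding HSP_def hom_images_def subalgebras_def direct_products_def by auto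
  let ?P = "bl_product J F" and ?A = "(bl_product J F)\<lparr>carrier := S\<rparr>"
  have cA: "bl_closed (carrier ?A) ?A" using S(2) by (simp add: bl_closed_def)
  have "bl_closed (carrier B) B"
    using S(2) h(1) unfolding bl_closed_def h(2)[symmetric] by (auto simp: bl_hom_def) (metis imageI)+
  moreover have "term_eval B w s = term_eval B w t" if st: "(s, t) \<in> E" and w: "range w \<subseteq> carrier B" for s t w
  proof -
    define v where "v n = inv_into S h (w n)" for n
    have "w n \<in> h ` S" for n using w h(2) by auto
    hence v: "v n \<in> S" "h (v n) = w n" for n
      by (simp_all add: v_def inv_into_into f_inv_into_f)
    hence vP: "range v \<subseteq> carrier ?P" and vA: "range v \<subseteq> carrier ?A" and hv: "h \<circ> v = w" using S(1) by auto
    have "term_eval (F j) (\<lambda>n. v n j) s = term_eval (F j) (\<lambda>n. v n j) t" if j: "j \<in> J" for j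
    proof -
      have "F j \<in> variety E" using F K j by auto
      moreover have "range (\<lambda>n. v n j) \<subseteq> carrier (F j)"
        using vP j by (auto simp: bl_product_def PiE_iff image_subset_iff)
      ultimately show ?thesis using st by (auto simp: variety_def)
    qed
    hence "term_eval ?A v s = term_eval ?A v t"
      by (simp add: term_eval_product[OF vP] cong: restrict_cong)
    thus ?thesis using term_eval_hom[OF h(1) cA vA] hv by metis
  qed
  ultimately show "B \<in> variety E" unfolding variety_def by blast
qed

primrec rename :: "(nat \<Rightarrow> nat) \<Rightarrow> bl_term \<Rightarrow> bl_term" where
  "rename \<sigma> (TVar n) = TVar (\<sigma> n)"
| "rename \<sigma> TZero = TZero"
| "rename \<sigma> TOne = TOne"
| "rename \<sigma> (TMult s t) = TMult (rename \<sigma> s) (rename \<sigma> t)"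
| "rename \<sigma> (TImpl s t) = TImpl (rename \<sigma> s) (rename \<sigma> t)"
| "rename \<sigma> (TInf s t) = TInf (rename \<sigma> s) (rename \<sigma> t)"
| "rename \<sigma> (TSup s t) = TSup (rename \<sigma> s) (rename \<sigma> t)"

lemma term_eval_rename: "term_eval A v (rename \<sigma> t) = term_eval A (v \<circ> \<sigma>) t"
  by (induction t) simp_all

text \<open>Birkhoff's argument with a single generating algebra \<open>W\<close>. A term with parameters from \<open>A\<close> yields the
  tuple of its values under all assignments \<open>A \<Rightarrow> W\<close>. These tuples form a subalgebra of a power of \<open>W\<close>, and
  sending a tuple to the value of the term in \<open>A\<close> is a well-defined homomorphism, because terms with
  equal tuples form an identity of \<open>W\<close>.\<close>

theorem variety_subset_HSP:
  fixes W :: "'b bl"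
  assumes W: "W \<in> K" "bl_closed (carrier W) W"
    and A: "A \<in> variety {(s, t). \<forall>v. range v \<subseteq> carrier W \<longrightarrow> term_eval W v s = term_eval W v t}"
  shows "(A :: 'a bl) \<in> HSP TYPE('a \<Rightarrow> 'b) K"
proof -
  define J where "J = {v :: 'a \<Rightarrow> 'b. range v \<subseteq> carrier W}"
  define P where "P = bl_product J (\<lambda>_. W)"
  define tuple where "tuple t f = (\<lambda>v\<in>J. term_eval W (v \<circ> f) t)" for t and f :: "nat \<Rightarrow> 'a"
  define S where "S = {tuple t f | t f. range f \<subseteq> carrier A}"
  have cA: "bl_closed (carrier A) A" using A by (simp add: variety_def)
  have same: "term_eval A f t = term_eval A f s"
    if eq: "tuple t f = tuple s f" and f: "range f \<subseteq> carrier A" for s t f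
  proof -
    \<comment> \<open>equal parameters must be instantiated equally, so each variable is replaced by the first one with
      the same parameter\<close>
    define \<sigma> where "\<sigma> n = (LEAST m. f m = f n)" for n
    have "f (\<sigma> n) = f n" for n unfolding \<sigma>_def by (rule LeastI[of "\<lambda>m. f m = f n" n]) (rule refl)
    hence f\<sigma>: "f \<circ> \<sigma> = f" by auto
    have "term_eval W w (rename \<sigma> t) = term_eval W w (rename \<sigma> s)" if w: "range w \<subseteq> carrier W" for w
    proof -
      define v where "v a = w (LEAST m. f m = a)" for a
      have vJ: "v \<in> J" using w by (auto simp: J_def v_def)
      have "v \<circ> f = w \<circ> \<sigma>" by (auto simp: v_def \<sigma>_def)
      thus ?thesis using fun_cong[OF eq, of v] vJ by (simp add: tuple_def term_eval_rename)
    qed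
    hence "term_eval A f (rename \<sigma> t) = term_eval A f (rename \<sigma> s)"
      using A f unfolding variety_def by blast
    thus ?thesis by (simp add: term_eval_rename f\<sigma>)
  qed
  have join: "\<exists>k. range k \<subseteq> carrier A \<and> (\<exists>t'. tuple t f = tuple t' k \<and> term_eval A f t = term_eval A k t')
      \<and> (\<exists>s'. tuple s g = tuple s' k \<and> term_eval A g s = term_eval A k s')"
    if fg: "range f \<subseteq> carrier A" "range g \<subseteq> carrier A" for s t f g
  proof -
    \<comment> \<open>two terms are given common parameters by using even and odd variables\<close>
    define k where "k n = (if even n then f (n div 2) else g (n div 2))" for n
    have "k \<circ> (\<lambda>n. 2 * n) = f" "k \<circ> (\<lambda>n. Suc (2 * n)) = g" by (auto simp: k_def)
    hence "tuple t f = tuple (rename (\<lambda>n. 2 * n) t) k" "tuple s g = tuple (rename (\<lambda>n. Suc (2 * n)) s) k"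
      "term_eval A f t = term_eval A k (rename (\<lambda>n. 2 * n) t)"
      "term_eval A g s = term_eval A k (rename (\<lambda>n. Suc (2 * n)) s)"
      by (simp_all add: tuple_def term_eval_rename comp_assoc)
    moreover have "range k \<subseteq> carrier A" using fg by (auto simp: k_def)
    ultimately show ?thesis by blast
  qed
  define h where "h X = (THE a. \<exists>t f. range f \<subseteq> carrier A \<and> X = tuple t f \<and> a = term_eval A f t)" for X
  have h: "h (tuple t f) = term_eval A f t" if f: "range f \<subseteq> carrier A" for t f
    unfolding h_def
  proof (rule the_equality)
    fix a assume "\<exists>s g. range g \<subseteq> carrier A \<and> tuple t f = tuple s g \<and> a = term_eval A g s"
    then obtain s g where g: "range g \<subseteq> carrier A" "tuple t f = tuple s g" "a = term_eval A g s" by blast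
    from join[OF f g(1), of t s] obtain k t' s' where "range k \<subseteq> carrier A" "tuple t f = tuple t' k"
      "term_eval A f t = term_eval A k t'" "tuple s g = tuple s' k" "term_eval A g s = term_eval A k s'" by blast
    thus "a = term_eval A f t" using same[of t' k s'] g by simp
  qed (use f in blast)
  have tuple_ops: "tuple TOne f = \<one>\<^bsub>P\<^esub>" "tuple TZero f = \<zero>\<^bsub>P\<^esub>"
    "tuple (TMult s t) f = tuple s f \<otimes>\<^bsub>P\<^esub> tuple t f" "tuple (TImpl s t) f = tuple s f \<rightarrow>\<^bsub>P\<^esub> tuple t f"
    "tuple (TInf s t) f = tuple s f \<curlywedge>\<^bsub>P\<^esub> tuple t f" "tuple (TSup s t) f = tuple s f \<curlyvee>\<^bsub>P\<^esub> tuple t f" for s t f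
    by (auto simp: tuple_def P_def bl_product_def fun_eq_iff)
  have pair: "\<exists>k s t. range k \<subseteq> carrier A \<and> X = tuple s k \<and> Y = tuple t k" if "X \<in> S" "Y \<in> S" for X Y
    using that join unfolding S_def by (clarify) meson
  have one: "range (\<lambda>_::nat. \<one>\<^bsub>A\<^esub>) \<subseteq> carrier A" using cA by (auto simp: bl_closed_def)
  have S_intro: "tuple t f \<in> S" if "range f \<subseteq> carrier A" for t f using that by (auto simp: S_def)
  have closed: "bl_closed S P"
    unfolding bl_closed_def
  proof (intro conjI ballI)
    show "\<one>\<^bsub>P\<^esub> \<in> S" "\<zero>\<^bsub>P\<^esub> \<in> S" using S_intro[OF one] by (metis tuple_ops(1,2))+
    fix X Y assume "X \<in> S" "Y \<in> S"
    from pair[OF this] obtain k s t where k: "range k \<subseteq> carrier A" "X = tuple s k" "Y = tuple t k" by blast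
    show "X \<otimes>\<^bsub>P\<^esub> Y \<in> S" "X \<rightarrow>\<^bsub>P\<^esub> Y \<in> S" "X \<curlywedge>\<^bsub>P\<^esub> Y \<in> S" "X \<curlyvee>\<^bsub>P\<^esub> Y \<in> S"
      unfolding k(2,3) tuple_ops(3-6)[symmetric] by (rule S_intro[OF k(1)])+
  qed
  have hom: "h \<in> bl_hom (P\<lparr>carrier := S\<rparr>) A"
  proof -
    have ops: "h (X \<otimes>\<^bsub>P\<^esub> Y) = h X \<otimes>\<^bsub>A\<^esub> h Y \<and> h (X \<rightarrow>\<^bsub>P\<^esub> Y) = h X \<rightarrow>\<^bsub>A\<^esub> h Y \<and>
        h (X \<curlywedge>\<^bsub>P\<^esub> Y) = h X \<curlywedge>\<^bsub>A\<^esub> h Y \<and> h (X \<curlyvee>\<^bsub>P\<^esub> Y) = h X \<curlyvee>\<^bsub>A\<^esub> h Y" if "X \<in> S" "Y \<in> S" for X Y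
    proof -
      from pair[OF that] obtain k s t where k: "range k \<subseteq> carrier A" "X = tuple s k" "Y = tuple t k" by blast
      show ?thesis unfolding k(2,3) tuple_ops(3-6)[symmetric] by (simp add: h[OF k(1)])
    qed
    have "h \<one>\<^bsub>P\<^esub> = \<one>\<^bsub>A\<^esub>" "h \<zero>\<^bsub>P\<^esub> = \<zero>\<^bsub>A\<^esub>"
      using h[OF one, of TOne] h[OF one, of TZero] by (simp_all add: tuple_ops)
    moreover have "h X \<in> carrier A" if "X \<in> S" for X
      using that h term_eval_closed[OF cA] by (auto simp: S_def)
    ultimately show ?thesis using ops by (simp add: bl_hom_def)
  qed
  have onto: "h ` S = carrier A"
  proof
    show "h ` S \<subseteq> carrier A" using hom by (auto simp: bl_hom_def)
    show "carrier A \<subseteq> h ` S"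
    proof
      fix a assume a: "a \<in> carrier A"
      hence f: "range (\<lambda>_::nat. a) \<subseteq> carrier A" by auto
      show "a \<in> h ` S" using h[OF f, of "TVar 0"] S_intro[OF f, of "TVar 0"] by (metis image_eqI term_eval.simps(1))
    qed
  qed
  have "S \<subseteq> carrier P"
  proof
    fix X assume "X \<in> S"
    then obtain t f where X: "X = tuple t f" by (auto simp: S_def)
    have "term_eval W (v \<circ> f) t \<in> carrier W" if "v \<in> J" for v
      using that by (intro term_eval_closed[OF W(2)]) (auto simp: J_def)
    thus "X \<in> carrier P" by (auto simp: X tuple_def P_def bl_product_def)
  qed
  moreover have "P \<in> direct_products K" using W by (auto simp: P_def direct_products_def)
  ultimately have "P\<lparr>carrier := S\<rparr> \<in> subalgebras (direct_products K)"
    using closed unfolding subalgebras_def by (intro CollectI exI[of _ P] exI[of _ S]) simp_all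
  moreover have "h ` carrier (P\<lparr>carrier := S\<rparr>) = carrier A" using onto by simp
  ultimately show ?thesis
    unfolding HSP_def hom_images_def by (intro CollectI bexI[of _ "P\<lparr>carrier := S\<rparr>"] bexI[of _ h] hom)
qed

section \<open>The variety of the Chang logic\<close>

theorem theorem3p9:
  shows "finitely_strongly_complete BL_Chang omegaV
    \<and> (BL_Chang_algebras :: 'a bl set)
        \<subseteq> HSP TYPE('a \<Rightarrow> omegaV_elem) (ordinal_sums_of_perfect_MV_chains :: omegaV_elem bl set)
    \<and> HSP TYPE('j) (ordinal_sums_of_perfect_MV_chains :: ('i \<times> 'b) option bl set)
        \<subseteq> (BL_Chang_algebras :: 'a bl set)
    \<and> (\<exists>E0.
          (BL_Chang_algebras :: 'a bl set) = variety E0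
        \<and> (BL_Chang_algebras :: ('i \<times> 'b) option bl set) = variety E0
        \<and> (ordinal_sums_of_perfect_MV_chains :: ('i \<times> 'b) option bl set) \<subseteq> variety E0
        \<and> (\<forall>E. (ordinal_sums_of_perfect_MV_chains :: omegaV_elem bl set) \<subseteq> variety E
              \<longrightarrow> (variety E0 :: 'a bl set) \<subseteq> variety E))"
proof (intro conjI exI[of _ omegaV_identities] allI impI)
  have "omegaV \<in> BL_Chang_algebras" using ordinal_sums_subset omegaV_in_sums by blast
  hence closed: "bl_closed (carrier omegaV) omegaV" unfolding BL_Chang_variety by (simp add: variety_def)
  show "finitely_strongly_complete BL_Chang omegaV" by (rule finite_strong_completeness)
  show "(BL_Chang_algebras :: 'a bl set)
      \<subseteq> HSP TYPE('a \<Rightarrow> omegaV_elem) (ordinal_sums_of_perfect_MV_chains :: omegaV_elem bl set)"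
    using variety_subset_HSP[OF omegaV_in_sums closed]
    unfolding BL_Chang_variety omegaV_identities_def by blast
  show "HSP TYPE('j) (ordinal_sums_of_perfect_MV_chains :: ('i \<times> 'b) option bl set)
      \<subseteq> (BL_Chang_algebras :: 'a bl set)"
    using HSP_subset_variety ordinal_sums_subset unfolding BL_Chang_variety by blast
  show "(ordinal_sums_of_perfect_MV_chains :: ('i \<times> 'b) option bl set) \<subseteq> variety omegaV_identities"
    using ordinal_sums_subset unfolding BL_Chang_variety .
  fix E assume E: "(ordinal_sums_of_perfect_MV_chains :: omegaV_elem bl set) \<subseteq> variety E"
  hence "omegaV \<in> variety E" using omegaV_in_sums by blast
  hence "E \<subseteq> omegaV_identities" by (auto simp: variety_def omegaV_identities_def)
  thus "(variety omegaV_identities :: 'a bl set) \<subseteq> variety E" unfolding variety_def by fast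
qed (fact BL_Chang_variety)+

end
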